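(* Let $p>1$ and let $(u,v)$ be a global solution of the system $$\partial_t u=\partial_x v,\qquad \partial_t v=(1-\partial_x^2)^{-1}\partial_x\left(u+|u|^{p-1}u\right),\qquad (t,x)\in\mathbb{R}\times\mathbb{R},$$ in the class $C(\mathbb{R},H^1(\mathbb{R})\times H^2(\mathbb{R}))\cap L^\infty(\mathbb{R},H^1(\mathbb{R})\times H^2(\mathbb{R}))$, not necessarily small in norm. Then for any sufficiently large $L$, $$\int_2^\infty\int_{-L}^{L}\left(v^2+u\,(1-\partial_x^2)^{-1}u+|u|^{p+1}\right)(t,x)\,dx\,dt\lesssim 1 .$$ Moreover, for any bounded interval $I\subset\mathbb{R}$, $$\lim_{t\to\infty}\|(u,v)(t)\|_{(L^2\times H^1)(I)}=0 .$$
   Context: The functions $u=u(t,x)$, $v=v(t,x)$ are real-valued. A global solution in $C(\mathbb{R},H^1\times H^2)$ is a pair satisfying both equations for all $t\in\mathbb{R}$. The operator $(1-\partial_x^2)^{-1}$ is the inverse of $1-\partial_x^2$ on $\mathbb{R}$: for $w\in L^2(\mathbb{R})$, $(1-\partial_x^2)^{-1}w$ is the unique $f\in H^2(\mathbb{R})$ with $f-\partial_x^2 f=w$. For an interval $I$, $\|(u,v)\|_{(L^2\times H^1)(I)}^2=\int_I\left(u^2+v^2+(\partial_x v)^2\right)dx$. Here $A\lesssim 1$ means $A\le C$ for a finite constant $C$, which may depend on $L$, $p$ and the solution. *)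

theory Defs
  imports "HOL-Analysis.Analysis"
begin

text \<open>
  Elements of the spaces \<open>L\<^sup>2\<close>, \<open>H\<^sup>1\<close>, \<open>H\<^sup>2\<close> on the real line are represented by functions, not by
  classes modulo null sets; everything below depends on a representative only up to a null set.
\<close>

definition L2 :: "(real \<Rightarrow> real) set" where
  "L2 = {f \<in> borel_measurable lebesgue. integrable lebesgue (\<lambda>x. (f x)\<^sup>2)}"

definition L2_norm :: "(real \<Rightarrow> real) \<Rightarrow> real" where
  "L2_norm f = sqrt (LINT x|lebesgue. (f x)\<^sup>2)"

definition locally_integrable :: "(real \<Rightarrow> real) \<Rightarrow> bool" where
  "locally_integrable f \<longleftrightarrow> (\<forall>a b. set_integrable lebesgue {a..b} f)"

definition test_function :: "(real \<Rightarrow> real) \<Rightarrow> bool" where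
  "test_function \<phi> \<longleftrightarrow> (\<forall>n x. (deriv ^^ n) \<phi> differentiable (at x)) \<and> compact (closure {x. \<phi> x \<noteq> 0})"

definition has_weak_deriv :: "(real \<Rightarrow> real) \<Rightarrow> (real \<Rightarrow> real) \<Rightarrow> bool" where
  "has_weak_deriv f g \<longleftrightarrow> locally_integrable f \<and> locally_integrable g \<and>
    (\<forall>\<phi>. test_function \<phi> \<longrightarrow> (LINT x|lebesgue. f x * deriv \<phi> x) = - (LINT x|lebesgue. g x * \<phi> x))"

text \<open>A choice among the weak derivatives of \<open>f\<close>, which agree almost everywhere.\<close>

definition weak_deriv :: "(real \<Rightarrow> real) \<Rightarrow> real \<Rightarrow> real" where
  "weak_deriv f = (SOME g. has_weak_deriv f g)"

definition H1 :: "(real \<Rightarrow> real) set" where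
  "H1 = {f \<in> L2. \<exists>g\<in>L2. has_weak_deriv f g}"

definition H2 :: "(real \<Rightarrow> real) set" where
  "H2 = {f \<in> L2. \<exists>g\<in>H1. has_weak_deriv f g}"

definition H1_norm :: "(real \<Rightarrow> real) \<Rightarrow> real" where
  "H1_norm f = sqrt ((L2_norm f)\<^sup>2 + (L2_norm (weak_deriv f))\<^sup>2)"

definition H2_norm :: "(real \<Rightarrow> real) \<Rightarrow> real" where
  "H2_norm f = sqrt ((L2_norm f)\<^sup>2 + (L2_norm (weak_deriv f))\<^sup>2
     + (L2_norm (weak_deriv (weak_deriv f)))\<^sup>2)"

text \<open>The operator \<open>(1 - \<partial>\<^sub>x\<^sup>2)\<inverse>\<close> on \<open>L\<^sup>2\<close>; the solution \<open>f\<close> is unique almost everywhere.\<close>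

definition inv_helmholtz :: "(real \<Rightarrow> real) \<Rightarrow> real \<Rightarrow> real" where
  "inv_helmholtz w =
    (SOME f. f \<in> H2 \<and> (AE x in lebesgue. f x - weak_deriv (weak_deriv f) x = w x))"

text \<open>Strong differentiability in \<open>L\<^sup>2\<close> of the curve \<open>w\<close> at time \<open>t\<close>.\<close>

definition has_time_deriv :: "(real \<Rightarrow> real \<Rightarrow> real) \<Rightarrow> (real \<Rightarrow> real) \<Rightarrow> real \<Rightarrow> bool" where
  "has_time_deriv w w' t \<longleftrightarrow>
    ((\<lambda>h. L2_norm (\<lambda>x. (w (t + h) x - w t x) / h - w' x)) \<longlongrightarrow> 0) (at 0)"

definition in_C_H1_H2 :: "(real \<Rightarrow> real \<Rightarrow> real) \<Rightarrow> (real \<Rightarrow> real \<Rightarrow> real) \<Rightarrow> bool" where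
  "in_C_H1_H2 u v \<longleftrightarrow> (\<forall>t. u t \<in> H1 \<and> v t \<in> H2) \<and>
    (\<forall>t. ((\<lambda>s. H1_norm (\<lambda>x. u s x - u t x)) \<longlongrightarrow> 0) (at t) \<and>
         ((\<lambda>s. H2_norm (\<lambda>x. v s x - v t x)) \<longlongrightarrow> 0) (at t))"

definition in_Linf_H1_H2 :: "(real \<Rightarrow> real \<Rightarrow> real) \<Rightarrow> (real \<Rightarrow> real \<Rightarrow> real) \<Rightarrow> bool" where
  "in_Linf_H1_H2 u v \<longleftrightarrow>
    (\<exists>M. AE t in lebesgue. u t \<in> H1 \<and> v t \<in> H2 \<and> H1_norm (u t) \<le> M \<and> H2_norm (v t) \<le> M)"

text \<open>
  The function \<open>u t + \<bar>u t\<bar>\<^sup>p\<^sup>-\<^sup>1 u t\<close> is in \<open>H\<^sup>1\<close> for \<open>p > 1\<close>, so that \<open>inv_helmholtz\<close> below is applied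
  to an element of \<open>L\<^sup>2\<close>.
\<close>

definition global_solution ::
  "real \<Rightarrow> (real \<Rightarrow> real \<Rightarrow> real) \<Rightarrow> (real \<Rightarrow> real \<Rightarrow> real) \<Rightarrow> bool" where
  "global_solution p u v \<longleftrightarrow> in_C_H1_H2 u v \<and>
    (\<forall>t. has_time_deriv u (weak_deriv (v t)) t \<and>
         has_time_deriv v
           (inv_helmholtz (weak_deriv (\<lambda>x. u t x + \<bar>u t x\<bar> powr (p - 1) * u t x))) t)"

definition L2_H1_norm_on :: "real set \<Rightarrow> (real \<Rightarrow> real) \<Rightarrow> (real \<Rightarrow> real) \<Rightarrow> real" where
  "L2_H1_norm_on I f g =
    sqrt (LINT x:I|lebesgue. (f x)\<^sup>2 + (g x)\<^sup>2 + (weak_deriv g x)\<^sup>2)"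

definition virial_density ::
  "real \<Rightarrow> (real \<Rightarrow> real) \<Rightarrow> (real \<Rightarrow> real) \<Rightarrow> real \<Rightarrow> real" where
  "virial_density p f g x = (g x)\<^sup>2 + f x * inv_helmholtz f x + \<bar>f x\<bar> powr (p + 1)"

end

theory Submission
  imports Defs
begin

text \<open>
  Write \<open>A = (1 - \<partial>\<^sub>x\<^sup>2)\<inverse>\<close>, \<open>f(u) = \<bar>u\<bar>\<^sup>p\<^sup>-\<^sup>1 u\<close> and \<open>c = (p - 1) / (p + 1)\<close>.
  For a bounded weight \<open>\<psi>\<close> with a bounded primitive \<open>\<phi>\<close>, the modified momentum
  \<open>X = - 2 \<integral> \<phi> u (v - v\<^sub>x\<^sub>x) + \<integral> \<psi> u v\<^sub>x\<close> satisfies the exact identity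
  \<open>X' = \<integral> \<psi> (v\<^sup>2 + u A u + u A f(u) + c \<bar>u\<bar>\<^sup>p\<^sup>+\<^sup>1)\<close> (lemma \<open>virial_identity\<close>): the flux of the momentum
  contains \<open>v\<^sub>x\<^sup>2\<close> with the wrong sign, and the second term of \<open>X\<close> cancels it.

  The term \<open>u A f(u)\<close> has no sign. But \<open>A\<close> has the kernel \<open>exp (- \<bar>x - y\<bar>) / 2\<close>, which is positive and
  of positive type, so that it is enough to compare \<open>a f(b) + b f(a)\<close> with a product: with
  \<open>g(s) = sgn s \<bar>s\<bar>\<^sup>(\<^sup>p\<^sup>+\<^sup>1\<^sup>)\<^sup>/\<^sup>2\<close>,
  \<open>a f(b) + b f(a) \<ge> 2 g(a) g(b) - c\<^sup>2 (\<bar>a\<bar>\<^sup>p\<^sup>+\<^sup>1 + \<bar>b\<bar>\<^sup>p\<^sup>+\<^sup>1)\<close> (lemma \<open>nonlin_cross_bound\<close>). Hence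
  \<open>\<integral> u A f(u) \<ge> - c\<^sup>2 \<integral> \<bar>u\<bar>\<^sup>p\<^sup>+\<^sup>1\<close>, and \<open>c\<^sup>2 < c\<close>. The weight \<open>\<chi>(x) = exp (- \<bar>x\<bar> / L)\<close> varies slowly
  enough that localising this estimate costs only a further \<open>1 / (L - 1)\<close> (lemma \<open>pairing_lower_bound\<close>).
  For large \<open>L\<close> the momentum \<open>X\<^sub>\<chi>\<close> is therefore increasing; it is bounded, so it converges.

  It follows that \<open>\<integral> \<chi> v\<^sup>2\<close> and \<open>\<integral> \<chi> (A u)\<^sup>2\<close> are integrable in time. They are Lipschitz in time, so they
  tend to zero (lemma \<open>barbalat\<close>), and integration by parts against the bounded higher norms gives the same
  for \<open>v\<^sub>x\<close> and \<open>u\<close>. This is the local decay.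

  The time integral over \<open>[- L, L]\<close> need not converge absolutely. The virial identity is applied once more, with
  the indicator of \<open>[- L, L]\<close> as weight. It has the same mass \<open>2 L\<close> as \<open>\<chi>\<close>, so the two primitives differ by a
  function that vanishes at infinity, and by the local decay the two momenta have the same limit. This gives
  convergence of the time integral of \<open>X'\<close>; the terms by which \<open>X'\<close> differs from the integral in the theorem
  are dominated by the integrable \<open>X\<^sub>\<chi>'\<close> (lemma \<open>sharp_density_has_integral\<close>).

  The functions of the statement are given up to null sets and with weak derivatives. They are replaced by locally
  absolutely continuous representatives, for which the product and chain rules and integration by parts hold.
\<close>

section \<open>Square integrable functions\<close>

definition ip :: "(real \<Rightarrow> real) \<Rightarrow> (real \<Rightarrow> real) \<Rightarrow> real" where
  "ip f g = (LINT x|lebesgue. f x * g x)"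

lemma L2_measurable: "f \<in> L2 \<Longrightarrow> f \<in> borel_measurable lebesgue"
  and L2_integrable_square: "f \<in> L2 \<Longrightarrow> integrable lebesgue (\<lambda>x. (f x)\<^sup>2)"
  by (auto simp: L2_def)

lemma L2_integrable_mult:
  assumes "f \<in> L2" "g \<in> L2"
  shows "integrable lebesgue (\<lambda>x. f x * g x)"
proof (rule Bochner_Integration.integrable_bound)
  show "integrable lebesgue (\<lambda>x. (f x)\<^sup>2 + (g x)\<^sup>2)"
    using assms by (intro Bochner_Integration.integrable_add L2_integrable_square)
  show "(\<lambda>x. f x * g x) \<in> borel_measurable lebesgue"
    using assms[THEN L2_measurable] by measurable
  have "\<bar>f x * g x\<bar> \<le> (f x)\<^sup>2 + (g x)\<^sup>2" for x
  proof -
    have "2 * (\<bar>f x\<bar> * \<bar>g x\<bar>) \<le> (f x)\<^sup>2 + (g x)\<^sup>2"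
      using sum_squares_bound[of "\<bar>f x\<bar>" "\<bar>g x\<bar>"] by (simp add: algebra_simps)
    moreover have "0 \<le> \<bar>f x\<bar> * \<bar>g x\<bar>" by simp
    ultimately show ?thesis unfolding abs_mult by linarith
  qed
  then show "AE x in lebesgue. norm (f x * g x) \<le> norm ((f x)\<^sup>2 + (g x)\<^sup>2)"
    by simp
qed

lemma L2_bounded_mult:
  assumes "f \<in> L2" and [measurable]: "w \<in> borel_measurable lebesgue" and "\<And>x. \<bar>w x\<bar> \<le> K"
  shows "(\<lambda>x. w x * f x) \<in> L2"
proof -
  have [measurable]: "f \<in> borel_measurable lebesgue" using assms(1) by (rule L2_measurable)
  have "integrable lebesgue (\<lambda>x. (w x * f x)\<^sup>2)"
  proof (rule Bochner_Integration.integrable_bound)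
    show "integrable lebesgue (\<lambda>x. K\<^sup>2 * (f x)\<^sup>2)"
      using L2_integrable_square[OF assms(1)] by simp
    have "(w x * f x)\<^sup>2 \<le> K\<^sup>2 * (f x)\<^sup>2" for x
      unfolding power_mult_distrib
      by (intro mult_right_mono) (use assms(3)[of x] in \<open>auto simp: abs_le_square_iff[symmetric]\<close>)
    then show "AE x in lebesgue. norm ((w x * f x)\<^sup>2) \<le> norm (K\<^sup>2 * (f x)\<^sup>2)"
      by simp
  qed measurable
  then show ?thesis by (simp add: L2_def)
qed

lemma L2_cmult: "f \<in> L2 \<Longrightarrow> (\<lambda>x. c * f x) \<in> L2"
  by (rule L2_bounded_mult[where K = "\<bar>c\<bar>"]) auto

lemma L2_uminus: "f \<in> L2 \<Longrightarrow> (\<lambda>x. - f x) \<in> L2"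
  using L2_cmult[of f "-1"] by simp

lemma L2_add:
  assumes "f \<in> L2" "g \<in> L2"
  shows "(\<lambda>x. f x + g x) \<in> L2"
proof -
  have [measurable]: "f \<in> borel_measurable lebesgue" "g \<in> borel_measurable lebesgue"
    using assms by (auto intro: L2_measurable)
  have "(\<lambda>x. (f x + g x)\<^sup>2) = (\<lambda>x. (f x)\<^sup>2 + (g x)\<^sup>2 + 2 * (f x * g x))"
    by (auto simp: power2_eq_square algebra_simps)
  then have "integrable lebesgue (\<lambda>x. (f x + g x)\<^sup>2)"
    using assms by (simp add: L2_integrable_square L2_integrable_mult)
  then show ?thesis by (simp add: L2_def)
qed

lemma L2_diff: "f \<in> L2 \<Longrightarrow> g \<in> L2 \<Longrightarrow> (\<lambda>x. f x - g x) \<in> L2"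
  using L2_add[of f "\<lambda>x. - g x"] L2_uminus[of g] by simp

lemma L2_divide: "f \<in> L2 \<Longrightarrow> (\<lambda>x. f x / c) \<in> L2"
  using L2_cmult[of f "1/c"] by simp

lemma L2_dominated:
  assumes "f \<in> L2" and [measurable]: "g \<in> borel_measurable lebesgue"
    and "\<And>x. \<bar>g x\<bar> \<le> \<bar>f x\<bar>"
  shows "g \<in> L2"
proof -
  have "integrable lebesgue (\<lambda>x. (g x)\<^sup>2)"
    by (rule Bochner_Integration.integrable_bound[OF L2_integrable_square[OF assms(1)]])
      (use assms(3) in \<open>auto simp: abs_le_square_iff\<close>)
  then show ?thesis by (simp add: L2_def)
qed

lemma L2_abs: "f \<in> L2 \<Longrightarrow> (\<lambda>x. \<bar>f x\<bar>) \<in> L2"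
  by (rule L2_dominated[of f]) (auto dest: L2_measurable)

lemma lebesgue_measurable_cong_AE:
  fixes f g :: "real \<Rightarrow> real"
  assumes "f \<in> borel_measurable lebesgue" and "AE x in lebesgue. f x = g x"
  shows "g \<in> borel_measurable lebesgue"
  using assms borel_measurable_AE by blast

lemma lebesgue_integrable_cong_AE:
  fixes f g :: "real \<Rightarrow> real"
  assumes "integrable lebesgue f" and "AE x in lebesgue. f x = g x"
  shows "integrable lebesgue g"
proof (rule integrable_cong_AE_imp[OF assms(1)])
  show "g \<in> borel_measurable lebesgue"
    using assms lebesgue_measurable_cong_AE by blast
  show "AE x in lebesgue. f x = g x" by (rule assms(2))
qed

lemma lebesgue_integral_cong_AE:
  fixes f g :: "real \<Rightarrow> real"
  assumes ae: "AE x in lebesgue. f x = g x"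
  shows "(LINT x|lebesgue. f x) = (LINT x|lebesgue. g x)"
proof (cases "f \<in> borel_measurable lebesgue")
  case True
  then show ?thesis
    using lebesgue_measurable_cong_AE[OF _ ae] ae by (intro integral_cong_AE) auto
next
  case False
  have ae': "AE x in lebesgue. g x = f x" using ae by eventually_elim simp
  have "g \<notin> borel_measurable lebesgue"
    using False lebesgue_measurable_cong_AE[OF _ ae'] by blast
  then show ?thesis
    using False borel_measurable_integrable[of lebesgue f] borel_measurable_integrable[of lebesgue g]
      not_integrable_integral_eq[of lebesgue f] not_integrable_integral_eq[of lebesgue g] by fastforce
qed

lemma L2_cong_AE:
  assumes "f \<in> L2" and ae: "AE x in lebesgue. f x = g x"
  shows "g \<in> L2"
proof -
  have "AE x in lebesgue. (f x)\<^sup>2 = (g x)\<^sup>2" using ae by eventually_elim simp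
  then have "integrable lebesgue (\<lambda>x. (g x)\<^sup>2)"
    using lebesgue_integrable_cong_AE[OF L2_integrable_square[OF assms(1)]] by simp
  then show ?thesis
    using lebesgue_measurable_cong_AE[OF L2_measurable[OF assms(1)] ae] by (simp add: L2_def)
qed

lemma ip_commute: "ip f g = ip g f"
  by (simp add: ip_def mult.commute)

lemma ip_add_left: "f \<in> L2 \<Longrightarrow> g \<in> L2 \<Longrightarrow> h \<in> L2 \<Longrightarrow> ip (\<lambda>x. f x + g x) h = ip f h + ip g h"
  and ip_diff_left: "f \<in> L2 \<Longrightarrow> g \<in> L2 \<Longrightarrow> h \<in> L2 \<Longrightarrow> ip (\<lambda>x. f x - g x) h = ip f h - ip g h"
  and ip_cmult_left: "ip (\<lambda>x. c * f x) h = c * ip f h"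
  and ip_divide_left: "ip (\<lambda>x. f x / c) h = ip f h / c"
  and ip_uminus_left: "ip (\<lambda>x. - f x) h = - ip f h"
  by (simp_all add: ip_def distrib_right left_diff_distrib mult.assoc L2_integrable_mult)

lemma ip_add_right: "f \<in> L2 \<Longrightarrow> g \<in> L2 \<Longrightarrow> h \<in> L2 \<Longrightarrow> ip h (\<lambda>x. f x + g x) = ip h f + ip h g"
  and ip_diff_right: "f \<in> L2 \<Longrightarrow> g \<in> L2 \<Longrightarrow> h \<in> L2 \<Longrightarrow> ip h (\<lambda>x. f x - g x) = ip h f - ip h g"
  and ip_cmult_right: "ip h (\<lambda>x. c * f x) = c * ip h f"
  by (simp_all add: ip_commute[of h] ip_add_left ip_diff_left ip_cmult_left)

lemma L2_norm_nonneg [simp]: "0 \<le> L2_norm f"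
  by (simp add: L2_norm_def)

lemma L2_norm_power2: "(L2_norm f)\<^sup>2 = ip f f"
  by (simp add: L2_norm_def ip_def power2_eq_square)

lemma ip_self_nonneg [simp]: "0 \<le> ip f f"
  unfolding L2_norm_power2[symmetric] by simp

lemma L2_norm_cong_AE:
  assumes ae: "AE x in lebesgue. f x = g x"
  shows "L2_norm f = L2_norm g"
proof -
  have "AE x in lebesgue. (f x)\<^sup>2 = (g x)\<^sup>2" using ae by eventually_elim simp
  then show ?thesis unfolding L2_norm_def by (simp only: lebesgue_integral_cong_AE)
qed

lemma ip_cong_AE:
  assumes "AE x in lebesgue. f x = f' x" "AE x in lebesgue. g x = g' x"
  shows "ip f g = ip f' g'"
proof -
  have "AE x in lebesgue. f x * g x = f' x * g' x" using assms by eventually_elim simp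
  then show ?thesis unfolding ip_def by (rule lebesgue_integral_cong_AE)
qed

lemma L2_norm_eq_0_imp_AE:
  assumes "f \<in> L2" "L2_norm f = 0"
  shows "AE x in lebesgue. f x = 0"
proof -
  have "(LINT x|lebesgue. (f x)\<^sup>2) = 0"
    using assms(2) by (simp add: L2_norm_def)
  then have "AE x in lebesgue. (f x)\<^sup>2 = 0"
    using integral_nonneg_eq_0_iff_AE[OF L2_integrable_square[OF assms(1)]] by simp
  then show ?thesis by eventually_elim simp
qed

lemma L2_norm_cmult: "L2_norm (\<lambda>x. c * f x) = \<bar>c\<bar> * L2_norm f"
  by (simp add: L2_norm_def power_mult_distrib real_sqrt_mult)

lemma L2_norm_uminus: "L2_norm (\<lambda>x. - f x) = L2_norm f"
  by (simp add: L2_norm_def)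

text \<open>
  Expand \<open>\<parallel> \<parallel>g\<parallel> f - \<parallel>f\<parallel> g \<parallel>\<^sup>2 \<ge> 0\<close>. In the degenerate cases one of the functions vanishes almost everywhere.
\<close>

lemma ip_le_norm:
  assumes f: "f \<in> L2" and g: "g \<in> L2"
  shows "ip f g \<le> L2_norm f * L2_norm g"
proof -
  let ?a = "L2_norm f" and ?b = "L2_norm g"
  consider "?a = 0" | "?b = 0" | "?a * ?b > 0"
    using L2_norm_nonneg[of f] L2_norm_nonneg[of g] by (cases "?a = 0"; cases "?b = 0") auto
  then show ?thesis
  proof cases
    case 1
    then have "AE x in lebesgue. f x = 0" using f by (rule L2_norm_eq_0_imp_AE[rotated])
    then have "ip f g = ip (\<lambda>x. 0) g" by (intro ip_cong_AE) auto
    then show ?thesis using 1 by (simp add: ip_def)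
  next
    case 2
    then have "AE x in lebesgue. g x = 0" using g by (rule L2_norm_eq_0_imp_AE[rotated])
    then have "ip f g = ip f (\<lambda>x. 0)" by (intro ip_cong_AE) auto
    then show ?thesis using 2 by (simp add: ip_def)
  next
    case 3
    have "0 \<le> ip (\<lambda>x. ?b * f x - ?a * g x) (\<lambda>x. ?b * f x - ?a * g x)" by simp
    also have "\<dots> = ?b\<^sup>2 * ip f f - 2 * (?a * ?b) * ip f g + ?a\<^sup>2 * ip g g"
      using f g by (simp add: ip_diff_left ip_diff_right L2_cmult L2_diff ip_cmult_left
          ip_cmult_right ip_commute[of g f] power2_eq_square algebra_simps)
    also have "\<dots> = 2 * (?a * ?b) * (?a * ?b - ip f g)"
      by (simp add: L2_norm_power2[symmetric] power2_eq_square algebra_simps)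
    finally show ?thesis using 3 by (simp add: zero_le_mult_iff)
  qed
qed

lemma abs_ip_le_norm: "f \<in> L2 \<Longrightarrow> g \<in> L2 \<Longrightarrow> \<bar>ip f g\<bar> \<le> L2_norm f * L2_norm g"
  using ip_le_norm[of f g] ip_le_norm[of "\<lambda>x. - f x" g]
  by (auto simp: ip_uminus_left L2_uminus L2_norm_uminus)

lemma L2_norm_add_le:
  assumes f: "f \<in> L2" and g: "g \<in> L2"
  shows "L2_norm (\<lambda>x. f x + g x) \<le> L2_norm f + L2_norm g"
proof (rule power2_le_imp_le)
  have "(L2_norm (\<lambda>x. f x + g x))\<^sup>2 = ip f f + 2 * ip f g + ip g g"
    using f g by (simp add: L2_norm_power2 ip_add_left ip_add_right L2_add ip_commute[of g f])
  also have "\<dots> \<le> (L2_norm f + L2_norm g)\<^sup>2"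
    using ip_le_norm[OF f g] by (simp add: L2_norm_power2[symmetric] power2_eq_square algebra_simps)
  finally show "(L2_norm (\<lambda>x. f x + g x))\<^sup>2 \<le> (L2_norm f + L2_norm g)\<^sup>2" .
qed simp

lemma L2_norm_diff_le:
  "f \<in> L2 \<Longrightarrow> g \<in> L2 \<Longrightarrow> L2_norm (\<lambda>x. f x - g x) \<le> L2_norm f + L2_norm g"
  using L2_norm_add_le[of f "\<lambda>x. - g x"] by (simp add: L2_uminus L2_norm_uminus)

lemma L2_norm_bounded_mult:
  assumes f: "f \<in> L2" and [measurable]: "w \<in> borel_measurable lebesgue" and w: "\<And>x. \<bar>w x\<bar> \<le> K"
  shows "L2_norm (\<lambda>x. w x * f x) \<le> K * L2_norm f"
proof -
  have K: "0 \<le> K" using w[of 0] by linarith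
  have "(LINT x|lebesgue. (w x * f x)\<^sup>2) \<le> (LINT x|lebesgue. (K * f x)\<^sup>2)"
  proof (rule integral_mono)
    show "integrable lebesgue (\<lambda>x. (w x * f x)\<^sup>2)"
      by (rule L2_integrable_square[OF L2_bounded_mult[OF assms]])
    show "integrable lebesgue (\<lambda>x. (K * f x)\<^sup>2)"
      by (rule L2_integrable_square[OF L2_cmult[OF f]])
    show "(w x * f x)\<^sup>2 \<le> (K * f x)\<^sup>2" for x
      unfolding power_mult_distrib
      by (intro mult_right_mono) (use w[of x] in \<open>auto simp: abs_le_square_iff[symmetric]\<close>)
  qed
  then have "L2_norm (\<lambda>x. w x * f x) \<le> L2_norm (\<lambda>x. K * f x)"
    by (simp add: L2_norm_def)
  then show ?thesis using K by (simp add: L2_norm_cmult)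
qed

lemma L2_norm_mono:
  assumes f: "f \<in> L2" and [measurable]: "g \<in> borel_measurable lebesgue"
    and le: "\<And>x. \<bar>g x\<bar> \<le> \<bar>f x\<bar>"
  shows "L2_norm g \<le> L2_norm f"
  unfolding L2_norm_def
  using L2_integrable_square[OF f] L2_integrable_square[OF L2_dominated[OF f _ le]] le
  by (intro real_sqrt_le_mono integral_mono) (auto simp: abs_le_square_iff)


section \<open>Locally absolutely continuous functions\<close>

text \<open>
  Local absolute continuity in the form in which it is used, the fundamental theorem of calculus. The derivative
  \<open>g\<close> matters only up to a null set, and no pointwise derivative occurs.
\<close>

definition ac_deriv :: "(real \<Rightarrow> real) \<Rightarrow> (real \<Rightarrow> real) \<Rightarrow> bool" where
  "ac_deriv f g \<longleftrightarrow> (\<forall>a b. a \<le> b \<longrightarrow>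
     set_integrable lebesgue {a..b} g \<and> f b - f a = (LINT x:{a..b}|lebesgue. g x))"

lemma ac_derivD:
  assumes "ac_deriv f g"
  shows "set_integrable lebesgue {a..b} g" "g integrable_on {a..b}"
    "a \<le> b \<Longrightarrow> f b - f a = integral {a..b} g"
    "a \<le> b \<Longrightarrow> (LINT x:{a..b}|lebesgue. g x) = f b - f a"
proof -
  show 1: "set_integrable lebesgue {a..b} g"
    using assms by (cases "a \<le> b") (auto simp: ac_deriv_def set_integrable_def)
  from set_lebesgue_integral_eq_integral[OF this] assms
  show "g integrable_on {a..b}" "a \<le> b \<Longrightarrow> f b - f a = integral {a..b} g"
    "a \<le> b \<Longrightarrow> (LINT x:{a..b}|lebesgue. g x) = f b - f a"
    by (auto simp: ac_deriv_def)
qed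

lemma ac_derivI:
  assumes "\<And>a b. a \<le> b \<Longrightarrow> set_integrable lebesgue {a..b} g"
    and "\<And>a b. a \<le> b \<Longrightarrow> f b - f a = integral {a..b} g"
  shows "ac_deriv f g"
  using assms set_lebesgue_integral_eq_integral(2)[OF assms(1)] by (auto simp: ac_deriv_def)

lemma ac_deriv_measurable:
  assumes "ac_deriv f g"
  shows "g \<in> borel_measurable lebesgue"
proof -
  have "(\<lambda>n. indicator {- real n..real n} x * g x) \<longlonglongrightarrow> g x" for x
  proof (rule tendsto_eventually)
    obtain N where N: "\<bar>x\<bar> \<le> real N" using real_arch_simple by blast
    show "\<forall>\<^sub>F n in sequentially. indicator {- real n..real n} x * g x = g x"
      using eventually_ge_at_top[of N] by eventually_elim (use N in \<open>auto simp: indicator_def\<close>)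
  qed
  moreover have "(\<lambda>x. indicator {- real n..real n} x * g x) \<in> borel_measurable lebesgue" for n
    using ac_derivD(1)[OF assms, of "- real n" "real n"]
    unfolding set_integrable_def by (auto dest: borel_measurable_integrable)
  ultimately show ?thesis by (rule borel_measurable_LIMSEQ_real)
qed

lemma ac_deriv_continuous:
  assumes "ac_deriv f g"
  shows "continuous_on UNIV f"
proof -
  have "isCont f x" for x
  proof -
    have "continuous_on {x - 1..x + 1} (\<lambda>y. f (x - 1) + integral {x - 1..y} g)"
      by (intro continuous_intros indefinite_integral_continuous_1 ac_derivD(2)[OF assms])
    then have "continuous_on {x - 1..x + 1} f"
      by (rule continuous_on_eq) (use ac_derivD(3)[OF assms, of "x - 1"] in force)
    then show ?thesis
      by (rule continuous_on_interior) auto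
  qed
  then show ?thesis by (simp add: continuous_at_imp_continuous_on)
qed

lemma ac_deriv_measurable_fun: "ac_deriv f g \<Longrightarrow> f \<in> borel_measurable lebesgue"
  by (simp add: ac_deriv_continuous borel_measurable_continuous_onI measurable_completion)

lemma ac_deriv_cong_AE:
  assumes "ac_deriv f g" and ae: "AE x in lebesgue. g x = h x"
  shows "ac_deriv f h"
proof -
  have "AE x in lebesgue. indicator {a..b} x *\<^sub>R g x = indicator {a..b} x *\<^sub>R h x" for a b :: real
    using ae by eventually_elim simp
  from lebesgue_integral_cong_AE[OF this] lebesgue_integrable_cong_AE[OF _ this] assms(1)
  show ?thesis unfolding ac_deriv_def set_integrable_def set_lebesgue_integral_def by auto
qed

lemma ac_deriv_const: "ac_deriv (\<lambda>x. c) (\<lambda>x. 0)"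
  by (simp add: ac_deriv_def set_integrable_def)

lemma ac_deriv_add: "ac_deriv f g \<Longrightarrow> ac_deriv f' g' \<Longrightarrow> ac_deriv (\<lambda>x. f x + f' x) (\<lambda>x. g x + g' x)"
  unfolding ac_deriv_def by (auto simp: algebra_simps)

lemma ac_deriv_cmult: "ac_deriv f g \<Longrightarrow> ac_deriv (\<lambda>x. c * f x) (\<lambda>x. c * g x)"
  unfolding ac_deriv_def by (auto simp: right_diff_distrib[symmetric])

lemma ac_deriv_uminus: "ac_deriv f g \<Longrightarrow> ac_deriv (\<lambda>x. - f x) (\<lambda>x. - g x)"
  using ac_deriv_cmult[of f g "-1"] by simp

lemma ac_deriv_diff: "ac_deriv f g \<Longrightarrow> ac_deriv f' g' \<Longrightarrow> ac_deriv (\<lambda>x. f x - f' x) (\<lambda>x. g x - g' x)"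
  using ac_deriv_add[of f g "\<lambda>x. - f' x" "\<lambda>x. - g' x"] ac_deriv_uminus[of f' g'] by simp

lemma ac_deriv_C1:
  assumes "\<And>x. (f has_real_derivative g x) (at x)" and "continuous_on UNIV g"
  shows "ac_deriv f g"
proof (rule ac_derivI)
  fix a b :: real assume ab: "a \<le> b"
  show "set_integrable lebesgue {a..b} g"
    using absolutely_integrable_continuous_real assms(2) continuous_on_subset by blast
  have "(g has_integral f b - f a) {a..b}"
    using assms(1) ab by (intro fundamental_theorem_of_calculus)
      (auto simp: has_real_derivative_iff_has_vector_derivative has_vector_derivative_at_within)
  then show "f b - f a = integral {a..b} g" by (simp add: integral_unique)
qed

text \<open>
  Errors that are small relative to the integral of a fixed function \<open>m\<close> add up under subdivision, so a comparison
  on short intervals around every point passes to the whole interval. The product rule and the chain rule are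
  proved in this way, by freezing coefficients, instead of by differentiation almost everywhere.
\<close>

lemma increment_eq_integral_of_local_approx:
  fixes H k m :: "real \<Rightarrow> real"
  assumes ab: "a \<le> b" and k: "k integrable_on {a..b}" and m: "m integrable_on {a..b}"
    and loc: "\<And>e x. 0 < e \<Longrightarrow> a \<le> x \<Longrightarrow> x \<le> b \<Longrightarrow>
      \<exists>d>0. \<forall>s t. a \<le> s \<and> s \<le> x \<and> x \<le> t \<and> t \<le> b \<and> t - s < d \<longrightarrow>
        \<bar>H t - H s - integral {s..t} k\<bar> \<le> e * integral {s..t} m"
  shows "H b - H a = integral {a..b} k"
proof -
  have main: "\<bar>H b - H a - integral {a..b} k\<bar> \<le> e * integral {a..b} m" if "0 < e" for e
  proof -
    define P where "P s t \<longleftrightarrow> (a \<le> s \<and> t \<le> b \<longrightarrow>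
       \<bar>H t - H s - integral {s..t} k\<bar> \<le> e * integral {s..t} m)" for s t
    have "P a b"
    proof (rule Bolzano[OF ab])
      fix r s t assume 1: "P r s" "P s t" "r \<le> s" "s \<le> t"
      show "P r t"
        unfolding P_def
      proof
        assume *: "a \<le> r \<and> t \<le> b"
        have "k integrable_on {r..t}" "m integrable_on {r..t}"
          using * 1 by (auto intro: integrable_on_subinterval[OF k] integrable_on_subinterval[OF m])
        then have "integral {r..t} k = integral {r..s} k + integral {s..t} k"
          "integral {r..t} m = integral {r..s} m + integral {s..t} m"
          using 1 by (auto simp: Henstock_Kurzweil_Integration.integral_combine)
        then show "\<bar>H t - H r - integral {r..t} k\<bar> \<le> e * integral {r..t} m"
          using 1 * by (simp add: P_def distrib_left)
      qed
    next
      fix x assume x: "a \<le> x" "x \<le> b"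
      show "\<exists>d>0. \<forall>s t. s \<le> x \<and> x \<le> t \<and> t - s < d \<longrightarrow> P s t"
        using loc[OF that x] unfolding P_def by metis
    qed
    then show ?thesis by (simp add: P_def)
  qed
  have "\<bar>H b - H a - integral {a..b} k\<bar> \<le> 0 + e" if "0 < e" for e
  proof -
    define c where "c = \<bar>integral {a..b} m\<bar> + 1"
    have c: "0 < c" by (simp add: c_def)
    have "\<bar>H b - H a - integral {a..b} k\<bar> \<le> e / c * integral {a..b} m"
      using main[of "e / c"] that c by simp
    also have "\<dots> \<le> e / c * c"
      using that c by (intro mult_left_mono) (auto simp: c_def)
    finally show ?thesis using c by simp
  qed
  then have "\<bar>H b - H a - integral {a..b} k\<bar> \<le> 0" by (rule field_le_epsilon)
  then show ?thesis by simp
qed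

lemma set_integrable_bounded_mult:
  fixes w g :: "real \<Rightarrow> real"
  assumes g: "set_integrable lebesgue S g" and [measurable]: "w \<in> borel_measurable lebesgue"
    and w: "\<And>x. x \<in> S \<Longrightarrow> \<bar>w x\<bar> \<le> K"
  shows "set_integrable lebesgue S (\<lambda>x. w x * g x)"
  unfolding set_integrable_def
proof (rule Bochner_Integration.integrable_bound)
  have [measurable]: "(\<lambda>x. indicator S x *\<^sub>R g x) \<in> borel_measurable lebesgue"
    using g unfolding set_integrable_def by (rule borel_measurable_integrable)
  show "integrable lebesgue (\<lambda>x. \<bar>K\<bar> * (indicator S x *\<^sub>R g x))"
    using g unfolding set_integrable_def by (rule integrable_mult_right)
  have "(\<lambda>x. w x * (indicator S x *\<^sub>R g x)) \<in> borel_measurable lebesgue"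
    by measurable
  then show "(\<lambda>x. indicator S x *\<^sub>R (w x * g x)) \<in> borel_measurable lebesgue"
    by (simp add: mult.left_commute)
  have "\<bar>indicator S x *\<^sub>R (w x * g x)\<bar> \<le> \<bar>\<bar>K\<bar> * (indicator S x *\<^sub>R g x)\<bar>" for x
    using w[of x] by (cases "x \<in> S") (auto simp: abs_mult intro!: mult_right_mono)
  then show "AE x in lebesgue. norm (indicator S x *\<^sub>R (w x * g x)) \<le> norm (\<bar>K\<bar> * (indicator S x *\<^sub>R g x))"
    by simp
qed

lemma continuous_lebesgue_measurable:
  fixes w :: "real \<Rightarrow> real"
  shows "continuous_on UNIV w \<Longrightarrow> w \<in> borel_measurable lebesgue"
  by (simp add: borel_measurable_continuous_onI measurable_completion)

lemma set_integrable_continuous_mult: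
  fixes w g :: "real \<Rightarrow> real"
  assumes "set_integrable lebesgue {a..b} g" and w: "continuous_on UNIV w"
  shows "set_integrable lebesgue {a..b} (\<lambda>x. w x * g x)"
proof -
  have "bounded (w ` {a..b})"
    using w by (intro compact_imp_bounded compact_continuous_image) (auto intro: continuous_on_subset)
  then obtain K where "\<And>x. x \<in> {a..b} \<Longrightarrow> \<bar>w x\<bar> \<le> K"
    unfolding bounded_iff by fastforce
  then show ?thesis
    by (intro set_integrable_bounded_mult[OF assms(1) continuous_lebesgue_measurable[OF w]]) auto
qed

text \<open>
  The hypothesis on short intervals of the preceding lemma: \<open>q\<close> is the integrand \<open>k\<close> with frozen coefficients,
  chosen so that it integrates exactly to the increment of \<open>H\<close>.
\<close>

lemma increment_approx:
  fixes q k m :: "real \<Rightarrow> real"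
  assumes "H t - H s = integral {s..t} q" "q integrable_on {s..t}" "k integrable_on {s..t}"
    "m integrable_on {s..t}" and le: "\<And>r. r \<in> {s..t} \<Longrightarrow> \<bar>q r - k r\<bar> \<le> e * m r"
  shows "\<bar>H t - H s - integral {s..t} k\<bar> \<le> e * integral {s..t} m"
proof -
  have "H t - H s - integral {s..t} k = integral {s..t} (\<lambda>r. q r - k r)"
    using assms by (simp add: Henstock_Kurzweil_Integration.integral_diff)
  also have "\<bar>\<dots>\<bar> \<le> integral {s..t} (\<lambda>r. e * m r)"
    using assms Henstock_Kurzweil_Integration.integral_norm_bound_integral[of "\<lambda>r. q r - k r" "{s..t}" "\<lambda>r. e * m r"]
    by (auto intro!: Henstock_Kurzweil_Integration.integrable_diff integrable_on_mult_right)
  finally show ?thesis by simp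
qed

lemma isCont_window:
  fixes f :: "real \<Rightarrow> real"
  assumes "isCont f x" "0 < e"
  shows "\<exists>d>0. \<forall>r r'. \<bar>r - x\<bar> < d \<longrightarrow> \<bar>r' - x\<bar> < d \<longrightarrow> \<bar>f r - f r'\<bar> < e"
proof -
  obtain d where d: "d > 0" "\<And>r. \<bar>r - x\<bar> < d \<Longrightarrow> \<bar>f r - f x\<bar> < e / 2"
    using assms unfolding continuous_at_eps_delta dist_real_def by (metis half_gt_zero)
  have "\<bar>f r - f r'\<bar> < e" if "\<bar>r - x\<bar> < d" "\<bar>r' - x\<bar> < d" for r r'
    using d(2)[OF that(1)] d(2)[OF that(2)] by (simp add: abs_if split: if_splits)
  with d(1) show ?thesis by blast
qed

lemma ac_deriv_isCont: "ac_deriv f g \<Longrightarrow> isCont f x"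
  using ac_deriv_continuous continuous_on_eq_continuous_at by blast

text \<open>
  Since \<open>f(t) g(t) - f(s) g(s) = (f(t) - f(s)) g(t) + f(s) (g(t) - g(s))\<close>, the increment is the integral of
  \<open>g(t) f' + f(s) g'\<close>, in which the frozen values are close to those of \<open>g\<close> and \<open>f\<close>.
\<close>

lemma ac_deriv_mult:
  assumes f: "ac_deriv f f'" and g: "ac_deriv g g'"
  shows "ac_deriv (\<lambda>x. f x * g x) (\<lambda>x. f' x * g x + f x * g' x)"
proof (rule ac_derivI)
  fix a b :: real assume ab: "a \<le> b"
  let ?k = "\<lambda>x. f' x * g x + f x * g' x" and ?m = "\<lambda>x. \<bar>f' x\<bar> + \<bar>g' x\<bar>"
  have int: "set_integrable lebesgue {s..t} ?k" "set_integrable lebesgue {s..t} ?m" for s t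
    using ac_derivD(1)[OF f, of s t] ac_derivD(1)[OF g, of s t]
      set_integrable_continuous_mult[OF ac_derivD(1)[OF f] ac_deriv_continuous[OF g], of s t]
      set_integrable_continuous_mult[OF ac_derivD(1)[OF g] ac_deriv_continuous[OF f], of s t]
    by (auto intro!: set_integral_add set_integrable_abs simp: mult.commute)
  show "set_integrable lebesgue {a..b} ?k" by (rule int)
  note hk = set_lebesgue_integral_eq_integral(1)
  show "f b * g b - f a * g a = integral {a..b} ?k"
  proof (rule increment_eq_integral_of_local_approx[OF ab hk hk, OF int])
    fix e x :: real assume e: "0 < e"
    obtain d1 where d1: "d1 > 0" "\<And>r r'. \<bar>r - x\<bar> < d1 \<Longrightarrow> \<bar>r' - x\<bar> < d1 \<Longrightarrow> \<bar>f r - f r'\<bar> < e"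
      using isCont_window[OF ac_deriv_isCont[OF f] e] by blast
    obtain d2 where d2: "d2 > 0" "\<And>r r'. \<bar>r - x\<bar> < d2 \<Longrightarrow> \<bar>r' - x\<bar> < d2 \<Longrightarrow> \<bar>g r - g r'\<bar> < e"
      using isCont_window[OF ac_deriv_isCont[OF g] e] by blast
    show "\<exists>d>0. \<forall>s t. a \<le> s \<and> s \<le> x \<and> x \<le> t \<and> t \<le> b \<and> t - s < d \<longrightarrow>
            \<bar>f t * g t - f s * g s - integral {s..t} ?k\<bar> \<le> e * integral {s..t} ?m"
    proof (intro exI[of _ "min d1 d2"] conjI allI impI)
      fix s t assume st: "a \<le> s \<and> s \<le> x \<and> x \<le> t \<and> t \<le> b \<and> t - s < min d1 d2"
      let ?q = "\<lambda>r. g t * f' r + f s * g' r"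
      show "\<bar>f t * g t - f s * g s - integral {s..t} ?k\<bar> \<le> e * integral {s..t} ?m"
      proof (rule increment_approx[OF _ _ hk[OF int(1)] hk[OF int(2)]])
        show "?q integrable_on {s..t}"
          using ac_derivD(2)[OF f] ac_derivD(2)[OF g]
          by (intro Henstock_Kurzweil_Integration.integrable_add integrable_on_mult_right)
        show "f t * g t - f s * g s = integral {s..t} ?q"
          using ac_derivD(2,3)[OF f, of s t] ac_derivD(2,3)[OF g, of s t] st
          by (simp add: Henstock_Kurzweil_Integration.integral_add integrable_on_mult_right
              flip: ac_derivD(3)[OF f]) (simp add: algebra_simps)
        fix r assume r: "r \<in> {s..t}"
        have "\<bar>g t - g r\<bar> \<le> e" "\<bar>f s - f r\<bar> \<le> e"
          using d1(2)[of s r] d2(2)[of t r] r st by (auto simp: less_imp_le abs_if)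
        then have "\<bar>(g t - g r) * f' r\<bar> + \<bar>(f s - f r) * g' r\<bar> \<le> e * \<bar>f' r\<bar> + e * \<bar>g' r\<bar>"
          unfolding abs_mult by (intro add_mono mult_right_mono) auto
        moreover have "?q r - ?k r = (g t - g r) * f' r + (f s - f r) * g' r"
          by (simp add: algebra_simps)
        ultimately show "\<bar>?q r - ?k r\<bar> \<le> e * ?m r"
          by (simp add: distrib_left)
      qed
    qed (use d1 d2 in auto)
  qed
qed

text \<open>
  The mean value theorem for \<open>P\<close> writes the increment as the integral of \<open>P'(y) f'\<close> with a value \<open>y\<close> of \<open>f\<close> near
  the given point.
\<close>

lemma ac_deriv_comp:
  assumes f: "ac_deriv f f'" and P: "\<And>y. (P has_real_derivative P' y) (at y)"
    and P': "continuous_on UNIV P'"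
  shows "ac_deriv (\<lambda>x. P (f x)) (\<lambda>x. P' (f x) * f' x)"
proof (rule ac_derivI)
  fix a b :: real assume ab: "a \<le> b"
  let ?k = "\<lambda>x. P' (f x) * f' x" and ?m = "\<lambda>x. \<bar>f' x\<bar>"
  have cont: "continuous_on UNIV (\<lambda>x. P' (f x))"
    using P' ac_deriv_continuous[OF f] by (auto intro: continuous_on_compose2)
  have int: "set_integrable lebesgue {s..t} ?k" "set_integrable lebesgue {s..t} ?m" for s t
    using ac_derivD(1)[OF f, of s t] set_integrable_continuous_mult[OF ac_derivD(1)[OF f] cont]
    by (auto intro!: set_integrable_abs)
  show "set_integrable lebesgue {a..b} ?k" by (rule int)
  note hk = set_lebesgue_integral_eq_integral(1)
  show "P (f b) - P (f a) = integral {a..b} ?k"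
  proof (rule increment_eq_integral_of_local_approx[OF ab hk hk, OF int])
    fix e x :: real assume e: "0 < e"
    have "isCont P' (f x)" using P' by (simp add: continuous_on_eq_continuous_at)
    then obtain c where c: "c > 0"
      "\<And>y y'. \<bar>y - f x\<bar> < c \<Longrightarrow> \<bar>y' - f x\<bar> < c \<Longrightarrow> \<bar>P' y - P' y'\<bar> < e"
      using isCont_window[OF _ e] by blast
    obtain d where d: "d > 0" "\<And>r r'. \<bar>r - x\<bar> < d \<Longrightarrow> \<bar>r' - x\<bar> < d \<Longrightarrow> \<bar>f r - f r'\<bar> < c"
      using isCont_window[OF ac_deriv_isCont[OF f] c(1)] by blast
    show "\<exists>d>0. \<forall>s t. a \<le> s \<and> s \<le> x \<and> x \<le> t \<and> t \<le> b \<and> t - s < d \<longrightarrow>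
            \<bar>P (f t) - P (f s) - integral {s..t} ?k\<bar> \<le> e * integral {s..t} ?m"
    proof (intro exI[of _ d] conjI allI impI)
      fix s t assume st: "a \<le> s \<and> s \<le> x \<and> x \<le> t \<and> t \<le> b \<and> t - s < d"
      have near: "\<bar>f r - f x\<bar> < c" if "r \<in> {s..t}" for r
        using d(2)[of r x] that st d(1) by auto
      \<comment> \<open>the mean value theorem for \<open>P\<close> between \<open>f s\<close> and \<open>f t\<close>\<close>
      obtain y where y: "P (f t) - P (f s) = P' y * (f t - f s)" "\<bar>y - f x\<bar> < c"
      proof -
        consider "f s < f t" | "f t < f s" | "f s = f t" by linarith
        then show ?thesis
        proof cases
          case 1
          obtain y where "f s < y" "y < f t" "P (f t) - P (f s) = (f t - f s) * P' y"
            using MVT2[OF 1 P] by blast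
          then show ?thesis
            using near[of s] near[of t] st by (intro that[of y]) (auto simp: abs_if split: if_splits)
        next
          case 2
          obtain y where "f t < y" "y < f s" "P (f s) - P (f t) = (f s - f t) * P' y"
            using MVT2[OF 2 P] by blast
          then show ?thesis
            using near[of s] near[of t] st
            by (intro that[of y]) (auto simp: abs_if algebra_simps split: if_splits)
        next
          case 3
          then show ?thesis using near[of s] st by (intro that[of "f s"]) auto
        qed
      qed
      let ?q = "\<lambda>r. P' y * f' r"
      show "\<bar>P (f t) - P (f s) - integral {s..t} ?k\<bar> \<le> e * integral {s..t} ?m"
      proof (rule increment_approx[OF _ _ hk[OF int(1)] hk[OF int(2)]])
        show "?q integrable_on {s..t}"
          using ac_derivD(2)[OF f] by (intro integrable_on_mult_right)
        show "P (f t) - P (f s) = integral {s..t} ?q"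
          using ac_derivD(2,3)[OF f, of s t] st y(1) by simp
        fix r assume r: "r \<in> {s..t}"
        have "\<bar>P' y - P' (f r)\<bar> \<le> e"
          using c(2)[OF y(2) near[OF r]] by simp
        then have "\<bar>P' y - P' (f r)\<bar> * \<bar>f' r\<bar> \<le> e * \<bar>f' r\<bar>"
          by (intro mult_right_mono) auto
        then show "\<bar>?q r - ?k r\<bar> \<le> e * ?m r"
          by (simp add: abs_mult[symmetric] left_diff_distrib)
      qed
    qed (use d in auto)
  qed
qed

lemma ac_deriv_exists:
  assumes "locally_integrable g"
  shows "\<exists>G. ac_deriv G g"
proof -
  define G where "G x = integral {0..x} g - integral {x..0} g" for x
  have si: "set_integrable lebesgue {a..b} g" for a b
    using assms by (simp add: locally_integrable_def)
  have ii: "g integrable_on {a..b}" for a b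
    using set_lebesgue_integral_eq_integral(1)[OF si] .
  have "ac_deriv G g"
  proof (rule ac_derivI[OF si])
    fix a b :: real assume ab: "a \<le> b"
    note comb = Henstock_Kurzweil_Integration.integral_combine[OF _ _ ii]
    have e: "integral {x..y} g = 0" if "y \<le> x" for x y
      using that by (cases "x = y") auto
    consider "0 \<le> a" | "a < 0" "0 \<le> b" | "b < 0" using ab by linarith
    then show "G b - G a = integral {a..b} g"
    proof cases
      case 1 then show ?thesis
        using ab comb[of 0 a b] e[of 0 a] e[of 0 b] by (simp add: G_def)
    next
      case 2 then show ?thesis
        using comb[of a 0 b] e[of a 0] e[of 0 b] by (simp add: G_def)
    next
      case 3 then show ?thesis
        using ab comb[of a b 0] e[of a 0] e[of b 0] by (simp add: G_def)
    qed
  qed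
  then show ?thesis by blast
qed

lemma L2_locally_integrable:
  assumes "f \<in> L2"
  shows "locally_integrable f"
  unfolding locally_integrable_def set_integrable_def
proof (intro allI)
  fix a b :: real
  have "integrable lebesgue (indicator {a..b} :: real \<Rightarrow> real)"
    by (simp add: lmeasurable_iff_integrable[symmetric])
  moreover have "(\<lambda>x. (indicator {a..b} x :: real)\<^sup>2) = indicator {a..b}"
    by (auto simp: indicator_def)
  ultimately have "(indicator {a..b} :: real \<Rightarrow> real) \<in> L2"
    by (simp add: L2_def)
  from L2_integrable_mult[OF this assms]
  show "integrable lebesgue (\<lambda>x. indicator {a..b} x *\<^sub>R f x)" by simp
qed

lemma ac_deriv_locally_integrable:
  assumes "ac_deriv f g"
  shows "locally_integrable f" "locally_integrable g"
  using ac_derivD(1)[OF assms] absolutely_integrable_continuous_real[OF continuous_on_subset[OF ac_deriv_continuous[OF assms]]]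
  unfolding locally_integrable_def by auto

text \<open>
  Otherwise \<open>\<bar>h\<bar> \<ge> e\<close> on intervals of arbitrary length.
\<close>

lemma integrable_small_somewhere:
  fixes h :: "real \<Rightarrow> real"
  assumes h: "integrable lebesgue h" and e: "0 < e"
  shows "\<exists>x>N. \<bar>h x\<bar> < e" "\<exists>x<N. \<bar>h x\<bar> < e"
proof -
  have main: "\<exists>x\<in>{a m..a m + real m}. \<bar>h x\<bar> < e"
    if m: "real m > (LINT x|lebesgue. \<bar>h x\<bar>) / e" for m and a :: "nat \<Rightarrow> real"
  proof (rule ccontr)
    assume "\<not> ?thesis"
    then have le: "e * indicator {a m..a m + real m} x \<le> \<bar>h x\<bar>" for x
      by (auto simp: indicator_def not_less)
    have "(LINT x|lebesgue. e * indicator {a m..a m + real m} x) \<le> (LINT x|lebesgue. \<bar>h x\<bar>)"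
      by (rule integral_mono[OF _ _ le]) (use h lmeasurable_iff_integrable[of "{a m..a m + real m}"] in auto)
    then have "e * real m \<le> (LINT x|lebesgue. \<bar>h x\<bar>)" by simp
    then show False using m e by (simp add: field_simps)
  qed
  obtain m where m: "real m > (LINT x|lebesgue. \<bar>h x\<bar>) / e"
    using reals_Archimedean2 by blast
  from main[OF m, of "\<lambda>_. N + 1"] show "\<exists>x>N. \<bar>h x\<bar> < e"
    by (metis atLeastAtMost_iff less_add_one order_less_le_trans)
  from main[OF m, of "\<lambda>m. N - 1 - real m"] show "\<exists>x<N. \<bar>h x\<bar> < e"
    by force
qed

text \<open>
  There are points arbitrarily far to the right and to the left at which \<open>h\<close> is small, and between two such points
  the integral of \<open>k\<close> is a difference of values of \<open>h\<close>.
\<close>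

lemma integral_ac_deriv_eq_0:
  assumes h: "ac_deriv h k" "integrable lebesgue h" "integrable lebesgue k"
  shows "(LINT x|lebesgue. k x) = 0"
proof -
  have "\<exists>x. real n < x \<and> \<bar>h x\<bar> < 1 / Suc n" "\<exists>x < - real n. \<bar>h x\<bar> < 1 / Suc n" for n
    using integrable_small_somewhere[OF h(2)] by auto
  then obtain x y where x: "\<And>n. real n < x n" "\<And>n. \<bar>h (x n)\<bar> < 1 / Suc n"
    and y: "\<And>n. y n < - real n" "\<And>n. \<bar>h (y n)\<bar> < 1 / Suc n" by metis
  have xy: "y n \<le> x n" for n using x(1)[of n] y(1)[of n] by linarith
  have lim0: "(\<lambda>n. 1 / real (Suc n)) \<longlonglongrightarrow> 0"
    using LIMSEQ_inverse_real_of_nat by (simp add: inverse_eq_divide)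
  have "(\<lambda>n. h (x n)) \<longlonglongrightarrow> 0" "(\<lambda>n. h (y n)) \<longlonglongrightarrow> 0"
    by (rule Lim_null_comparison[OF _ lim0], use x y in \<open>simp add: less_imp_le\<close>)+
  then have 1: "(\<lambda>n. h (x n) - h (y n)) \<longlonglongrightarrow> 0"
    using tendsto_diff by fastforce
  have "(\<lambda>n. LINT s|lebesgue. indicator {y n..x n} s *\<^sub>R k s) \<longlonglongrightarrow> (LINT s|lebesgue. k s)"
  proof (rule integral_dominated_convergence[where w = "\<lambda>s. \<bar>k s\<bar>"])
    show "AE s in lebesgue. (\<lambda>n. indicator {y n..x n} s *\<^sub>R k s) \<longlonglongrightarrow> k s"
    proof (intro AE_I2 tendsto_eventually)
      fix s :: real
      obtain N where N: "\<bar>s\<bar> \<le> real N" using real_arch_simple by blast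
      show "\<forall>\<^sub>F n in sequentially. indicator {y n..x n} s *\<^sub>R k s = k s"
        using eventually_ge_at_top[of N]
      proof eventually_elim
        fix n assume "N \<le> n"
        then have "s \<in> {y n..x n}" using N x(1)[of n] y(1)[of n] by auto
        then show "indicator {y n..x n} s *\<^sub>R k s = k s" by simp
      qed
    qed
    show "k \<in> borel_measurable lebesgue" by (rule borel_measurable_integrable[OF h(3)])
    show "(\<lambda>s. indicator {y n..x n} s *\<^sub>R k s) \<in> borel_measurable lebesgue" for n
      by (rule borel_measurable_integrable[OF integrable_mult_indicator[OF _ h(3)]]) simp
    show "AE s in lebesgue. norm (indicator {y n..x n} s *\<^sub>R k s) \<le> \<bar>k s\<bar>" for n
      by (auto simp: indicator_def)
  qed (use h(3) in auto)
  moreover have "(LINT s|lebesgue. indicator {y n..x n} s *\<^sub>R k s) = h (x n) - h (y n)" for n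
    using ac_derivD(4)[OF h(1) xy[of n]] by (simp add: set_lebesgue_integral_def)
  ultimately show ?thesis
    using 1 LIMSEQ_unique by auto
qed

lemma ip_deriv_left:
  assumes "ac_deriv f f'" "ac_deriv g g'" "f \<in> L2" "f' \<in> L2" "g \<in> L2" "g' \<in> L2"
  shows "ip f' g = - ip f g'"
proof -
  have "(LINT x|lebesgue. f' x * g x + f x * g' x) = 0"
    using assms by (intro integral_ac_deriv_eq_0[OF ac_deriv_mult[OF assms(1,2)]]
        Bochner_Integration.integrable_add L2_integrable_mult)
  then show ?thesis
    using assms by (simp add: ip_def L2_integrable_mult)
qed

text \<open>
  The Sobolev embedding in one dimension: \<open>(f\<^sup>2)' = 2 f f'\<close> is integrated from a point where \<open>f\<^sup>2\<close> is small.
\<close>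

lemma ac_deriv_square_bound:
  assumes f: "ac_deriv f f'" "f \<in> L2" "f' \<in> L2"
  shows "(f x)\<^sup>2 \<le> (L2_norm f)\<^sup>2 + (L2_norm f')\<^sup>2"
proof (rule field_le_epsilon)
  fix e :: real assume e: "0 < e"
  obtain y where y: "y < x" "\<bar>(f y)\<^sup>2\<bar> < e"
    using integrable_small_somewhere(2)[OF L2_integrable_square[OF f(2)] e] by blast
  have k: "ac_deriv (\<lambda>x. f x * f x) (\<lambda>x. f' x * f x + f x * f' x)"
    by (rule ac_deriv_mult[OF f(1) f(1)])
  have 2: "(\<lambda>x. (f x)\<^sup>2 + (f' x)\<^sup>2) absolutely_integrable_on S" if "S \<in> sets lebesgue" for S
    using f that unfolding set_integrable_def
    by (intro integrable_mult_indicator Bochner_Integration.integrable_add L2_integrable_square)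
  have "f x * f x - f y * f y = (LINT s:{y..x}|lebesgue. f' s * f s + f s * f' s)"
    using ac_derivD(4)[OF k, of y x] y by simp
  also have "\<dots> \<le> (LINT s:{y..x}|lebesgue. (f s)\<^sup>2 + (f' s)\<^sup>2)"
  proof (rule set_integral_mono[OF ac_derivD(1)[OF k] 2])
    fix s show "f' s * f s + f s * f' s \<le> (f s)\<^sup>2 + (f' s)\<^sup>2"
      using sum_squares_bound[of "f s" "f' s"] by (simp add: algebra_simps)
  qed simp
  also have "\<dots> \<le> (LINT s:UNIV|lebesgue. (f s)\<^sup>2 + (f' s)\<^sup>2)"
    using 2[of UNIV] 2[of "{y..x}"] unfolding set_lebesgue_integral_def set_integrable_def
    by (intro integral_mono) (auto simp: indicator_def)
  also have "\<dots> = (L2_norm f)\<^sup>2 + (L2_norm f')\<^sup>2"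
    using f by (simp add: set_lebesgue_integral_def L2_norm_power2 ip_def L2_integrable_square
        flip: power2_eq_square)
  finally show "(f x)\<^sup>2 \<le> (L2_norm f)\<^sup>2 + (L2_norm f')\<^sup>2 + e"
    using y(2) by (simp add: power2_eq_square)
qed

section \<open>Test functions\<close>

definition smooth :: "(real \<Rightarrow> real) \<Rightarrow> bool" where
  "smooth f \<longleftrightarrow> (\<forall>n x. (deriv ^^ n) f differentiable (at x))"

text \<open>
  A set of functions that is closed under differentiation consists of smooth functions. This avoids formulas for
  higher derivatives.
\<close>

lemma smoothI:
  assumes "f \<in> S" and S: "\<And>g. g \<in> S \<Longrightarrow> \<exists>g'\<in>S. \<forall>x. (g has_real_derivative g' x) (at x)"
  shows "smooth f"
proof -
  have d: "deriv g \<in> S \<and> g differentiable (at x)" if "g \<in> S" for g x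
  proof -
    obtain g' where g': "g' \<in> S" "\<And>x. (g has_real_derivative g' x) (at x)"
      using S[of g] \<open>g \<in> S\<close> by blast
    then have "deriv g = g'" by (auto intro!: DERIV_imp_deriv)
    with g' show ?thesis by (auto simp: real_differentiable_def)
  qed
  have "(deriv ^^ n) f \<in> S" for n
    using assms(1) d by (induction n) auto
  then show ?thesis using d by (simp add: smooth_def)
qed

lemma smooth_DERIV: "smooth f \<Longrightarrow> (f has_real_derivative deriv f x) (at x)"
  unfolding smooth_def by (metis DERIV_deriv_iff_real_differentiable funpow_0)

lemma smooth_deriv: "smooth f \<Longrightarrow> smooth (deriv f)"
  unfolding smooth_def by (metis comp_apply funpow_Suc_right)

lemma smooth_antiderivative:
  assumes "\<And>x. (F has_real_derivative f x) (at x)" "smooth f"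
  shows "smooth F"
proof (rule smoothI[where S = "{g. g = F \<or> smooth g}"])
  fix g assume "g \<in> {g. g = F \<or> smooth g}"
  then consider "g = F" | "smooth g" by auto
  then show "\<exists>g'\<in>{g. g = F \<or> smooth g}. \<forall>x. (g has_real_derivative g' x) (at x)"
  proof cases
    case 1
    then show ?thesis using assms by (intro bexI[of _ f]) auto
  next
    case 2
    then show ?thesis using smooth_DERIV[OF 2] smooth_deriv[OF 2] by (intro bexI[of _ "deriv g"]) auto
  qed
qed simp

lemma smooth_lincomb:
  assumes "smooth f" "smooth g"
  shows "smooth (\<lambda>x. f x + c * g x)"
proof (rule smoothI[where S = "{h. \<exists>f g. smooth f \<and> smooth g \<and> h = (\<lambda>x. f x + c * g x)}"])
  fix h assume "h \<in> {h. \<exists>f g. smooth f \<and> smooth g \<and> h = (\<lambda>x. f x + c * g x)}"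
  then obtain f g where fg: "smooth f" "smooth g" and h: "h = (\<lambda>x. f x + c * g x)" by auto
  have "\<forall>x. (h has_real_derivative deriv f x + c * deriv g x) (at x)"
    unfolding h using fg by (intro allI DERIV_add DERIV_cmult smooth_DERIV)
  with fg smooth_deriv
  show "\<exists>g'\<in>{h. \<exists>f g. smooth f \<and> smooth g \<and> h = (\<lambda>x. f x + c * g x)}. \<forall>x. (h has_real_derivative g' x) (at x)"
    by (intro bexI[of _ "\<lambda>x. deriv f x + c * deriv g x"]) auto
qed (use assms in auto)

lemma test_functionI:
  assumes "smooth f" and "\<And>x. x \<notin> {a..b} \<Longrightarrow> f x = 0"
  shows "test_function f"
proof -
  have "{x. f x \<noteq> 0} \<subseteq> {a..b}" using assms(2) by blast
  then have "bounded {x. f x \<noteq> 0}"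
    by (rule bounded_subset[rotated]) auto
  then show ?thesis using assms(1) by (simp add: test_function_def smooth_def)
qed

lemma test_functionD:
  assumes "test_function f"
  shows "smooth f" "\<exists>R. \<forall>x. x \<notin> {-R..R} \<longrightarrow> f x = 0"
proof -
  show "smooth f" using assms by (simp add: test_function_def smooth_def)
  have "bounded (closure {x. f x \<noteq> 0})"
    using assms compact_imp_bounded by (auto simp: test_function_def)
  then have "bounded {x. f x \<noteq> 0}" using closure_subset by (rule bounded_subset)
  then obtain R where "\<forall>x. f x \<noteq> 0 \<longrightarrow> \<bar>x\<bar> \<le> R" by (auto simp: bounded_iff)
  then show "\<exists>R. \<forall>x. x \<notin> {-R..R} \<longrightarrow> f x = 0" by (intro exI[of _ R]) force
qed

text \<open>
  The derivatives of \<open>exp (- c / (x - a) - c / (b - x))\<close> are combinations of these terms. As \<open>c\<close> tends to zero the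
  bump tends to the indicator of the interval.
\<close>

definition bump_term :: "real \<Rightarrow> real \<Rightarrow> real \<Rightarrow> nat \<Rightarrow> nat \<Rightarrow> real \<Rightarrow> real" where
  "bump_term c a b i j x = (if a < x \<and> x < b
     then inverse (x - a) ^ i * inverse (b - x) ^ j * exp (- c / (x - a) - c / (b - x)) else 0)"

abbreviation bump :: "real \<Rightarrow> real \<Rightarrow> real \<Rightarrow> real \<Rightarrow> real" where
  "bump c a b \<equiv> bump_term c a b 0 0"

lemma inverse_power_exp_le:
  assumes "0 < c" "0 < (y::real)"
  shows "inverse y ^ i * exp (- c / y) \<le> fact i / c ^ i"
proof -
  have "(c / y) ^ i / fact i \<le> exp (c / y)"
  proof -
    have "(\<Sum>k\<in>{i}. (c / y) ^ k /\<^sub>R fact k) \<le> (\<Sum>k. (c / y) ^ k /\<^sub>R fact k)"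
      using assms by (intro sum_le_suminf summable_exp_generic) auto
    then show ?thesis by (simp add: exp_def divide_inverse mult.commute)
  qed
  then have "(c / y) ^ i / fact i * exp (- (c / y)) \<le> exp (c / y) * exp (- (c / y))"
    by (intro mult_right_mono) auto
  then have "(c / y) ^ i / fact i * exp (- (c / y)) \<le> 1"
    by (simp add: exp_minus)
  then show ?thesis
    using assms by (simp add: field_simps power_divide power_inverse)
qed

lemma bump_term_nonneg: "0 \<le> bump_term c a b i j x"
  by (simp add: bump_term_def)

text \<open>
  The exponential absorbs every negative power of \<open>x - a\<close> and \<open>b - x\<close>, with two powers to spare. So the terms
  vanish to second order at both ends and have derivative zero there.
\<close>

lemma bump_term_flat:
  assumes c: "0 < c"
  shows "bump_term c a b i j x \<le> fact (i + 2) / c ^ (i + 2) * (fact j / c ^ j) * (x - a)\<^sup>2"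
    and "bump_term c a b i j x \<le> fact i / c ^ i * (fact (j + 2) / c ^ (j + 2)) * (b - x)\<^sup>2"
proof -
  have split: "bump_term c a b i j x = (inverse (x - a) ^ i * exp (- c / (x - a))) *
      (inverse (b - x) ^ j * exp (- c / (b - x)))" if "a < x" "x < b"
  proof -
    have "exp (- c / (x - a) - c / (b - x)) = exp (- c / (x - a)) * exp (- c / (b - x))"
      by (simp add: exp_add[symmetric])
    then show ?thesis using that by (simp only: bump_term_def) (simp add: mult_ac)
  qed
  have up: "inverse y ^ i * exp (- c / y) = inverse y ^ (i + 2) * exp (- c / y) * y\<^sup>2" if "0 < y" for y i
    using that by (simp add: power_add power2_eq_square field_simps)
  show "bump_term c a b i j x \<le> fact (i + 2) / c ^ (i + 2) * (fact j / c ^ j) * (x - a)\<^sup>2"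
  proof (cases "a < x \<and> x < b")
    case True
    then have "bump_term c a b i j x = (inverse (x - a) ^ (i + 2) * exp (- c / (x - a))) *
      (inverse (b - x) ^ j * exp (- c / (b - x))) * (x - a)\<^sup>2"
      using split up[of "x - a" i] by simp
    also have "\<dots> \<le> fact (i + 2) / c ^ (i + 2) * (fact j / c ^ j) * (x - a)\<^sup>2"
      using True c by (intro mult_mono mult_right_mono inverse_power_exp_le) auto
    finally show ?thesis .
  qed (use c in \<open>auto simp: bump_term_def\<close>)
  show "bump_term c a b i j x \<le> fact i / c ^ i * (fact (j + 2) / c ^ (j + 2)) * (b - x)\<^sup>2"
  proof (cases "a < x \<and> x < b")
    case True
    then have "bump_term c a b i j x = (inverse (x - a) ^ i * exp (- c / (x - a))) *
      (inverse (b - x) ^ (j + 2) * exp (- c / (b - x))) * (b - x)\<^sup>2"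
      using split up[of "b - x" j] by simp
    also have "\<dots> \<le> fact i / c ^ i * (fact (j + 2) / c ^ (j + 2)) * (b - x)\<^sup>2"
      using True c by (intro mult_mono mult_right_mono inverse_power_exp_le) auto
    finally show ?thesis .
  qed (use c in \<open>auto simp: bump_term_def\<close>)
qed

lemma DERIV_zero_of_quadratic_bound:
  fixes f :: "real \<Rightarrow> real"
  assumes "\<And>y. \<bar>f y\<bar> \<le> K * (y - x)\<^sup>2"
  shows "(f has_real_derivative 0) (at x)"
  unfolding has_field_derivative_iff
proof (rule Lim_null_comparison)
  have fx: "f x = 0" using assms[of x] by simp
  have "\<bar>(f y - f x) / (y - x)\<bar> \<le> K * \<bar>y - x\<bar>" if "y \<noteq> x" for y
  proof -
    have "\<bar>f y\<bar> \<le> K * \<bar>y - x\<bar> * \<bar>y - x\<bar>"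
      using assms[of y] by (simp add: power2_eq_square mult.assoc flip: abs_mult)
    then show ?thesis using that fx by (simp add: pos_divide_le_eq)
  qed
  then show "\<forall>\<^sub>F y in at x. norm ((f y - f x) / (y - x)) \<le> K * \<bar>y - x\<bar>"
    by (auto simp: eventually_at intro!: exI[of _ 1])
  have "((\<lambda>y. K * \<bar>y - x\<bar>) \<longlongrightarrow> K * \<bar>x - x\<bar>) (at x)"
    by (intro tendsto_intros)
  then show "((\<lambda>y. K * \<bar>y - x\<bar>) \<longlongrightarrow> 0) (at x)" by simp
qed

lemma bump_term_DERIV:
  assumes c: "0 < c"
  shows "(bump_term c a b i j has_real_derivative
     - real i * bump_term c a b (i + 1) j x + real j * bump_term c a b i (j + 1) x
     + c * bump_term c a b (i + 2) j x - c * bump_term c a b i (j + 2) x) (at x)"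
proof -
  consider "a < x" "x < b" | "x \<le> a" | "b \<le> x" by linarith
  then show ?thesis
  proof cases
    case 1
    let ?g = "\<lambda>x. inverse (x - a) ^ i * inverse (b - x) ^ j * exp (- c / (x - a) - c / (b - x))"
    have nz: "x - a \<noteq> 0" "b - x \<noteq> 0" using 1 by auto
    have p1: "((\<lambda>x. inverse (x - a) ^ i) has_real_derivative - real i * inverse (x - a) ^ (i + 1)) (at x)"
    proof -
      have "((\<lambda>x. inverse (x - a) ^ i) has_real_derivative
          real i * inverse (x - a) ^ (i - 1) * (- inverse (x - a) * inverse (x - a))) (at x)"
        using nz by (auto intro!: derivative_eq_intros)
      moreover have "real i * inverse (x - a) ^ (i - 1) * (- inverse (x - a) * inverse (x - a))
          = - real i * inverse (x - a) ^ (i + 1)"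
        by (cases i) (auto simp: algebra_simps)
      ultimately show ?thesis by (simp only:)
    qed
    have p2: "((\<lambda>x. inverse (b - x) ^ j) has_real_derivative real j * inverse (b - x) ^ (j + 1)) (at x)"
    proof -
      have "((\<lambda>x. inverse (b - x) ^ j) has_real_derivative
          real j * inverse (b - x) ^ (j - 1) * (inverse (b - x) * inverse (b - x))) (at x)"
        using nz by (auto intro!: derivative_eq_intros)
      moreover have "real j * inverse (b - x) ^ (j - 1) * (inverse (b - x) * inverse (b - x))
          = real j * inverse (b - x) ^ (j + 1)"
        by (cases j) (auto simp: algebra_simps)
      ultimately show ?thesis by (simp only:)
    qed
    have p3: "((\<lambda>x. exp (- c / (x - a) - c / (b - x))) has_real_derivative
        exp (- c / (x - a) - c / (b - x)) * (c * inverse (x - a) ^ 2 - c * inverse (b - x) ^ 2)) (at x)"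
      using nz by (auto intro!: derivative_eq_intros simp: power2_eq_square divide_inverse)
    have "(?g has_real_derivative
       - real i * inverse (x - a) ^ (i + 1) * inverse (b - x) ^ j * exp (- c / (x - a) - c / (b - x))
       + real j * inverse (x - a) ^ i * inverse (b - x) ^ (j + 1) * exp (- c / (x - a) - c / (b - x))
       + c * inverse (x - a) ^ (i + 2) * inverse (b - x) ^ j * exp (- c / (x - a) - c / (b - x))
       - c * inverse (x - a) ^ i * inverse (b - x) ^ (j + 2) * exp (- c / (x - a) - c / (b - x))) (at x)"
      by (rule DERIV_cong[OF DERIV_mult[OF DERIV_mult[OF p1 p2] p3]])
        (simp add: algebra_simps power_add power2_eq_square)
    then have "(?g has_real_derivative
     - real i * bump_term c a b (i + 1) j x + real j * bump_term c a b i (j + 1) x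
     + c * bump_term c a b (i + 2) j x - c * bump_term c a b i (j + 2) x) (at x)"
      using 1 by (simp add: bump_term_def mult.assoc)
    moreover have "\<forall>\<^sub>F y in nhds x. bump_term c a b i j y = ?g y"
      using eventually_nhds_in_open[of "{a<..<b}" x] 1
      by (auto elim!: eventually_mono simp: bump_term_def)
    ultimately show ?thesis by (subst DERIV_cong_ev[OF refl _ refl]) auto
  next
    case 2
    let ?K = "fact (i + 2) / c ^ (i + 2) * (fact j / c ^ j)"
    have K: "0 \<le> ?K" using c by simp
    have "\<bar>bump_term c a b i j y\<bar> \<le> ?K * (y - x)\<^sup>2" for y
    proof (cases "a < y")
      case True
      then have "(y - a)\<^sup>2 \<le> (y - x)\<^sup>2" using 2 by (intro power_mono) auto
      then have "?K * (y - a)\<^sup>2 \<le> ?K * (y - x)\<^sup>2" using K by (rule mult_left_mono)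
      then show ?thesis
        using bump_term_flat(1)[OF c, of a b i j y] bump_term_nonneg[of c a b i j y] by linarith
    qed (use mult_nonneg_nonneg[OF K zero_le_power2[of "y - x"]] in \<open>simp add: bump_term_def\<close>)
    then have "(bump_term c a b i j has_real_derivative 0) (at x)"
      by (rule DERIV_zero_of_quadratic_bound)
    moreover have "bump_term c a b i' j' x = 0" for i' j'
      using 2 by (simp add: bump_term_def)
    ultimately show ?thesis by simp
  next
    case 3
    let ?K = "fact i / c ^ i * (fact (j + 2) / c ^ (j + 2))"
    have K: "0 \<le> ?K" using c by simp
    have "\<bar>bump_term c a b i j y\<bar> \<le> ?K * (y - x)\<^sup>2" for y
    proof (cases "y < b")
      case True
      then have "(b - y)\<^sup>2 \<le> (x - y)\<^sup>2" using 3 by (intro power_mono) auto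
      then have "?K * (b - y)\<^sup>2 \<le> ?K * (y - x)\<^sup>2"
        unfolding power2_commute[of x y] using K by (rule mult_left_mono)
      then show ?thesis
        using bump_term_flat(2)[OF c, of a b i j y] bump_term_nonneg[of c a b i j y] by linarith
    qed (use mult_nonneg_nonneg[OF K zero_le_power2[of "y - x"]] in \<open>simp add: bump_term_def\<close>)
    then have "(bump_term c a b i j has_real_derivative 0) (at x)"
      by (rule DERIV_zero_of_quadratic_bound)
    moreover have "bump_term c a b i' j' x = 0" for i' j'
      using 3 by (simp add: bump_term_def)
    ultimately show ?thesis by simp
  qed
qed

inductive_set bump_span :: "real \<Rightarrow> real \<Rightarrow> real \<Rightarrow> (real \<Rightarrow> real) set" for c a b where
  zero: "(\<lambda>x. 0) \<in> bump_span c a b"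
| step: "f \<in> bump_span c a b \<Longrightarrow> (\<lambda>x. f x + k * bump_term c a b i j x) \<in> bump_span c a b"

lemma test_function_bump:
  assumes c: "0 < c"
  shows "test_function (bump c a b)"
proof (rule test_functionI)
  show "smooth (bump c a b)"
  proof (rule smoothI)
    have "(\<lambda>x. 0 + 1 * bump_term c a b 0 0 x) \<in> bump_span c a b"
      by (intro bump_span.intros)
    then show "bump c a b \<in> bump_span c a b" by simp
    show "\<exists>g'\<in>bump_span c a b. \<forall>x. (g has_real_derivative g' x) (at x)" if "g \<in> bump_span c a b" for g
      using that
    proof induction
      case zero
      then show ?case by (intro bexI[of _ "\<lambda>x. 0"] bump_span.zero) auto
    next
      case (step f k i j)
      then obtain f' where f': "f' \<in> bump_span c a b" "\<And>x. (f has_real_derivative f' x) (at x)"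
        by blast
      let ?g' = "\<lambda>x. f' x + (- k * real i) * bump_term c a b (i + 1) j x
        + (k * real j) * bump_term c a b i (j + 1) x
        + (k * c) * bump_term c a b (i + 2) j x + (- k * c) * bump_term c a b i (j + 2) x"
      have "?g' \<in> bump_span c a b" by (intro bump_span.step f')
      moreover have "((\<lambda>x. f x + k * bump_term c a b i j x) has_real_derivative ?g' x) (at x)" for x
        by (rule DERIV_cong[OF DERIV_add[OF f'(2) DERIV_cmult[OF bump_term_DERIV[OF c]]]])
          (simp add: algebra_simps)
      ultimately show ?case by (intro bexI[of _ ?g']) auto
    qed
  qed
  show "bump c a b x = 0" if "x \<notin> {a..b}" for x
    using that by (auto simp: bump_term_def)
qed

lemma bump_le_1: "0 < c \<Longrightarrow> bump c a b x \<le> 1"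
proof -
  assume c: "0 < c"
  have "- c / (x - a) - c / (b - x) \<le> 0" if "a < x" "x < b"
  proof -
    have "0 < c / (x - a)" "0 < c / (b - x)" using that c by auto
    then show ?thesis unfolding minus_divide_left[symmetric] by linarith
  qed
  then show ?thesis by (auto simp: bump_term_def)
qed

lemma bump_tendsto_indicator:
  "(\<lambda>n. bump (1 / real (Suc n)) a b x) \<longlonglongrightarrow> indicator {a<..<b} x"
proof (cases "a < x \<and> x < b")
  case True
  have "(\<lambda>n. 1 / real (Suc n)) \<longlonglongrightarrow> 0"
    using LIMSEQ_inverse_real_of_nat by (simp add: inverse_eq_divide)
  then have "(\<lambda>n. exp (- (1 / real (Suc n)) / (x - a) - (1 / real (Suc n)) / (b - x)))
      \<longlonglongrightarrow> exp (- 0 / (x - a) - 0 / (b - x))"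
    using True by (intro tendsto_intros) auto
  then show ?thesis using True by (simp add: bump_term_def)
qed (auto simp: bump_term_def)

section \<open>Weak derivatives\<close>

lemma integrable_mult_compactly_supported:
  assumes h: "locally_integrable h" and w: "continuous_on UNIV w"
    and supp: "\<And>x. x \<notin> {a..b} \<Longrightarrow> w x = 0"
  shows "integrable lebesgue (\<lambda>x. h x * w x)"
proof -
  have "set_integrable lebesgue {a..b} (\<lambda>x. w x * h x)"
    using h by (intro set_integrable_continuous_mult[OF _ w]) (auto simp: locally_integrable_def)
  moreover have "(\<lambda>x. indicator {a..b} x *\<^sub>R (w x * h x)) = (\<lambda>x. h x * w x)"
  proof
    show "indicator {a..b} x *\<^sub>R (w x * h x) = h x * w x" for x
      using supp[of x] by (cases "x \<in> {a..b}") auto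
  qed
  ultimately show ?thesis by (simp add: set_integrable_def)
qed

lemma test_function_continuous: "test_function \<phi> \<Longrightarrow> continuous_on UNIV \<phi>"
  by (meson DERIV_continuous_on has_field_derivative_at_within smooth_DERIV test_functionD(1))

lemma test_function_deriv: "test_function \<phi> \<Longrightarrow> test_function (deriv \<phi>)"
proof -
  assume t: "test_function \<phi>"
  obtain R where R: "\<And>x. x \<notin> {-R..R} \<Longrightarrow> \<phi> x = 0" using test_functionD(2)[OF t] by blast
  show ?thesis
  proof (rule test_functionI[OF smooth_deriv[OF test_functionD(1)[OF t]]])
    fix x assume "x \<notin> {-R..R}"
    then have "\<forall>\<^sub>F y in nhds x. y \<in> - {-R..R}"
      by (intro eventually_nhds_in_open) auto
    then have "\<forall>\<^sub>F y in nhds x. \<phi> y = 0"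
      by eventually_elim (use R in blast)
    then have "(\<phi> has_real_derivative 0) (at x)"
      by (subst DERIV_cong_ev[OF refl _ refl]) auto
    then show "deriv \<phi> x = 0" by (rule DERIV_imp_deriv)
  qed
qed

lemma test_function_ac_deriv: "test_function \<phi> \<Longrightarrow> ac_deriv \<phi> (deriv \<phi>)"
  using test_function_continuous[OF test_function_deriv] smooth_DERIV test_functionD(1)
  by (intro ac_deriv_C1) auto

lemma integrable_mult_test_function:
  assumes "locally_integrable h" "test_function \<phi>"
  shows "integrable lebesgue (\<lambda>x. h x * \<phi> x)"
  using test_functionD(2)[OF assms(2)] integrable_mult_compactly_supported[OF assms(1) test_function_continuous[OF assms(2)]]
  by blast

text \<open>
  The Borel sets over which the integral vanishes form a Dynkin class that contains the intervals, so they are all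
  Borel sets; \<open>h\<close> is first replaced by a Borel function.
\<close>

lemma AE_0_of_interval_integrals:
  fixes h :: "real \<Rightarrow> real"
  assumes h: "integrable lebesgue h" and 0: "\<And>a b. (LINT x:{a..b}|lebesgue. h x) = 0"
  shows "AE x in lebesgue. h x = 0"
proof -
  obtain k where k[measurable]: "k \<in> borel_measurable lborel" and ae: "AE x in lborel. h x = k x"
    using completion_ex_borel_measurable_real[of h lborel] borel_measurable_integrable[OF h] by auto
  note ae' = AE_completion[OF ae]
  have kl: "k \<in> borel_measurable lborel" by measurable
  have ki: "integrable lborel k"
    using lebesgue_integrable_cong_AE[OF h ae'] integrable_completion[OF kl] by simp
  have kA: "set_integrable lborel A k" if "A \<in> sets borel" for A
    unfolding set_integrable_def using that ki by (intro integrable_mult_indicator) auto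
  have k0: "(LINT x:{a..b}|lborel. k x) = 0" for a b
  proof -
    have "AE x in lebesgue. indicator {a..b} x *\<^sub>R h x = indicator {a..b} x *\<^sub>R k x"
      using ae' by eventually_elim simp
    from lebesgue_integral_cong_AE[OF this] 0[of a b]
    show ?thesis by (simp add: set_lebesgue_integral_def integral_completion)
  qed
  have tot: "(LINT x|lborel. k x) = 0"
  proof -
    have "(\<lambda>n. LINT x|lborel. indicator {- real n..real n} x *\<^sub>R k x) \<longlonglongrightarrow> (LINT x|lborel. k x)"
    proof (rule integral_dominated_convergence[where w = "\<lambda>x. \<bar>k x\<bar>"])
      show "AE x in lborel. (\<lambda>n. indicator {- real n..real n} x *\<^sub>R k x) \<longlonglongrightarrow> k x"
      proof (intro AE_I2 tendsto_eventually)
        fix x :: real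
        obtain N where N: "\<bar>x\<bar> \<le> real N" using real_arch_simple by blast
        show "\<forall>\<^sub>F n in sequentially. indicator {- real n..real n} x *\<^sub>R k x = k x"
          using eventually_ge_at_top[of N] by eventually_elim (use N in \<open>auto simp: indicator_def\<close>)
      qed
    qed (use ki in \<open>auto simp: indicator_def\<close>)
    then have "(\<lambda>n. 0) \<longlonglongrightarrow> (LINT x|lborel. k x)"
      using k0 by (simp add: set_lebesgue_integral_def)
    then show ?thesis by (simp add: LIMSEQ_const_iff)
  qed
  have A0: "(LINT x:A|lborel. k x) = 0" if "A \<in> sets borel" for A
    using that
  proof (induction rule: borel_set_induct)
    case (compl A)
    have "(LINT x:A \<union> - A|lborel. k x) = (LINT x:A|lborel. k x) + (LINT x:- A|lborel. k x)"
      using compl(1) by (intro set_integral_Un kA) auto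
    then show ?case using compl(2) tot by (simp add: set_lebesgue_integral_def)
  next
    case (union f)
    have "(LINT x:(\<Union>i. f i)|lborel. k x) = (\<Sum>i. (LINT x:(f i)|lborel. k x))"
      using union(1,2) by (intro lebesgue_integral_countable_add kA) (auto simp: disjoint_family_on_def)
    then show ?case using union(3) by simp
  qed (use k0 in \<open>auto simp: set_lebesgue_integral_def\<close>)
  have "AE x in lborel. k x = 0"
    using A0 by (intro density_unique_real ki) (auto simp: set_lebesgue_integral_def)
  then have "AE x in lebesgue. k x = 0" by (rule AE_completion)
  with ae' show ?thesis by eventually_elim simp
qed

text \<open>
  The bumps tend boundedly to the indicators of open intervals, so \<open>h\<close> has integral zero over every interval.
\<close>

lemma fundamental_lemma:
  assumes h: "locally_integrable h"
    and 0: "\<And>\<phi>. test_function \<phi> \<Longrightarrow> (LINT x|lebesgue. h x * \<phi> x) = 0"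
  shows "AE x in lebesgue. h x = 0"
proof -
  have hm: "integrable lebesgue (\<lambda>x. indicator {a..b} x *\<^sub>R h x)" for a b
    using h by (simp add: locally_integrable_def set_integrable_def)
  have int0: "(LINT x:{a..b}|lebesgue. h x) = 0" for a b
  proof -
    have "(\<lambda>n. LINT x|lebesgue. h x * bump (1 / real (Suc n)) a b x) \<longlonglongrightarrow>
        (LINT x|lebesgue. indicator {a<..<b} x *\<^sub>R (indicator {a..b} x *\<^sub>R h x))"
    proof (rule integral_dominated_convergence[where w = "\<lambda>x. \<bar>indicator {a..b} x *\<^sub>R h x\<bar>"])
      show "(\<lambda>x. indicator {a<..<b} x *\<^sub>R (indicator {a..b} x *\<^sub>R h x)) \<in> borel_measurable lebesgue"
        by (intro borel_measurable_integrable integrable_mult_indicator hm) simp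
      show "(\<lambda>x. h x * bump (1 / real (Suc n)) a b x) \<in> borel_measurable lebesgue" for n
        using integrable_mult_test_function[OF h test_function_bump] by (intro borel_measurable_integrable) auto
      show "AE x in lebesgue. (\<lambda>n. h x * bump (1 / real (Suc n)) a b x)
          \<longlonglongrightarrow> indicator {a<..<b} x *\<^sub>R (indicator {a..b} x *\<^sub>R h x)"
      proof (rule AE_I2)
        fix x
        have "(\<lambda>n. h x * bump (1 / real (Suc n)) a b x) \<longlonglongrightarrow> h x * indicator {a<..<b} x"
          by (intro tendsto_intros bump_tendsto_indicator)
        moreover have "h x * indicator {a<..<b} x = indicator {a<..<b} x *\<^sub>R (indicator {a..b} x *\<^sub>R h x)"
          by (auto simp: indicator_def)
        ultimately show "(\<lambda>n. h x * bump (1 / real (Suc n)) a b x)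
          \<longlonglongrightarrow> indicator {a<..<b} x *\<^sub>R (indicator {a..b} x *\<^sub>R h x)" by simp
      qed
      show "AE x in lebesgue. norm (h x * bump (1 / real (Suc n)) a b x) \<le> \<bar>indicator {a..b} x *\<^sub>R h x\<bar>" for n
      proof (rule AE_I2)
        fix x
        have "\<bar>h x\<bar> * bump (1 / real (Suc n)) a b x \<le> \<bar>h x\<bar> * 1"
          by (intro mult_left_mono bump_le_1) auto
        then show "norm (h x * bump (1 / real (Suc n)) a b x) \<le> \<bar>indicator {a..b} x *\<^sub>R h x\<bar>"
          by (cases "x \<in> {a..b}") (auto simp: abs_mult bump_term_nonneg, auto simp: bump_term_def)
      qed
    qed (use hm in auto)
    moreover have "(LINT x|lebesgue. h x * bump (1 / real (Suc n)) a b x) = 0" for n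
      by (rule 0[OF test_function_bump]) simp
    ultimately have "(LINT x|lebesgue. indicator {a<..<b} x *\<^sub>R (indicator {a..b} x *\<^sub>R h x)) = 0"
      by (simp add: LIMSEQ_const_iff)
    moreover have "AE x in lebesgue. indicator {a<..<b} x *\<^sub>R (indicator {a..b} x *\<^sub>R h x) = indicator {a..b} x *\<^sub>R h x"
    proof -
      have "AE x in lborel. x \<noteq> a \<and> x \<noteq> b"
        using AE_lborel_singleton[of a] AE_lborel_singleton[of b] by eventually_elim simp
      from AE_completion[OF this] show ?thesis by eventually_elim (auto simp: indicator_def)
    qed
    ultimately show ?thesis
      unfolding set_lebesgue_integral_def using lebesgue_integral_cong_AE by metis
  qed
  have "AE x in lebesgue. indicator {- real n..real n} x *\<^sub>R h x = 0" for n
  proof (rule AE_0_of_interval_integrals[OF hm])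
    fix a b
    have "indicator {a..b} x *\<^sub>R (indicator {- real n..real n} x *\<^sub>R h x)
        = indicator {max a (- real n)..min b (real n)} x *\<^sub>R h x" for x
      by (auto simp: indicator_def)
    then show "(LINT x:{a..b}|lebesgue. indicator {- real n..real n} x *\<^sub>R h x) = 0"
      using int0[of "max a (- real n)" "min b (real n)"] unfolding set_lebesgue_integral_def by presburger
  qed
  then have "AE x in lebesgue. \<forall>n. indicator {- real n..real n} x *\<^sub>R h x = 0"
    by (simp only: AE_all_countable) blast
  then show ?thesis
  proof eventually_elim
    case (elim x)
    obtain N where "\<bar>x\<bar> \<le> real N" using real_arch_simple by blast
    then show ?case using elim[rule_format, of N] by (auto simp: indicator_def)
  qed
qed

text \<open>
  A test function of mean zero is the derivative of a test function. Every test function becomes one of mean zero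
  when a multiple of a fixed bump is subtracted; the constant \<open>c\<close> is the mean of \<open>h\<close> against that bump.
\<close>

lemma du_Bois_Reymond:
  assumes h: "locally_integrable h"
    and 0: "\<And>\<phi>. test_function \<phi> \<Longrightarrow> (LINT x|lebesgue. h x * deriv \<phi> x) = 0"
  shows "\<exists>c. AE x in lebesgue. h x = c"
proof -
  define \<eta>\<^sub>0 where "\<eta>\<^sub>0 = bump 1 0 1"
  have t0: "test_function \<eta>\<^sub>0" unfolding \<eta>\<^sub>0_def by (rule test_function_bump) simp
  have l1: "locally_integrable (\<lambda>x. 1)"
    using absolutely_integrable_continuous_real[of _ _ "\<lambda>x. 1"] by (auto simp: locally_integrable_def)
  have i1: "integrable lebesgue \<phi>" if "test_function \<phi>" for \<phi>
    using integrable_mult_test_function[OF l1 that] by simp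
  define I\<^sub>0 where "I\<^sub>0 = (LINT x|lebesgue. \<eta>\<^sub>0 x)"
  have I0: "I\<^sub>0 \<noteq> 0"
  proof
    assume "I\<^sub>0 = 0"
    then have "AE x in lebesgue. \<eta>\<^sub>0 x = 0"
      using integral_nonneg_eq_0_iff_AE[OF i1[OF t0]] by (simp add: I\<^sub>0_def \<eta>\<^sub>0_def bump_term_nonneg)
    then have "AE x in lebesgue. x \<notin> {0<..<1::real}"
      by eventually_elim (auto simp: \<eta>\<^sub>0_def bump_term_def)
    then have "emeasure lebesgue {0<..<1::real} = 0"
      by (subst (asm) AE_iff_measurable[of "{0<..<1::real}"]) auto
    then show False by simp
  qed
  define c where "c = (LINT x|lebesgue. h x * \<eta>\<^sub>0 x) / I\<^sub>0"
  have lc: "locally_integrable (\<lambda>x. h x - c)"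
    using h absolutely_integrable_continuous_real[of _ _ "\<lambda>x. c"]
    by (auto simp: locally_integrable_def intro!: set_integral_diff)
  have "(LINT x|lebesgue. (h x - c) * \<eta> x) = 0" if \<eta>: "test_function \<eta>" for \<eta>
  proof -
    \<comment> \<open>this multiple of the bump makes the mean of \<open>\<zeta>\<close> zero\<close>
    define l where "l = (LINT x|lebesgue. \<eta> x) / I\<^sub>0"
    define \<zeta> where "\<zeta> x = \<eta> x + (- l) * \<eta>\<^sub>0 x" for x
    have \<zeta>s: "smooth \<zeta>" unfolding \<zeta>_def
      by (intro smooth_lincomb test_functionD(1) \<eta> t0)
    obtain R1 where R1: "\<And>x. x \<notin> {-R1..R1} \<Longrightarrow> \<eta> x = 0" using test_functionD(2)[OF \<eta>] by blast
    obtain R2 where R2: "\<And>x. x \<notin> {-R2..R2} \<Longrightarrow> \<eta>\<^sub>0 x = 0" using test_functionD(2)[OF t0] by blast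
    define R where "R = max 0 (max R1 R2)"
    have R0: "0 \<le> R" by (simp add: R_def)
    have supp: "\<zeta> x = 0" if "x \<notin> {-R..R}" for x
    proof -
      have "x \<notin> {-R1..R1}" "x \<notin> {-R2..R2}" using that by (auto simp: R_def)
      then show ?thesis using R1 R2 by (simp add: \<zeta>_def)
    qed
    have \<zeta>t: "test_function \<zeta>" by (rule test_functionI[OF \<zeta>s supp])
    have \<zeta>c: "continuous_on UNIV \<zeta>" by (rule test_function_continuous[OF \<zeta>t])
    have "\<exists>F. \<forall>x::real. -\<infinity> < ereal x \<longrightarrow> ereal x < \<infinity> \<longrightarrow> (F has_vector_derivative \<zeta> x) (at x)"
      by (rule einterval_antiderivative) (use \<zeta>c in \<open>auto simp: continuous_on_eq_continuous_at\<close>)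
    then obtain F where F: "\<And>x. (F has_real_derivative \<zeta> x) (at x)"
      by (auto simp: has_real_derivative_iff_has_vector_derivative)
    define \<phi> where "\<phi> x = F x - F (- R)" for x
    have \<phi>: "(\<phi> has_real_derivative \<zeta> x) (at x)" for x
      unfolding \<phi>_def using F by (auto intro!: derivative_eq_intros)
    have ac: "ac_deriv \<phi> \<zeta>" by (rule ac_deriv_C1[OF \<phi> \<zeta>c])
    have z0: "(LINT x:{a..b}|lebesgue. \<zeta> x) = 0" if "{a..b} \<inter> {-R<..<R} = {}" for a b
    proof -
      have "AE x in lborel. x \<noteq> -R \<and> x \<noteq> R"
        using AE_lborel_singleton[of "-R"] AE_lborel_singleton[of R] by eventually_elim simp
      from AE_completion[OF this]
      have "AE x in lebesgue. indicator {a..b} x *\<^sub>R \<zeta> x = 0"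
      proof eventually_elim
        case (elim x)
        then show ?case using that supp[of x] by (cases "x \<in> {a..b}"; cases "x \<in> {-R..R}") auto
      qed
      then show ?thesis
        using lebesgue_integral_cong_AE[of "\<lambda>x. indicator {a..b} x *\<^sub>R \<zeta> x" "\<lambda>x. 0"]
        by (simp add: set_lebesgue_integral_def)
    qed
    have tot: "(LINT x:{-R..R}|lebesgue. \<zeta> x) = 0"
    proof -
      have "indicator {-R..R} x *\<^sub>R \<zeta> x = \<zeta> x" for x using supp[of x] by (auto simp: indicator_def)
      then have "(LINT x:{-R..R}|lebesgue. \<zeta> x) = (LINT x|lebesgue. \<zeta> x)"
        unfolding set_lebesgue_integral_def by presburger
      also have "\<dots> = (LINT x|lebesgue. \<eta> x) - l * I\<^sub>0"
        unfolding \<zeta>_def I\<^sub>0_def using i1[OF \<eta>] i1[OF t0] by simp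
      finally show ?thesis using I0 by (simp add: l_def)
    qed
    have "test_function \<phi>"
    proof (rule test_functionI[OF smooth_antiderivative[OF \<phi> \<zeta>s]])
      fix x assume "x \<notin> {-R..R}"
      then consider "x < -R" | "R < x" by fastforce
      then show "\<phi> x = 0"
      proof cases
        case 1
        have "(LINT y:{x..-R}|lebesgue. \<zeta> y) = 0" by (rule z0) auto
        then show ?thesis using ac_derivD(4)[OF ac, of x "-R"] 1 by (simp add: \<phi>_def)
      next
        case 2
        have "(LINT y:{R..x}|lebesgue. \<zeta> y) = 0" by (rule z0) auto
        then show ?thesis
          using ac_derivD(4)[OF ac, of "-R" R] ac_derivD(4)[OF ac, of R x] tot R0 2
          by (simp add: \<phi>_def)
      qed
    qed
    moreover have "deriv \<phi> = \<zeta>" using \<phi> by (auto intro!: DERIV_imp_deriv)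
    ultimately have "(LINT x|lebesgue. h x * \<zeta> x) = 0" using 0[of \<phi>] by simp
    moreover have "(LINT x|lebesgue. h x * \<zeta> x) = (LINT x|lebesgue. h x * \<eta> x - l * (h x * \<eta>\<^sub>0 x))"
      by (simp add: \<zeta>_def algebra_simps)
    ultimately have "(LINT x|lebesgue. h x * \<eta> x) = l * (LINT x|lebesgue. h x * \<eta>\<^sub>0 x)"
      using integrable_mult_test_function[OF h \<eta>] integrable_mult_test_function[OF h t0] by simp
    also have "\<dots> = c * (LINT x|lebesgue. \<eta> x)" by (simp add: l_def c_def)
    finally show ?thesis
      using integrable_mult_test_function[OF h \<eta>] i1[OF \<eta>] by (simp add: left_diff_distrib)
  qed
  from fundamental_lemma[OF lc this] have "AE x in lebesgue. h x = c" by simp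
  then show ?thesis by blast
qed

lemma ac_deriv_test_function:
  assumes f: "ac_deriv f g" and \<phi>: "test_function \<phi>"
  shows "(LINT x|lebesgue. f x * deriv \<phi> x) = - (LINT x|lebesgue. g x * \<phi> x)"
proof -
  note i = integrable_mult_test_function[OF ac_deriv_locally_integrable(1)[OF f]]
    integrable_mult_test_function[OF ac_deriv_locally_integrable(2)[OF f]]
  have "(LINT x|lebesgue. g x * \<phi> x + f x * deriv \<phi> x) = 0"
    using i \<phi> test_function_deriv[OF \<phi>]
    by (intro integral_ac_deriv_eq_0[OF ac_deriv_mult[OF f test_function_ac_deriv[OF \<phi>]]]) auto
  then show ?thesis using i \<phi> test_function_deriv[OF \<phi>] by simp
qed

text \<open>
  On the line, a function and a primitive of its weak derivative differ by a function with weak derivative zero,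
  which is constant almost everywhere.
\<close>

lemma has_weak_deriv_iff:
  "has_weak_deriv f g \<longleftrightarrow> (\<exists>F. ac_deriv F g \<and> (AE x in lebesgue. f x = F x))"
proof
  assume w: "has_weak_deriv f g"
  then have lf: "locally_integrable f" and lg: "locally_integrable g" by (auto simp: has_weak_deriv_def)
  obtain G where G: "ac_deriv G g" using ac_deriv_exists[OF lg] by blast
  note lG = ac_deriv_locally_integrable(1)[OF G]
  have "locally_integrable (\<lambda>x. f x - G x)"
    using lf lG by (auto simp: locally_integrable_def intro!: set_integral_diff)
  moreover have "(LINT x|lebesgue. (f x - G x) * deriv \<phi> x) = 0" if \<phi>: "test_function \<phi>" for \<phi>
    using w \<phi> ac_deriv_test_function[OF G \<phi>] integrable_mult_test_function[OF lf test_function_deriv[OF \<phi>]]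
      integrable_mult_test_function[OF lG test_function_deriv[OF \<phi>]]
    by (simp add: has_weak_deriv_def left_diff_distrib)
  ultimately obtain c where "AE x in lebesgue. f x - G x = c"
    using du_Bois_Reymond by blast
  then have "AE x in lebesgue. f x = G x + c" by eventually_elim simp
  moreover have "ac_deriv (\<lambda>x. G x + c) g"
    using ac_deriv_add[OF G ac_deriv_const[of c]] by simp
  ultimately show "\<exists>F. ac_deriv F g \<and> (AE x in lebesgue. f x = F x)" by blast
next
  assume "\<exists>F. ac_deriv F g \<and> (AE x in lebesgue. f x = F x)"
  then obtain F where F: "ac_deriv F g" and ae: "AE x in lebesgue. f x = F x" by blast
  have ae': "AE x in lebesgue. F x = f x" using ae by eventually_elim simp
  note l = ac_deriv_locally_integrable[OF F]
  have "locally_integrable f"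
    unfolding locally_integrable_def set_integrable_def
  proof (intro allI)
    fix a b
    have "AE x in lebesgue. indicator {a..b} x *\<^sub>R F x = indicator {a..b} x *\<^sub>R f x"
      using ae by eventually_elim simp
    from lebesgue_integrable_cong_AE[OF _ this] l(1)
    show "integrable lebesgue (\<lambda>x. indicator {a..b} x *\<^sub>R f x)"
      by (simp add: locally_integrable_def set_integrable_def)
  qed
  moreover have "(LINT x|lebesgue. f x * deriv \<phi> x) = - (LINT x|lebesgue. g x * \<phi> x)" if "test_function \<phi>" for \<phi>
  proof -
    have "AE x in lebesgue. f x * deriv \<phi> x = F x * deriv \<phi> x" using ae by eventually_elim simp
    from lebesgue_integral_cong_AE[OF this] ac_deriv_test_function[OF F that] show ?thesis by simp
  qed
  ultimately show "has_weak_deriv f g" using l by (simp add: has_weak_deriv_def)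
qed

lemma has_weak_deriv_unique:
  assumes "has_weak_deriv f g" "has_weak_deriv f g'"
  shows "AE x in lebesgue. g x = g' x"
proof -
  have l: "locally_integrable g" "locally_integrable g'" using assms by (auto simp: has_weak_deriv_def)
  have "AE x in lebesgue. g x - g' x = 0"
  proof (rule fundamental_lemma)
    show "locally_integrable (\<lambda>x. g x - g' x)"
      using l by (auto simp: locally_integrable_def intro!: set_integral_diff)
    show "(LINT x|lebesgue. (g x - g' x) * \<phi> x) = 0" if "test_function \<phi>" for \<phi>
      using assms that integrable_mult_test_function[OF l(1) that] integrable_mult_test_function[OF l(2) that]
      by (simp add: has_weak_deriv_def left_diff_distrib)
  qed
  then show ?thesis by eventually_elim simp
qed

lemma weak_deriv_AE:
  assumes "has_weak_deriv f g"
  shows "has_weak_deriv f (weak_deriv f)" "AE x in lebesgue. weak_deriv f x = g x"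
proof -
  show 1: "has_weak_deriv f (weak_deriv f)"
    unfolding weak_deriv_def by (rule someI[of "has_weak_deriv f"]) (rule assms)
  show "AE x in lebesgue. weak_deriv f x = g x" by (rule has_weak_deriv_unique[OF 1 assms])
qed

lemma weak_deriv_ac_deriv:
  assumes "ac_deriv F g" "AE x in lebesgue. f x = F x"
  shows "AE x in lebesgue. weak_deriv f x = g x"
  using assms by (intro weak_deriv_AE) (auto simp: has_weak_deriv_iff)

lemma H1_ac_deriv:
  assumes "f \<in> H1"
  obtains F where "ac_deriv F (weak_deriv f)" "AE x in lebesgue. f x = F x" "F \<in> L2"
    "f \<in> L2" "weak_deriv f \<in> L2"
proof -
  obtain g where g: "g \<in> L2" "has_weak_deriv f g" and f: "f \<in> L2"
    using assms by (auto simp: H1_def)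
  obtain F where F: "ac_deriv F (weak_deriv f)" "AE x in lebesgue. f x = F x"
    using weak_deriv_AE(1)[OF g(2)] by (auto simp: has_weak_deriv_iff)
  have "AE x in lebesgue. g x = weak_deriv f x"
    using weak_deriv_AE(2)[OF g(2)] by eventually_elim simp
  then have "weak_deriv f \<in> L2" by (rule L2_cong_AE[OF g(1)])
  with F f L2_cong_AE[OF f F(2)] show ?thesis by (intro that)
qed

lemma H1_I:
  assumes "ac_deriv F g" "AE x in lebesgue. f x = F x" "F \<in> L2" "g \<in> L2"
  shows "f \<in> H1"
proof -
  have "AE x in lebesgue. F x = f x" using assms(2) by eventually_elim simp
  then have "f \<in> L2" by (rule L2_cong_AE[OF assms(3)])
  then show ?thesis using assms by (auto simp: H1_def has_weak_deriv_iff)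
qed

lemma H2_ac_deriv:
  assumes "f \<in> H2"
  obtains F G where "ac_deriv F G" "ac_deriv G (weak_deriv (weak_deriv f))"
    "AE x in lebesgue. f x = F x" "AE x in lebesgue. weak_deriv f x = G x"
    "F \<in> L2" "G \<in> L2" "weak_deriv (weak_deriv f) \<in> L2"
proof -
  obtain g where g: "g \<in> H1" "has_weak_deriv f g" and f: "f \<in> L2"
    using assms by (auto simp: H2_def)
  obtain G where G: "ac_deriv G (weak_deriv g)" "AE x in lebesgue. g x = G x" "G \<in> L2" "g \<in> L2" "weak_deriv g \<in> L2"
    using H1_ac_deriv[OF g(1)] .
  have fG: "AE x in lebesgue. weak_deriv f x = G x"
    using weak_deriv_AE(2)[OF g(2)] G(2) by eventually_elim simp
  have "f \<in> H1" using f g(2) G(4) by (auto simp: H1_def)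
  then obtain F where F: "ac_deriv F (weak_deriv f)" "AE x in lebesgue. f x = F x" "F \<in> L2"
    by (rule H1_ac_deriv)
  have "AE x in lebesgue. weak_deriv (weak_deriv f) x = weak_deriv g x"
    by (rule weak_deriv_ac_deriv[OF G(1) fG])
  then have ww: "AE x in lebesgue. weak_deriv g x = weak_deriv (weak_deriv f) x"
    by eventually_elim simp
  show ?thesis
    by (rule that[OF ac_deriv_cong_AE[OF F(1) fG] ac_deriv_cong_AE[OF G(1) ww] F(2) fG F(3) G(3)
          L2_cong_AE[OF G(5) ww]])
qed

lemma H2_I:
  assumes "ac_deriv F G" "ac_deriv G K" "AE x in lebesgue. f x = F x" "F \<in> L2" "G \<in> L2" "K \<in> L2"
  shows "f \<in> H2" "AE x in lebesgue. weak_deriv f x = G x" "AE x in lebesgue. weak_deriv (weak_deriv f) x = K x"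
proof -
  have "AE x in lebesgue. F x = f x" using assms(3) by eventually_elim simp
  then have "f \<in> L2" by (rule L2_cong_AE[OF assms(4)])
  moreover have "G \<in> H1" using assms by (intro H1_I[OF assms(2)]) auto
  ultimately show "f \<in> H2" using assms(1,3) by (auto simp: H2_def has_weak_deriv_iff)
  show 1: "AE x in lebesgue. weak_deriv f x = G x" by (rule weak_deriv_ac_deriv[OF assms(1,3)])
  show "AE x in lebesgue. weak_deriv (weak_deriv f) x = K x" by (rule weak_deriv_ac_deriv[OF assms(2) 1])
qed

section \<open>The resolvent of the second derivative\<close>

text \<open>
  The relation says \<open>f = (1 - \<partial>\<^sub>x\<^sup>2 / k\<^sup>2)\<inverse> w\<close>, with derivative \<open>f'\<close>. The operator of the equation is the case
  \<open>k = 1\<close>; for large \<open>k\<close> these operators approximate the identity. Apart from existence and positivity of the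
  kernel, everything needed about them follows from the relation by integration by parts.
\<close>

definition resolvent_pair :: "real \<Rightarrow> (real \<Rightarrow> real) \<Rightarrow> (real \<Rightarrow> real) \<Rightarrow> (real \<Rightarrow> real) \<Rightarrow> bool" where
  "resolvent_pair k w f f' \<longleftrightarrow> w \<in> L2 \<and> f \<in> L2 \<and> f' \<in> L2 \<and>
     ac_deriv f f' \<and> ac_deriv f' (\<lambda>x. k\<^sup>2 * (f x - w x))"

lemma resolvent_pairD:
  assumes "resolvent_pair k w f f'"
  shows "w \<in> L2" "f \<in> L2" "f' \<in> L2" "ac_deriv f f'" "ac_deriv f' (\<lambda>x. k\<^sup>2 * (f x - w x))"
  using assms by (auto simp: resolvent_pair_def)

text \<open>
  The equation is tested with its solution. Contractivity, uniqueness and positivity of the operator follow.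
\<close>

lemma resolvent_pair_energy:
  assumes "resolvent_pair k w f f'"
  shows "k\<^sup>2 * ip w f = k\<^sup>2 * ip f f + ip f' f'"
proof -
  note r = resolvent_pairD[OF assms]
  have "ip (\<lambda>x. k\<^sup>2 * (f x - w x)) f = - ip f' f'"
    using r by (intro ip_deriv_left L2_cmult L2_diff)
  then have "k\<^sup>2 * (ip f f - ip w f) = - ip f' f'" using r by (simp add: ip_cmult_left ip_diff_left)
  then show ?thesis by (simp add: right_diff_distrib)
qed

lemma resolvent_pair_norm:
  assumes f: "resolvent_pair k w f f'" and k: "0 < k"
  shows "L2_norm f \<le> L2_norm w" "L2_norm f' \<le> k * L2_norm w"
proof -
  note r = resolvent_pairD[OF f]
  have e: "k\<^sup>2 * (L2_norm f)\<^sup>2 + (L2_norm f')\<^sup>2 \<le> k\<^sup>2 * (L2_norm w * L2_norm f)"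
    using resolvent_pair_energy[OF f] mult_left_mono[OF ip_le_norm[OF r(1,2)], of "k\<^sup>2"]
    by (simp add: L2_norm_power2[symmetric])
  have "k\<^sup>2 * (L2_norm f)\<^sup>2 \<le> k\<^sup>2 * (L2_norm w * L2_norm f)"
    using e zero_le_power2[of "L2_norm f'"] by linarith
  then have 1: "L2_norm f * L2_norm f \<le> L2_norm w * L2_norm f"
    using k by (simp add: power2_eq_square)
  then show n: "L2_norm f \<le> L2_norm w"
    using L2_norm_nonneg[of f] L2_norm_nonneg[of w] by (cases "L2_norm f = 0") (auto simp: mult_le_cancel_right)
  have "(L2_norm f')\<^sup>2 \<le> k\<^sup>2 * (L2_norm w * L2_norm f)"
    using e mult_nonneg_nonneg[OF zero_le_power2[of k] zero_le_power2[of "L2_norm f"]] by linarith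
  also have "\<dots> \<le> k\<^sup>2 * (L2_norm w * L2_norm w)"
    using n by (intro mult_left_mono) auto
  finally show "L2_norm f' \<le> k * L2_norm w"
    using k by (intro power2_le_imp_le[of "L2_norm f'"]) (auto simp: power2_eq_square mult_ac)
qed

lemma resolvent_pair_diff:
  assumes "resolvent_pair k w f f'" "resolvent_pair k v g g'"
  shows "resolvent_pair k (\<lambda>x. w x - v x) (\<lambda>x. f x - g x) (\<lambda>x. f' x - g' x)"
proof -
  note r = resolvent_pairD[OF assms(1)] and s = resolvent_pairD[OF assms(2)]
  have "(\<lambda>x. k\<^sup>2 * (f x - w x) - k\<^sup>2 * (g x - v x)) = (\<lambda>x. k\<^sup>2 * ((f x - g x) - (w x - v x)))"
    by (auto simp: algebra_simps)
  then show ?thesis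
    using r s ac_deriv_diff[OF r(5) s(5)] by (auto simp: resolvent_pair_def intro!: L2_diff ac_deriv_diff)
qed

lemma resolvent_pair_add:
  assumes "resolvent_pair k w f f'" "resolvent_pair k v g g'"
  shows "resolvent_pair k (\<lambda>x. w x + v x) (\<lambda>x. f x + g x) (\<lambda>x. f' x + g' x)"
proof -
  note r = resolvent_pairD[OF assms(1)] and s = resolvent_pairD[OF assms(2)]
  have "(\<lambda>x. k\<^sup>2 * (f x - w x) + k\<^sup>2 * (g x - v x)) = (\<lambda>x. k\<^sup>2 * ((f x + g x) - (w x + v x)))"
    by (auto simp: algebra_simps)
  then show ?thesis
    using r s ac_deriv_add[OF r(5) s(5)] by (auto simp: resolvent_pair_def intro!: L2_add ac_deriv_add)
qed

lemma resolvent_pair_cmult: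
  assumes "resolvent_pair k w f f'"
  shows "resolvent_pair k (\<lambda>x. c * w x) (\<lambda>x. c * f x) (\<lambda>x. c * f' x)"
proof -
  note r = resolvent_pairD[OF assms(1)]
  have "(\<lambda>x. c * (k\<^sup>2 * (f x - w x))) = (\<lambda>x. k\<^sup>2 * (c * f x - c * w x))"
    by (auto simp: algebra_simps)
  then show ?thesis
    using r ac_deriv_cmult[OF r(5), of c] by (auto simp: resolvent_pair_def intro!: L2_cmult ac_deriv_cmult)
qed

lemma resolvent_pair_unique:
  assumes f: "resolvent_pair k w f f'" and g: "resolvent_pair k w g g'" and k: "0 < k"
  shows "f x = g x" "f' x = g' x"
proof -
  have d: "resolvent_pair k (\<lambda>x. 0) (\<lambda>x. f x - g x) (\<lambda>x. f' x - g' x)"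
    using resolvent_pair_diff[OF f g] by simp
  note r = resolvent_pairD[OF d]
  have z: "L2_norm (\<lambda>x. 0) = 0" by (simp add: L2_norm_def)
  have n: "L2_norm (\<lambda>x. f x - g x) = 0" "L2_norm (\<lambda>x. f' x - g' x) = 0"
    using resolvent_pair_norm[OF d k] z L2_norm_nonneg[of "\<lambda>x. f x - g x"]
      L2_norm_nonneg[of "\<lambda>x. f' x - g' x"] by auto
  show "f x = g x" using ac_deriv_square_bound[OF r(4,2,3), of x] n by simp
  have "L2_norm (\<lambda>x. k\<^sup>2 * ((f x - g x) - 0)) = 0"
    using n by (simp only: L2_norm_cmult diff_0_right mult_zero_right)
  then show "f' x = g' x"
    using ac_deriv_square_bound[OF r(5,3), of x] n L2_cmult[OF L2_diff[OF r(2,1)]] by simp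
qed

lemma resolvent_pair_symmetric:
  assumes f: "resolvent_pair k w f f'" and g: "resolvent_pair k v g g'" and k: "0 < k"
  shows "ip w g = ip f v"
proof -
  note r = resolvent_pairD[OF f] and s = resolvent_pairD[OF g]
  have "ip (\<lambda>x. k\<^sup>2 * (f x - w x)) g = - ip f' g'"
    using r s by (intro ip_deriv_left L2_cmult L2_diff)
  moreover have "ip (\<lambda>x. k\<^sup>2 * (g x - v x)) f = - ip g' f'"
    using r s by (intro ip_deriv_left L2_cmult L2_diff)
  ultimately have "k\<^sup>2 * (ip f g - ip w g) = k\<^sup>2 * (ip g f - ip v f)"
    using r s by (simp add: ip_cmult_left ip_diff_left ip_commute[of g' f'])
  then show ?thesis using k by (simp add: ip_commute)
qed

text \<open>
  Here \<open>k\<^sup>2 (f - \<eta>) = f''\<close>. Pairing with \<open>f - \<eta>\<close> and integrating by parts leaves only first derivatives on the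
  right, so the squared distance is of order \<open>1 / k\<^sup>2\<close>.
\<close>

lemma resolvent_pair_converges:
  assumes f: "resolvent_pair k \<eta> f f'" and \<eta>: "ac_deriv \<eta> \<eta>'" "\<eta>' \<in> L2" and k: "0 < k"
  shows "L2_norm (\<lambda>x. f x - \<eta> x) \<le> L2_norm \<eta>' / k"
proof -
  note r = resolvent_pairD[OF f]
  have "ip (\<lambda>x. k\<^sup>2 * (f x - \<eta> x)) (\<lambda>x. f x - \<eta> x) = - ip f' (\<lambda>x. f' x - \<eta>' x)"
    using r \<eta> by (intro ip_deriv_left L2_cmult L2_diff ac_deriv_diff)
  then have "k\<^sup>2 * (L2_norm (\<lambda>x. f x - \<eta> x))\<^sup>2 = ip f' \<eta>' - (L2_norm f')\<^sup>2"
    using r \<eta> by (simp add: ip_cmult_left ip_diff_right L2_norm_power2)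
  also have "\<dots> \<le> L2_norm f' * L2_norm \<eta>' - (L2_norm f')\<^sup>2"
    using ip_le_norm[OF r(3) \<eta>(2)] by simp
  also have "\<dots> \<le> (L2_norm \<eta>')\<^sup>2"
    using sum_squares_bound[of "L2_norm f'" "L2_norm \<eta>'"] zero_le_power2[of "L2_norm f'"]
      zero_le_power2[of "L2_norm \<eta>'"] by linarith
  finally have "(k * L2_norm (\<lambda>x. f x - \<eta> x))\<^sup>2 \<le> (L2_norm \<eta>')\<^sup>2"
    by (simp add: power_mult_distrib)
  then have "k * L2_norm (\<lambda>x. f x - \<eta> x) \<le> L2_norm \<eta>'"
    by (rule power2_le_imp_le) simp
  then show ?thesis using k by (simp add: field_simps)
qed

definition half_exp :: "real \<Rightarrow> real \<Rightarrow> real" where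
  "half_exp k y = indicator {0..} y * exp (- k * y)"

lemma half_exp_integral:
  assumes k: "0 < k"
  shows "integrable lborel (half_exp k)" "(LINT y|lborel. half_exp k y) = 1 / k"
proof -
  have hi: "((\<lambda>x. exp (- k * x)) has_integral 1 / k) {0..}"
    using has_integral_exp_minus_to_infinity[OF k, of 0] by simp
  have si: "set_integrable lebesgue {0..} (\<lambda>x. exp (- k * x))"
    using hi by (intro nonnegative_absolutely_integrable_1) (auto simp: integrable_on_def)
  have [measurable]: "half_exp k \<in> borel_measurable lborel"
    unfolding half_exp_def by measurable
  have "integrable lebesgue (half_exp k)"
    using si by (simp add: set_integrable_def half_exp_def[abs_def])
  then show "integrable lborel (half_exp k)"
    by (simp add: integrable_completion)
  have "(LINT y|lebesgue. half_exp k y) = 1 / k"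
    using set_lebesgue_integral_eq_integral(2)[OF si] integral_unique[OF hi]
    by (simp add: set_lebesgue_integral_def half_exp_def[abs_def])
  then show "(LINT y|lborel. half_exp k y) = 1 / k"
    by (simp add: integral_completion)
qed

lemma exp_kernel_integral:
  fixes k x :: real
  assumes k: "0 < k"
  shows "integrable lebesgue (\<lambda>y. exp (- k * \<bar>x - y\<bar>))"
    and "(LINT y|lebesgue. exp (- k * \<bar>x - y\<bar>)) = 2 / k"
proof -
  have i: "integrable lborel (\<lambda>y. half_exp k (- x + 1 * y))" "integrable lborel (\<lambda>y. half_exp k (x + (- 1) * y))"
    by (rule lborel_integrable_real_affine[OF half_exp_integral(1)[OF k]], simp)+
  have v: "(LINT y|lborel. half_exp k (- x + 1 * y)) = 1 / k" "(LINT y|lborel. half_exp k (x + (- 1) * y)) = 1 / k"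
    using lborel_integral_real_affine[of 1 "half_exp k" "- x"]
      lborel_integral_real_affine[of "- 1" "half_exp k" x] half_exp_integral(2)[OF k] by auto
  let ?s = "\<lambda>y. half_exp k (- x + 1 * y) + half_exp k (x + (- 1) * y)"
  have ae: "AE y in lborel. ?s y = exp (- k * \<bar>x - y\<bar>)"
    using AE_lborel_singleton[of x]
    by eventually_elim (auto simp: half_exp_def indicator_def abs_if algebra_simps)
  have "integrable lborel ?s" using i by (rule Bochner_Integration.integrable_add)
  then have 1: "integrable lborel (\<lambda>y. exp (- k * \<bar>x - y\<bar>))"
    by (rule integrable_cong_AE_imp) (use ae in \<open>auto elim: eventually_mono\<close>)
  have "(LINT y|lborel. exp (- k * \<bar>x - y\<bar>)) = (LINT y|lborel. ?s y)"
    using ae 1 i by (intro integral_cong_AE) (auto intro: borel_measurable_integrable)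
  also have "\<dots> = 2 / k"
    using i v by simp
  finally have 2: "(LINT y|lborel. exp (- k * \<bar>x - y\<bar>)) = 2 / k" .
  show "integrable lebesgue (\<lambda>y. exp (- k * \<bar>x - y\<bar>))"
    using 1 by (subst integrable_completion) auto
  show "(LINT y|lebesgue. exp (- k * \<bar>x - y\<bar>)) = 2 / k"
    using 2 by (subst integral_completion) auto
qed

lemma exp_kernel_L2:
  fixes k x :: real
  assumes k: "0 < k"
  shows "(\<lambda>y. exp (- k * \<bar>x - y\<bar>)) \<in> L2"
    and "(L2_norm (\<lambda>y. exp (- k * \<bar>x - y\<bar>)))\<^sup>2 = 1 / k"
proof -
  have sq: "(\<lambda>y. (exp (- k * \<bar>x - y\<bar>))\<^sup>2) = (\<lambda>y. exp (- (2 * k) * \<bar>x - y\<bar>))"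
    by (auto simp: power2_eq_square mult_exp_exp)
  have 2: "0 < 2 * k" using k by simp
  show "(\<lambda>y. exp (- k * \<bar>x - y\<bar>)) \<in> L2"
    using exp_kernel_integral(1)[OF 2, of x] unfolding L2_def
    by (simp only: mem_Collect_eq sq) (auto intro!: measurable_completion)
  show "(L2_norm (\<lambda>y. exp (- k * \<bar>x - y\<bar>)))\<^sup>2 = 1 / k"
    using exp_kernel_integral(2)[OF 2, of x] k
    by (simp only: L2_norm_def sq) simp
qed

lemma L2_of_bounded_square_integrals:
  assumes [measurable]: "f \<in> borel_measurable lebesgue"
    and int: "\<And>n. set_integrable lebesgue {- real n..real n} (\<lambda>x. (f x)\<^sup>2)"
    and le: "\<And>n. (LINT x:{- real n..real n}|lebesgue. (f x)\<^sup>2) \<le> C"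
  shows "f \<in> L2"
proof -
  let ?g = "\<lambda>n x. indicator {- real n..real n} x *\<^sub>R (f x)\<^sup>2"
  have mono: "?g m x \<le> ?g n x" if "m \<le> n" for m n x
    using that by (auto simp: indicator_def)
  have ig: "integrable lebesgue (?g n)" for n
    using int by (simp add: set_integrable_def)
  have inc: "incseq (\<lambda>n. LINT x|lebesgue. ?g n x)"
    by (intro monoI integral_mono ig mono)
  then obtain L where L: "(\<lambda>n. LINT x|lebesgue. ?g n x) \<longlonglongrightarrow> L"
    using le incseq_convergent[OF inc, of C] unfolding set_lebesgue_integral_def by blast
  have "integrable lebesgue (\<lambda>x. (f x)\<^sup>2)"
  proof (rule integrable_monotone_convergence[OF ig _ _ L])
    show "AE x in lebesgue. mono (\<lambda>n. ?g n x)" using mono by (auto intro!: monoI)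
    show "AE x in lebesgue. (\<lambda>n. ?g n x) \<longlonglongrightarrow> (f x)\<^sup>2"
    proof (intro AE_I2 tendsto_eventually)
      fix x :: real
      obtain N where N: "\<bar>x\<bar> \<le> real N" using real_arch_simple by blast
      show "\<forall>\<^sub>F n in sequentially. ?g n x = (f x)\<^sup>2"
        using eventually_ge_at_top[of N] by eventually_elim (use N in \<open>auto simp: indicator_def\<close>)
    qed
  qed simp
  then show ?thesis by (simp add: L2_def)
qed

text \<open>
  From \<open>p' = s (w - p)\<close> one has \<open>(p\<^sup>2)' / s = 2 p w - 2 p\<^sup>2 \<le> w\<^sup>2 - p\<^sup>2\<close>. The left side integrates to boundary terms,
  which are bounded, so the integral of \<open>p\<^sup>2\<close> is controlled by that of \<open>w\<^sup>2\<close>.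
\<close>

lemma relaxation_in_L2:
  assumes p: "ac_deriv p (\<lambda>x. s * (w x - p x))" and w: "w \<in> L2" and s: "s \<noteq> 0"
    and C: "\<And>x. \<bar>p x\<bar> \<le> C"
  shows "p \<in> L2"
proof (rule L2_of_bounded_square_integrals)
  have cp: "continuous_on UNIV p" by (rule ac_deriv_continuous[OF p])
  show "p \<in> borel_measurable lebesgue" by (rule ac_deriv_measurable_fun[OF p])
  fix n :: nat
  let ?I = "{- real n..real n}"
  show ip2: "set_integrable lebesgue ?I (\<lambda>x. (p x)\<^sup>2)"
    by (intro absolutely_integrable_continuous_real continuous_intros continuous_on_subset[OF cp]) auto
  have iw: "set_integrable lebesgue S (\<lambda>x. (w x)\<^sup>2)" if "S \<in> sets lebesgue" for S
    unfolding set_integrable_def using that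
    by (intro integrable_mult_indicator L2_integrable_square[OF w])
  note q = ac_deriv_mult[OF p p]
  let ?q = "\<lambda>x. s * (w x - p x) * p x + p x * (s * (w x - p x))"
  let ?e = "1 / s"
  have "(LINT x:?I|lebesgue. (p x)\<^sup>2) \<le> (LINT x:?I|lebesgue. (w x)\<^sup>2 - ?e * ?q x)"
  proof (rule set_integral_mono[OF ip2])
    show "set_integrable lebesgue ?I (\<lambda>x. (w x)\<^sup>2 - ?e * ?q x)"
      using ac_derivD(1)[OF q, of "- real n" "real n"] iw by (intro set_integral_diff(1) set_integrable_mult_right) auto
    fix x
    have "?e * ?q x = 2 * (w x * p x) - 2 * (p x)\<^sup>2"
      using s by (simp add: field_simps power2_eq_square)
    then show "(p x)\<^sup>2 \<le> (w x)\<^sup>2 - ?e * ?q x"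
      using sum_squares_bound[of "w x" "p x"] by (simp add: mult.assoc)
  qed
  also have "\<dots> = (LINT x:?I|lebesgue. (w x)\<^sup>2) - ?e * (LINT x:?I|lebesgue. ?q x)"
    using set_integral_diff(2)[OF iw[of ?I] set_integrable_mult_right[OF ac_derivD(1)[OF q]], of ?e]
    by (simp only: set_integral_mult_right) simp
  also have "(LINT x:?I|lebesgue. ?q x) = (p (real n))\<^sup>2 - (p (- real n))\<^sup>2"
    using ac_derivD(4)[OF q, of "- real n" "real n"] by (simp add: power2_eq_square)
  also have "(LINT x:?I|lebesgue. (w x)\<^sup>2) \<le> (LINT x|lebesgue. (w x)\<^sup>2)"
    using iw[of ?I] L2_integrable_square[OF w] unfolding set_lebesgue_integral_def set_integrable_def
    by (intro integral_mono) (auto simp: indicator_def)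
  also have "(LINT x|lebesgue. (w x)\<^sup>2) - ?e * ((p (real n))\<^sup>2 - (p (- real n))\<^sup>2)
      \<le> (LINT x|lebesgue. (w x)\<^sup>2) + \<bar>?e\<bar> * C\<^sup>2"
  proof -
    have c: "(p y)\<^sup>2 \<le> C\<^sup>2" for y using C[of y] by (metis abs_ge_zero power2_abs power_mono)
    have "\<bar>(p (real n))\<^sup>2 - (p (- real n))\<^sup>2\<bar> \<le> C\<^sup>2"
      using c[of "real n"] c[of "- real n"] zero_le_power2[of "p (real n)"] zero_le_power2[of "p (- real n)"]
      unfolding abs_le_iff by linarith
    then have "\<bar>?e * ((p (real n))\<^sup>2 - (p (- real n))\<^sup>2)\<bar> \<le> \<bar>?e\<bar> * C\<^sup>2"
      unfolding abs_mult by (rule mult_left_mono) simp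
    then show ?thesis by linarith
  qed
  finally show "(LINT x:?I|lebesgue. (p x)\<^sup>2) \<le> (LINT x|lebesgue. (w x)\<^sup>2) + \<bar>?e\<bar> * C\<^sup>2"
    by simp
qed

definition resolvent :: "real \<Rightarrow> (real \<Rightarrow> real) \<Rightarrow> real \<Rightarrow> real" where
  "resolvent k w x = (LINT y|lebesgue. k / 2 * exp (- k * \<bar>x - y\<bar>) * w y)"

text \<open>
  The part of the convolution of \<open>w\<close> with \<open>k exp (- k \<bar>x\<bar>)\<close> that comes from one side of \<open>x\<close>: the left side is
  \<open>S x = {..x}\<close> with \<open>s = k\<close>, the right side is \<open>S x = {x<..}\<close> with \<open>s = - k\<close>. Up to an exponential factor the
  part is a primitive of \<open>exp (s y) w(y)\<close>, hence it solves a first order equation.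
\<close>

lemma one_sided_exp_integral:
  assumes k: "0 < k" and w: "w \<in> L2"
    and meas: "\<And>x. S x \<in> sets lebesgue" and side: "\<And>x y. y \<in> S x \<Longrightarrow> k * \<bar>x - y\<bar> = s * (x - y)"
    and incr: "\<And>a b. a \<le> b \<Longrightarrow> (\<lambda>y. indicator (S b) y - indicator (S a) y) = (\<lambda>y. (s / k) * indicator {a<..b} y)"
    and s: "s\<^sup>2 = k\<^sup>2"
    and p_def: "p = (\<lambda>x. LINT y:S x|lebesgue. k * exp (- k * \<bar>x - y\<bar>) * w y)"
  shows "ac_deriv p (\<lambda>x. s * (w x - p x))" "p \<in> L2"
    and "set_integrable lebesgue (S x) (\<lambda>y. k * exp (- k * \<bar>x - y\<bar>) * w y)"
proof -
  have int: "integrable lebesgue (\<lambda>y. k * exp (- k * \<bar>x - y\<bar>) * w y)" for x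
    using L2_integrable_mult[OF exp_kernel_L2(1)[OF k, of x] w] by (simp add: mult.assoc)
  show si: "set_integrable lebesgue (S x) (\<lambda>y. k * exp (- k * \<bar>x - y\<bar>) * w y)" for x
    unfolding set_integrable_def by (intro integrable_mult_indicator meas int)
  define P where "P x = (LINT y:S x|lebesgue. exp (s * y) * w y)" for x
  have conv: "indicator (S x) y *\<^sub>R (k * exp (- k * \<bar>x - y\<bar>) * w y)
      = (k * exp (- s * x)) * (indicator (S x) y *\<^sub>R (exp (s * y) * w y))" for x y
  proof (cases "y \<in> S x")
    case True
    have "- k * \<bar>x - y\<bar> = - s * x + s * y" using side[OF True] by (simp add: algebra_simps)
    then have "exp (- k * \<bar>x - y\<bar>) = exp (- s * x) * exp (s * y)" by (simp only: exp_add)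
    then show ?thesis using True by (simp only: indicator_simps scaleR_one mult_ac)
  qed simp
  have siP: "set_integrable lebesgue (S x) (\<lambda>y. exp (s * y) * w y)" for x
  proof -
    have "integrable lebesgue (\<lambda>y. (k * exp (- s * x)) * (indicator (S x) y *\<^sub>R (exp (s * y) * w y)))"
      using si[of x] unfolding set_integrable_def conv .
    from integrable_mult_right[OF this, of "inverse (k * exp (- s * x))"]
    show ?thesis
      unfolding set_integrable_def mult.assoc[symmetric] using k by simp
  qed
  have pP: "p x = k * exp (- s * x) * P x" for x
    unfolding p_def P_def set_lebesgue_integral_def conv by simp
  have acP: "ac_deriv P (\<lambda>y. (s / k) * (exp (s * y) * w y))"
    unfolding ac_deriv_def
  proof (intro allI impI conjI)
    fix a b :: real assume ab: "a \<le> b"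
    have "set_integrable lebesgue {a..b} w"
      using L2_locally_integrable[OF w] by (auto simp: locally_integrable_def)
    then have "set_integrable lebesgue {a..b} (\<lambda>y. exp (s * y) * w y)"
      by (rule set_integrable_continuous_mult) (intro continuous_intros)
    then show si1: "set_integrable lebesgue {a..b} (\<lambda>y. (s / k) * (exp (s * y) * w y))"
      by (intro set_integrable_mult_right)
    have "P b - P a = (LINT y|lebesgue. indicator (S b) y *\<^sub>R (exp (s * y) * w y)
        - indicator (S a) y *\<^sub>R (exp (s * y) * w y))"
      using siP[of a] siP[of b] by (simp add: P_def set_lebesgue_integral_def set_integrable_def)
    also have "\<dots> = (LINT y|lebesgue. (s / k) * indicator {a<..b} y * (exp (s * y) * w y))"
    proof (rule Bochner_Integration.integral_cong[OF refl])
      fix y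
      have "indicator (S b) y - indicator (S a) y = (s / k) * indicator {a<..b} y"
        using incr[OF ab] by meson
      then show "indicator (S b) y *\<^sub>R (exp (s * y) * w y) - indicator (S a) y *\<^sub>R (exp (s * y) * w y)
          = (s / k) * indicator {a<..b} y * (exp (s * y) * w y)"
        by (simp add: left_diff_distrib[symmetric])
    qed
    also have "\<dots> = (LINT y:{a..b}|lebesgue. (s / k) * (exp (s * y) * w y))"
      unfolding set_lebesgue_integral_def
    proof (rule lebesgue_integral_cong_AE)
      show "AE y in lebesgue. (s / k) * indicator {a<..b} y * (exp (s * y) * w y)
          = indicator {a..b} y *\<^sub>R ((s / k) * (exp (s * y) * w y))"
        using AE_completion[OF AE_lborel_singleton[of a]]
        by eventually_elim (auto simp: indicator_def)
    qed
    finally show "P b - P a = (LINT y:{a..b}|lebesgue. (s / k) * (exp (s * y) * w y))" .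
  qed
  have acE: "ac_deriv (\<lambda>x. k * exp (- s * x)) (\<lambda>x. - s * (k * exp (- s * x)))"
    by (rule ac_deriv_C1) (auto intro!: derivative_eq_intros continuous_intros)
  have eq: "(\<lambda>x. - s * (k * exp (- s * x)) * P x + k * exp (- s * x) * ((s / k) * (exp (s * x) * w x)))
      = (\<lambda>x. s * (w x - p x))"
  proof
    fix x
    have "exp (- s * x) * exp (s * x) = 1" by (simp flip: exp_add)
    then have "k * exp (- s * x) * ((s / k) * (exp (s * x) * w x)) = s * w x"
      using k by (simp add: field_simps)
    then show "- s * (k * exp (- s * x)) * P x + k * exp (- s * x) * ((s / k) * (exp (s * x) * w x))
      = s * (w x - p x)"
      by (simp add: pP right_diff_distrib)
  qed
  have "ac_deriv (\<lambda>x. k * exp (- s * x) * P x) (\<lambda>x. s * (w x - p x))"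
    using ac_deriv_mult[OF acE acP] by (simp only: eq)
  moreover have "p = (\<lambda>x. k * exp (- s * x) * P x)" by (rule ext) (rule pP)
  ultimately show ac: "ac_deriv p (\<lambda>x. s * (w x - p x))" by simp
  have s0: "s \<noteq> 0" using s k by auto
  show "p \<in> L2"
  proof (rule relaxation_in_L2[OF ac w s0])
    fix x
    have "\<bar>p x\<bar> \<le> (LINT y|lebesgue. \<bar>indicator (S x) y *\<^sub>R (k * exp (- k * \<bar>x - y\<bar>) * w y)\<bar>)"
      unfolding p_def set_lebesgue_integral_def by (rule integral_abs_bound)
    also have "\<dots> \<le> (LINT y|lebesgue. k * (exp (- k * \<bar>x - y\<bar>) * \<bar>w y\<bar>))"
    proof (rule integral_mono)
      show "integrable lebesgue (\<lambda>y. \<bar>indicator (S x) y *\<^sub>R (k * exp (- k * \<bar>x - y\<bar>) * w y)\<bar>)"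
        using si[of x] unfolding set_integrable_def by (rule integrable_abs)
      show "integrable lebesgue (\<lambda>y. k * (exp (- k * \<bar>x - y\<bar>) * \<bar>w y\<bar>))"
        using L2_integrable_mult[OF exp_kernel_L2(1)[OF k, of x] L2_abs[OF w]] by simp
    qed (use k in \<open>auto simp: indicator_def abs_mult\<close>)
    also have "\<dots> = k * ip (\<lambda>y. exp (- k * \<bar>x - y\<bar>)) (\<lambda>y. \<bar>w y\<bar>)"
      by (simp add: ip_def)
    also have "\<dots> \<le> k * (L2_norm (\<lambda>y. exp (- k * \<bar>x - y\<bar>)) * L2_norm (\<lambda>y. \<bar>w y\<bar>))"
      using k by (intro mult_left_mono ip_le_norm exp_kernel_L2 L2_abs w) auto
    also have "L2_norm (\<lambda>y. exp (- k * \<bar>x - y\<bar>)) = sqrt (1 / k)"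
      using exp_kernel_L2(2)[OF k, of x] by (simp add: real_sqrt_unique)
    finally show "\<bar>p x\<bar> \<le> k * (sqrt (1 / k) * L2_norm (\<lambda>y. \<bar>w y\<bar>))" .
  qed
qed

text \<open>
  With the left part \<open>p\<close> and the right part \<open>r\<close> of the convolution, \<open>f = (p + r) / 2\<close> and \<open>f' = k (r - p) / 2\<close>.
\<close>

lemma resolvent_pair_exists:
  assumes k: "0 < k" and w: "w \<in> L2"
  shows "\<exists>f'. resolvent_pair k w (resolvent k w) f'"
proof -
  define p where "p = (\<lambda>x. LINT y:{..x}|lebesgue. k * exp (- k * \<bar>x - y\<bar>) * w y)"
  define r where "r = (\<lambda>x. LINT y:{x<..}|lebesgue. k * exp (- k * \<bar>x - y\<bar>) * w y)"
  note P = one_sided_exp_integral[OF k w, of "\<lambda>x. {..x}" k p, OF _ _ _ refl p_def]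
  have p: "ac_deriv p (\<lambda>x. k * (w x - p x))" "p \<in> L2"
    "set_integrable lebesgue {..x} (\<lambda>y. k * exp (- k * \<bar>x - y\<bar>) * w y)" for x
    by (rule P; use k in \<open>auto simp: indicator_def\<close>)+
  note R = one_sided_exp_integral[OF k w, of "\<lambda>x. {x<..}" "- k" r, OF _ _ _ _ r_def]
  have r: "ac_deriv r (\<lambda>x. - k * (w x - r x))" "r \<in> L2"
    "set_integrable lebesgue {x<..} (\<lambda>y. k * exp (- k * \<bar>x - y\<bar>) * w y)" for x
    by (rule R; use k in \<open>auto simp: indicator_def algebra_simps\<close>)+
  have res: "resolvent k w x = 1 / 2 * (p x + r x)" for x
  proof -
    have "p x + r x = (LINT y:{..x} \<union> {x<..}|lebesgue. k * exp (- k * \<bar>x - y\<bar>) * w y)"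
      unfolding p_def r_def using p(3) r(3) by (intro set_integral_Un[symmetric]) auto
    also have "{..x} \<union> {x<..} = UNIV" by auto
    finally show ?thesis
      by (simp add: resolvent_def set_lebesgue_integral_def flip: integral_mult_right_zero)
  qed
  let ?f' = "\<lambda>x. k / 2 * (r x - p x)"
  have "ac_deriv (resolvent k w) (\<lambda>x. 1 / 2 * (k * (w x - p x) + (- k) * (w x - r x)))"
    unfolding res[abs_def] by (intro ac_deriv_cmult ac_deriv_add p r)
  moreover have "(\<lambda>x. 1 / 2 * (k * (w x - p x) + (- k) * (w x - r x))) = ?f'"
    by (auto simp: algebra_simps)
  moreover have "ac_deriv ?f' (\<lambda>x. k / 2 * ((- k) * (w x - r x) - k * (w x - p x)))"
    by (intro ac_deriv_cmult ac_deriv_diff p r)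
  moreover have "(\<lambda>x. k / 2 * ((- k) * (w x - r x) - k * (w x - p x))) = (\<lambda>x. k\<^sup>2 * (resolvent k w x - w x))"
    by (auto simp: res power2_eq_square algebra_simps)
  moreover have "resolvent k w \<in> L2" "?f' \<in> L2"
    unfolding res[abs_def] by (intro L2_cmult L2_add L2_diff p r)+
  ultimately show ?thesis
    using w unfolding resolvent_pair_def by (intro exI[of _ ?f']) simp
qed

definition resolvent_deriv :: "real \<Rightarrow> (real \<Rightarrow> real) \<Rightarrow> real \<Rightarrow> real" where
  "resolvent_deriv k w = (SOME f'. resolvent_pair k w (resolvent k w) f')"

lemma resolvent_pair_resolvent:
  assumes "0 < k" "w \<in> L2"
  shows "resolvent_pair k w (resolvent k w) (resolvent_deriv k w)"
  unfolding resolvent_deriv_def using resolvent_pair_exists[OF assms] by (rule someI_ex)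

lemma resolvent_pair_eq:
  assumes "resolvent_pair k w f f'" "0 < k"
  shows "f = resolvent k w" "f' = resolvent_deriv k w"
  using resolvent_pair_unique[OF assms(1) resolvent_pair_resolvent[OF assms(2) resolvent_pairD(1)[OF assms(1)]] assms(2)]
  by auto

text \<open>
  Whatever element of the class the choice in the definition picks, its representative solves the same equation as
  the convolution, and the solution is unique.
\<close>

lemma inv_helmholtz_AE:
  assumes w: "w \<in> L2"
  shows "AE x in lebesgue. inv_helmholtz w x = resolvent 1 w x"
proof -
  note r = resolvent_pairD[OF resolvent_pair_resolvent[OF zero_less_one w]]
  note h = H2_I[OF r(4,5) _ r(2,3) L2_cmult[OF L2_diff[OF r(2,1)]]]
  have "AE x in lebesgue. resolvent 1 w x - weak_deriv (weak_deriv (resolvent 1 w)) x = w x"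
    using h(3)[OF AE_I2[OF refl]] by eventually_elim simp
  with h(1)[OF AE_I2[OF refl]]
  have *: "inv_helmholtz w \<in> H2 \<and> (AE x in lebesgue. inv_helmholtz w x - weak_deriv (weak_deriv (inv_helmholtz w)) x = w x)"
    unfolding inv_helmholtz_def by (intro someI[of "\<lambda>f. f \<in> H2 \<and> (AE x in lebesgue. f x - weak_deriv (weak_deriv f) x = w x)"]) auto
  then obtain F G where F: "ac_deriv F G" "ac_deriv G (weak_deriv (weak_deriv (inv_helmholtz w)))"
    "AE x in lebesgue. inv_helmholtz w x = F x" "F \<in> L2" "G \<in> L2"
    using H2_ac_deriv[of "inv_helmholtz w"] by blast
  have "AE x in lebesgue. weak_deriv (weak_deriv (inv_helmholtz w)) x = 1\<^sup>2 * (F x - w x)"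
    using conjunct2[OF *] F(3) by eventually_elim simp
  then have "resolvent_pair 1 w F G"
    using ac_deriv_cong_AE[OF F(2)] F w by (simp add: resolvent_pair_def)
  then have "F = resolvent 1 w" by (rule resolvent_pair_eq) simp
  then show ?thesis using F(3) by simp
qed

section \<open>The nonlocal nonlinear term\<close>

definition nonlin :: "real \<Rightarrow> real \<Rightarrow> real" where
  "nonlin p s = \<bar>s\<bar> powr (p - 1) * s"

text \<open>
  The square of this function is \<open>s * nonlin p s\<close>.
\<close>

definition signed_root :: "real \<Rightarrow> real \<Rightarrow> real" where
  "signed_root p s = sgn s * \<bar>s\<bar> powr ((p + 1) / 2)"

text \<open>
  Convexity of \<open>sinh\<close> on the half-line, together with \<open>sinh 0 = 0\<close>.
\<close>

lemma sinh_mult_le: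
  fixes l t :: real
  assumes "0 \<le> l" "l \<le> 1" "0 \<le> t"
  shows "sinh (l * t) \<le> l * sinh t"
proof -
  let ?h = "\<lambda>t. l * sinh t - sinh (l * t)"
  have "?h 0 \<le> ?h t"
  proof (rule DERIV_nonneg_imp_nondecreasing[OF assms(3)])
    fix x :: real assume x: "0 \<le> x"
    have "(?h has_real_derivative l * (cosh x - cosh (l * x))) (at x)"
      by (auto intro!: derivative_eq_intros simp: algebra_simps)
    moreover have "cosh (l * x) \<le> cosh x"
      using assms x by (subst cosh_real_nonneg_le_iff) (auto intro: mult_left_le_one_le)
    ultimately show "\<exists>y. (?h has_real_derivative y) (at x) \<and> 0 \<le> y"
      using assms by (intro exI[of _ "l * (cosh x - cosh (l * x))"]) auto
  qed
  then show ?thesis by simp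
qed

text \<open>
  Since \<open>cosh s - 1 = 2 (sinh (s / 2))\<^sup>2\<close>, this is the square of the inequality \<open>sinh (l s) \<le> l sinh s\<close> with
  \<open>l = a / b\<close>.
\<close>

lemma cosh_comparison:
  fixes a b t :: real
  assumes "0 < a" "a \<le> b"
  shows "cosh (a * t) \<le> 1 + (a / b)\<^sup>2 * cosh (b * t)"
proof -
  have b: "0 < b" using assms by simp
  have half: "cosh s = 1 + 2 * (sinh (s / 2))\<^sup>2" for s :: real
    using cosh_double[of "s / 2"] cosh_square_eq[of "s / 2"] by simp
  define s where "s = b * \<bar>t\<bar> / 2"
  have s: "0 \<le> s" using b by (simp add: s_def)
  have "sinh (a / b * s) \<le> a / b * sinh s"
    using assms b s by (intro sinh_mult_le) auto
  moreover have "0 \<le> sinh (a / b * s)"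
    using assms b s by simp
  ultimately have "(sinh (a / b * s))\<^sup>2 \<le> (a / b * sinh s)\<^sup>2"
    by (intro power_mono) auto
  then have 1: "(sinh (a * \<bar>t\<bar> / 2))\<^sup>2 \<le> (a / b)\<^sup>2 * (sinh (b * \<bar>t\<bar> / 2))\<^sup>2"
    using b by (simp add: s_def power_mult_distrib power_divide)
  have abs: "cosh (c * t) = cosh (c * \<bar>t\<bar>)" for c
    by (cases "t \<ge> 0") (auto simp: abs_if)
  have ha: "cosh (a * t) = 1 + 2 * (sinh (a * \<bar>t\<bar> / 2))\<^sup>2"
    unfolding abs[of a] by (rule half)
  have hb: "cosh (b * t) - 1 = 2 * (sinh (b * \<bar>t\<bar> / 2))\<^sup>2"
    unfolding abs[of b] using half[of "b * \<bar>t\<bar>"] by linarith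
  have "cosh (a * t) \<le> 1 + (a / b)\<^sup>2 * (cosh (b * t) - 1)"
    unfolding ha hb using 1 by linarith
  also have "\<dots> \<le> 1 + (a / b)\<^sup>2 * cosh (b * t)"
    by (simp add: right_diff_distrib)
  finally show ?thesis .
qed

text \<open>
  Put \<open>\<bar>a\<bar> = exp \<alpha>\<close>, \<open>\<bar>b\<bar> = exp \<beta>\<close> and \<open>t = (\<alpha> - \<beta>) / 2\<close>. After division by a common factor the right side is
  \<open>\<plusminus> 2 cosh ((p - 1) t)\<close> and the sum of powers is \<open>2 cosh ((p + 1) t)\<close>. For equal signs the claim follows from
  \<open>cosh \<ge> 1\<close>, for opposite signs it is the comparison of hyperbolic cosines. The constant is the square of the
  coefficient of \<open>\<bar>u\<bar>\<^sup>p\<^sup>+\<^sup>1\<close> in the virial identity, hence smaller than that coefficient.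
\<close>

lemma nonlin_cross_bound:
  fixes a b p :: real
  assumes p: "1 < p"
  shows "2 * (signed_root p a * signed_root p b)
      - ((p - 1) / (p + 1))\<^sup>2 * (\<bar>a\<bar> powr (p + 1) + \<bar>b\<bar> powr (p + 1))
    \<le> a * nonlin p b + b * nonlin p a"
proof (cases "a = 0 \<or> b = 0")
  case True
  then show ?thesis by (auto simp: nonlin_def signed_root_def)
next
  case False
  define \<alpha> \<beta> where "\<alpha> = ln \<bar>a\<bar>" and "\<beta> = ln \<bar>b\<bar>"
  define s t where "s = (p + 1) * (\<alpha> + \<beta>) / 2" and "t = (\<alpha> - \<beta>) / 2"
  define c where "c = ((p - 1) / (p + 1))\<^sup>2"
  have ab: "a = sgn a * exp \<alpha>" "b = sgn b * exp \<beta>"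
    using False by (auto simp: \<alpha>_def \<beta>_def sgn_mult_abs)
  have abs: "\<bar>a\<bar> = exp \<alpha>" "\<bar>b\<bar> = exp \<beta>" using False by (auto simp: \<alpha>_def \<beta>_def)
  have pw: "exp x powr y = exp (y * x)" for x y :: real by (simp add: powr_def)
  have 1: "a * nonlin p b = sgn a * sgn b * (exp s * exp (- (p - 1) * t))"
  proof -
    have "a * nonlin p b = (sgn a * exp \<alpha>) * (exp \<beta> powr (p - 1) * (sgn b * exp \<beta>))"
      unfolding nonlin_def abs ab[symmetric] ..
    also have "\<dots> = sgn a * sgn b * exp (\<alpha> + (p - 1) * \<beta> + \<beta>)"
      by (simp add: pw exp_add)
    also have "\<alpha> + (p - 1) * \<beta> + \<beta> = s + - (p - 1) * t" by (simp add: s_def t_def field_simps)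
    finally show ?thesis by (simp only: exp_add)
  qed
  have 2: "b * nonlin p a = sgn a * sgn b * (exp s * exp ((p - 1) * t))"
  proof -
    have "b * nonlin p a = (sgn b * exp \<beta>) * (exp \<alpha> powr (p - 1) * (sgn a * exp \<alpha>))"
      unfolding nonlin_def abs ab[symmetric] ..
    also have "\<dots> = sgn a * sgn b * exp (\<beta> + (p - 1) * \<alpha> + \<alpha>)"
      by (simp add: pw exp_add)
    also have "\<beta> + (p - 1) * \<alpha> + \<alpha> = s + (p - 1) * t" by (simp add: s_def t_def field_simps)
    finally show ?thesis by (simp only: exp_add)
  qed
  have 3: "signed_root p a * signed_root p b = sgn a * sgn b * exp s"
  proof -
    have "signed_root p a * signed_root p b = sgn a * sgn b * exp ((p + 1) / 2 * \<alpha> + (p + 1) / 2 * \<beta>)"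
      by (simp add: signed_root_def abs pw exp_add)
    also have "(p + 1) / 2 * \<alpha> + (p + 1) / 2 * \<beta> = s" by (simp add: s_def field_simps)
    finally show ?thesis .
  qed
  have 4: "\<bar>a\<bar> powr (p + 1) + \<bar>b\<bar> powr (p + 1) = exp s * (2 * cosh ((p + 1) * t))"
  proof -
    have "(p + 1) * \<alpha> = s + (p + 1) * t" "(p + 1) * \<beta> = s + - ((p + 1) * t)"
      by (simp_all add: s_def t_def field_simps)
    then show ?thesis unfolding abs pw by (simp only: exp_add cosh_def) (simp add: algebra_simps)
  qed
  have 5: "a * nonlin p b + b * nonlin p a = sgn a * sgn b * (exp s * (2 * cosh ((p - 1) * t)))"
    unfolding 1 2 by (simp add: cosh_def algebra_simps)
  have c0: "0 \<le> c" by (simp add: c_def)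
  have key: "cosh ((p - 1) * t) \<le> 1 + c * cosh ((p + 1) * t)"
    unfolding c_def using p by (intro cosh_comparison) auto
  have ge1: "1 \<le> cosh ((p - 1) * t)" "1 \<le> cosh ((p + 1) * t)" by (rule cosh_real_ge_1)+
  have "sgn a * sgn b = 1 \<or> sgn a * sgn b = - 1" using False by (auto simp: sgn_if)
  then have "2 * (sgn a * sgn b) - c * (2 * cosh ((p + 1) * t)) \<le> sgn a * sgn b * (2 * cosh ((p - 1) * t))"
  proof
    assume e: "sgn a * sgn b = 1"
    have "0 \<le> c * cosh ((p + 1) * t)" using c0 ge1(2) by (intro mult_nonneg_nonneg) auto
    then show ?thesis unfolding e using ge1(1) by linarith
  next
    assume e: "sgn a * sgn b = - 1"
    show ?thesis unfolding e using key by simp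
  qed
  then have "exp s * (2 * (sgn a * sgn b) - c * (2 * cosh ((p + 1) * t)))
      \<le> exp s * (sgn a * sgn b * (2 * cosh ((p - 1) * t)))"
    by (intro mult_left_mono) auto
  then show ?thesis
    unfolding 3 4 5 c_def[symmetric] by (simp add: algebra_simps)
qed

lemma abs_nonlin: "1 < p \<Longrightarrow> \<bar>nonlin p s\<bar> = \<bar>s\<bar> powr p"
  by (cases "s = 0") (auto simp: nonlin_def abs_mult powr_mult_base powr_diff)

lemma nonlin_mult_self: "1 < p \<Longrightarrow> s * nonlin p s = \<bar>s\<bar> powr (p + 1)"
proof -
  assume p: "1 < p"
  have "s * nonlin p s = \<bar>s\<bar> powr (p - 1) * (\<bar>s\<bar> * \<bar>s\<bar>)"
    by (simp add: nonlin_def mult_ac)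
  also have "\<dots> = \<bar>s\<bar> powr (p + 1)"
  proof (cases "s = 0")
    case False
    have "\<bar>s\<bar> powr (p + 1) = \<bar>s\<bar> powr ((p - 1) + 2)" by (simp add: add.commute)
    also have "\<dots> = \<bar>s\<bar> powr (p - 1) * \<bar>s\<bar>\<^sup>2"
      unfolding powr_add using False by simp
    finally show ?thesis by (simp only: power2_eq_square)
  qed (use p in auto)
  finally show ?thesis .
qed

lemma young_nonlin:
  fixes a b p :: real
  assumes p: "1 < p"
  shows "\<bar>a * nonlin p b\<bar> \<le> (\<bar>a\<bar> powr (p + 1) + p * \<bar>b\<bar> powr (p + 1)) / (p + 1)"
proof -
  have "\<bar>a * nonlin p b\<bar> = \<bar>a\<bar> * \<bar>b\<bar> powr p" using p by (simp add: abs_mult abs_nonlin)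
  also have "\<dots> \<le> \<bar>a\<bar> powr (p + 1) / (p + 1) + (\<bar>b\<bar> powr p) powr ((p + 1) / p) / ((p + 1) / p)"
    using p by (intro Youngs_inequality) (auto simp: field_simps)
  also have "(\<bar>b\<bar> powr p) powr ((p + 1) / p) = \<bar>b\<bar> powr (p + 1)"
    using p by (simp add: powr_powr)
  also have "\<bar>a\<bar> powr (p + 1) / (p + 1) + \<bar>b\<bar> powr (p + 1) / ((p + 1) / p)
      = (\<bar>a\<bar> powr (p + 1) + p * \<bar>b\<bar> powr (p + 1)) / (p + 1)"
  proof -
    have "\<bar>b\<bar> powr (p + 1) / ((p + 1) / p) = p * \<bar>b\<bar> powr (p + 1) / (p + 1)"
      by (simp only: divide_divide_eq_right mult.commute)
    then show ?thesis by (simp only: add_divide_distrib[of "\<bar>a\<bar> powr (p + 1)"])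
  qed
  finally show ?thesis .
qed

lemma exp_kernel_pair_integrable:
  fixes k :: real and a :: "real \<Rightarrow> real"
  assumes k: "0 < k" and a: "integrable lborel a"
  shows "integrable (lborel \<Otimes>\<^sub>M lborel) (\<lambda>(x, y). exp (- k * \<bar>x - y\<bar>) * a x)"
    and "integrable (lborel \<Otimes>\<^sub>M lborel) (\<lambda>(x, y). exp (- k * \<bar>x - y\<bar>) * a y)"
    and "(LINT z|(lborel \<Otimes>\<^sub>M lborel). (case z of (x, y) \<Rightarrow> exp (- k * \<bar>x - y\<bar>) * a x)) = 2 / k * (LINT x|lborel. a x)"
    and "(LINT z|(lborel \<Otimes>\<^sub>M lborel). (case z of (x, y) \<Rightarrow> exp (- k * \<bar>x - y\<bar>) * a y)) = 2 / k * (LINT x|lborel. a x)"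
proof -
  have [measurable]: "a \<in> borel_measurable borel" using borel_measurable_integrable[OF a] by simp
  have ker: "integrable lborel (\<lambda>y. exp (- k * \<bar>x - y\<bar>))" "(LINT y|lborel. exp (- k * \<bar>x - y\<bar>)) = 2 / k" for x
    using exp_kernel_integral[OF k, of x] by (auto simp: integrable_completion integral_completion)
  let ?F = "\<lambda>(x, y). exp (- k * \<bar>x - y\<bar>) * a x"
  show 1: "integrable (lborel \<Otimes>\<^sub>M lborel) ?F"
  proof (rule lborel_pair.Fubini_integrable)
    show "?F \<in> borel_measurable (lborel \<Otimes>\<^sub>M lborel)" by measurable
    have "(\<lambda>x. LINT y|lborel. norm (?F (x, y))) = (\<lambda>x. 2 / k * \<bar>a x\<bar>)"
      using ker by (auto simp: abs_mult)
    then show "integrable lborel (\<lambda>x. LINT y|lborel. norm (?F (x, y)))"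
      using a by simp
    show "AE x in lborel. integrable lborel (\<lambda>y. ?F (x, y))"
      using ker by simp
  qed
  show v1: "(LINT z|(lborel \<Otimes>\<^sub>M lborel). ?F z) = 2 / k * (LINT x|lborel. a x)"
  proof -
    have "(LINT z|(lborel \<Otimes>\<^sub>M lborel). ?F z) = (LINT x|lborel. LINT y|lborel. exp (- k * \<bar>x - y\<bar>) * a x)"
      using lborel_pair.integral_fst[OF 1] by simp
    also have "\<dots> = (LINT x|lborel. 2 / k * a x)"
      using ker by simp
    finally show ?thesis by simp
  qed
  have sw: "(\<lambda>(x, y). ?F (y, x)) = (\<lambda>(x, y). exp (- k * \<bar>x - y\<bar>) * a y)"
    by (auto simp: abs_minus_commute)
  show "integrable (lborel \<Otimes>\<^sub>M lborel) (\<lambda>(x, y). exp (- k * \<bar>x - y\<bar>) * a y)"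
    using lborel_pair.integrable_product_swap[OF 1] unfolding sw .
  show "(LINT z|(lborel \<Otimes>\<^sub>M lborel). (case z of (x, y) \<Rightarrow> exp (- k * \<bar>x - y\<bar>) * a y)) = 2 / k * (LINT x|lborel. a x)"
    using lborel_pair.integral_product_swap[of ?F] 1 v1 unfolding sw by (auto dest: borel_measurable_integrable)
qed

lemma resolvent_pairing:
  fixes a b :: "real \<Rightarrow> real"
  assumes [measurable]: "a \<in> borel_measurable borel" "b \<in> borel_measurable borel"
    and a: "a \<in> L2" and b: "b \<in> L2"
  shows "integrable (lborel \<Otimes>\<^sub>M lborel) (\<lambda>(x, y). 1 / 2 * exp (- \<bar>x - y\<bar>) * (a x * b y))"
    and "(LINT z|(lborel \<Otimes>\<^sub>M lborel). (case z of (x, y) \<Rightarrow> 1 / 2 * exp (- \<bar>x - y\<bar>) * (a x * b y)))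
      = ip a (resolvent 1 b)"
proof -
  have i2: "integrable lborel (\<lambda>x. (a x)\<^sup>2)" "integrable lborel (\<lambda>x. (b x)\<^sup>2)"
    using L2_integrable_square[OF a] L2_integrable_square[OF b] by (simp_all add: integrable_completion)
  let ?F = "\<lambda>(x, y). 1 / 2 * exp (- \<bar>x - y\<bar>) * (a x * b y)"
  show 1: "integrable (lborel \<Otimes>\<^sub>M lborel) ?F"
  proof (rule Bochner_Integration.integrable_bound)
    show "integrable (lborel \<Otimes>\<^sub>M lborel) (\<lambda>z. (case z of (x, y) \<Rightarrow> exp (- 1 * \<bar>x - y\<bar>) * (a x)\<^sup>2)
        + (case z of (x, y) \<Rightarrow> exp (- 1 * \<bar>x - y\<bar>) * (b y)\<^sup>2))"
      by (intro Bochner_Integration.integrable_add exp_kernel_pair_integrable i2) auto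
    show "?F \<in> borel_measurable (lborel \<Otimes>\<^sub>M lborel)" by measurable
    have "\<bar>1 / 2 * exp (- \<bar>x - y\<bar>) * (a x * b y)\<bar> \<le> exp (- \<bar>x - y\<bar>) * (a x)\<^sup>2 + exp (- \<bar>x - y\<bar>) * (b y)\<^sup>2" for x y
    proof -
      have "\<bar>1 / 2 * (a x * b y)\<bar> \<le> (a x)\<^sup>2 + (b y)\<^sup>2"
      proof -
        have "\<bar>1 / 2 * (a x * b y)\<bar> = 1 / 4 * (2 * \<bar>a x\<bar> * \<bar>b y\<bar>)" by (simp add: abs_mult)
        also have "\<dots> \<le> 1 / 4 * ((a x)\<^sup>2 + (b y)\<^sup>2)"
          using sum_squares_bound[of "\<bar>a x\<bar>" "\<bar>b y\<bar>"] by simp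
        also have "\<dots> \<le> (a x)\<^sup>2 + (b y)\<^sup>2" by simp
        finally show ?thesis .
      qed
      then have "exp (- \<bar>x - y\<bar>) * \<bar>1 / 2 * (a x * b y)\<bar> \<le> exp (- \<bar>x - y\<bar>) * ((a x)\<^sup>2 + (b y)\<^sup>2)"
        by (intro mult_left_mono) auto
      then show ?thesis by (simp add: abs_mult distrib_left mult_ac)
    qed
    then show "AE z in lborel \<Otimes>\<^sub>M lborel. norm (?F z) \<le> norm ((case z of (x, y) \<Rightarrow> exp (- 1 * \<bar>x - y\<bar>) * (a x)\<^sup>2)
        + (case z of (x, y) \<Rightarrow> exp (- 1 * \<bar>x - y\<bar>) * (b y)\<^sup>2))"
      by (intro AE_I2) (auto split: prod.splits)
  qed
  have "(LINT z|(lborel \<Otimes>\<^sub>M lborel). ?F z) = (LINT x|lborel. LINT y|lborel. 1 / 2 * exp (- \<bar>x - y\<bar>) * (a x * b y))"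
    using lborel_pair.integral_fst[OF 1] by simp
  also have "\<dots> = (LINT x|lborel. a x * resolvent 1 b x)"
  proof (rule Bochner_Integration.integral_cong[OF refl])
    fix x
    have "(LINT y|lborel. 1 / 2 * exp (- \<bar>x - y\<bar>) * (a x * b y)) = (LINT y|lborel. a x * (1 / 2 * exp (- \<bar>x - y\<bar>) * b y))"
      by (simp add: mult_ac)
    also have "\<dots> = a x * (LINT y|lborel. 1 / 2 * exp (- \<bar>x - y\<bar>) * b y)" by simp
    also have "(LINT y|lborel. 1 / 2 * exp (- \<bar>x - y\<bar>) * b y) = resolvent 1 b x"
      unfolding resolvent_def by (subst integral_completion) auto
    finally show "(LINT y|lborel. 1 / 2 * exp (- \<bar>x - y\<bar>) * (a x * b y)) = a x * resolvent 1 b x" .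
  qed
  also have "\<dots> = ip a (resolvent 1 b)"
  proof -
    have "continuous_on UNIV (resolvent 1 b)"
      by (rule ac_deriv_continuous[OF resolvent_pairD(4)[OF resolvent_pair_resolvent[OF zero_less_one b]]])
    then have [measurable]: "resolvent 1 b \<in> borel_measurable borel" by (rule borel_measurable_continuous_onI)
    show ?thesis unfolding ip_def by (subst integral_completion) auto
  qed
  finally show "(LINT z|(lborel \<Otimes>\<^sub>M lborel). ?F z) = ip a (resolvent 1 b)" .
qed

lemma exp_weight_ratio:
  fixes x y L q :: real
  assumes "0 < L" "0 \<le> q" "q \<le> 1"
  shows "\<bar>exp (- q * (\<bar>x\<bar> - \<bar>y\<bar>) / L) - 1\<bar> \<le> exp (\<bar>x - y\<bar> / L) - 1"
proof -
  define s where "s = - q * (\<bar>x\<bar> - \<bar>y\<bar>) / L"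
  have "\<bar>s\<bar> = q * \<bar>\<bar>x\<bar> - \<bar>y\<bar>\<bar> / L" using assms by (simp add: s_def abs_mult)
  also have "\<dots> \<le> 1 * \<bar>x - y\<bar> / L"
    using assms by (intro divide_right_mono mult_mono) auto
  finally have s: "\<bar>s\<bar> \<le> \<bar>x - y\<bar> / L" by simp
  have "\<bar>exp s - 1\<bar> \<le> exp \<bar>s\<bar> - 1"
  proof (cases "0 \<le> s")
    case False
    have "2 \<le> exp s + exp (- s)" using cosh_real_ge_1[of s] by (simp add: cosh_def)
    then show ?thesis using False by (simp add: abs_if)
  qed simp
  also have "\<dots> \<le> exp (\<bar>x - y\<bar> / L) - 1" using s by simp
  finally show ?thesis by (simp add: s_def)
qed

lemma weighted_nonlin:
  fixes x L p s :: real
  assumes p: "1 < p"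
  defines "e \<equiv> \<lambda>x::real. exp (- (1 / (p + 1)) * \<bar>x\<bar> / L)"
  shows "nonlin p (e x * s) = exp (- (p / (p + 1)) * \<bar>x\<bar> / L) * nonlin p s"
    and "\<bar>e x * s\<bar> powr (p + 1) = exp (- \<bar>x\<bar> / L) * \<bar>s\<bar> powr (p + 1)"
proof -
  have pw: "e x powr q = exp (- (q / (p + 1)) * \<bar>x\<bar> / L)" for q
    by (simp add: e_def powr_def)
  have abs: "\<bar>e x * s\<bar> = e x * \<bar>s\<bar>" by (simp add: abs_mult e_def)
  have e0: "0 < e x" by (simp add: e_def)
  have "nonlin p (e x * s) = (e x powr (p - 1) * e x) * nonlin p s"
    using e0 unfolding nonlin_def abs by (simp add: powr_mult)
  also have "e x powr (p - 1) * e x = e x powr p"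
    using e0 by (simp add: powr_diff)
  finally show "nonlin p (e x * s) = exp (- (p / (p + 1)) * \<bar>x\<bar> / L) * nonlin p s"
    by (simp only: pw)
  show "\<bar>e x * s\<bar> powr (p + 1) = exp (- \<bar>x\<bar> / L) * \<bar>s\<bar> powr (p + 1)"
    using e0 p unfolding abs by (simp add: powr_mult pw)
qed

lemma bounded_L2_powr:
  assumes u: "u \<in> L2" and B: "\<And>x. \<bar>u x\<bar> \<le> B" and q: "1 \<le> q"
  shows "(\<lambda>x. \<bar>u x\<bar> powr q) \<in> L2"
proof -
  have [measurable]: "u \<in> borel_measurable lebesgue" by (rule L2_measurable[OF u])
  have B0: "0 \<le> B" using B[of 0] by linarith
  have "\<bar>u x\<bar> powr q = \<bar>u x\<bar> powr (q - 1) * \<bar>u x\<bar>" for x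
    by (cases "u x = 0") (auto simp: powr_diff)
  moreover have "(\<lambda>x. \<bar>u x\<bar> powr (q - 1) * \<bar>u x\<bar>) \<in> L2"
  proof (rule L2_bounded_mult[OF L2_abs[OF u]])
    show "(\<lambda>x. \<bar>u x\<bar> powr (q - 1)) \<in> borel_measurable lebesgue" by measurable
    show "\<bar>\<bar>u x\<bar> powr (q - 1)\<bar> \<le> B powr (q - 1)" for x
      using B[of x] q B0 by (auto intro!: powr_mono2)
  qed
  ultimately show ?thesis by simp
qed

lemma nonlin_measurable [measurable]: "nonlin p \<in> borel_measurable borel"
  unfolding nonlin_def[abs_def] by measurable

lemma signed_root_measurable [measurable]: "signed_root p \<in> borel_measurable borel"
  unfolding signed_root_def[abs_def] by measurable

lemma nonlin_L2:
  assumes u: "u \<in> L2" and B: "\<And>x. \<bar>u x\<bar> \<le> B" and p: "1 < p"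
  shows "(\<lambda>x. nonlin p (u x)) \<in> L2"
proof (rule L2_dominated[OF bounded_L2_powr[OF u B, of p]])
  show "(\<lambda>x. nonlin p (u x)) \<in> borel_measurable lebesgue"
    using L2_measurable[OF u] by measurable
qed (use p in \<open>auto simp: abs_nonlin\<close>)

lemma integrable_powr_Suc:
  assumes u: "u \<in> L2" and B: "\<And>x. \<bar>u x\<bar> \<le> B" and p: "1 < p"
  shows "integrable lebesgue (\<lambda>x. \<bar>u x\<bar> powr (p + 1))"
  using L2_integrable_mult[OF u nonlin_L2[OF assms]] p by (simp add: nonlin_mult_self)

text \<open>
  The weight \<open>exp (- \<bar>x\<bar> / L)\<close> of the product \<open>u(x) f(u(y))\<close> is distributed over both factors in such a way that
  they become \<open>w(x) f(w(y))\<close> for the weighted function \<open>w = exp (- \<bar>x\<bar> / L)\<^sup>1\<^sup>/\<^sup>(\<^sup>p\<^sup>+\<^sup>1\<^sup>) u\<close>. What remains is a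
  factor that is close to one as long as \<open>\<bar>x - y\<bar>\<close> is small compared with \<open>L\<close>.
\<close>

locale weighted_profile =
  fixes p L :: real and u :: "real \<Rightarrow> real" and B :: real
  assumes p: "1 < p" and L: "1 < L" and u: "u \<in> L2" and uc: "continuous_on UNIV u" and B: "\<And>x. \<bar>u x\<bar> \<le> B"
begin

definition wu :: "real \<Rightarrow> real" where "wu x = exp (- (1 / (p + 1)) * \<bar>x\<bar> / L) * u x"

lemma u_measurable [measurable]: "u \<in> borel_measurable borel"
  by (rule borel_measurable_continuous_onI[OF uc])

lemma wu_measurable [measurable]: "wu \<in> borel_measurable borel"
  unfolding wu_def[abs_def] by measurable

lemma decay_le_1: "0 \<le> q \<Longrightarrow> exp (- q * \<bar>x\<bar> / L) \<le> 1" "0 \<le> q \<Longrightarrow> \<bar>exp (- q * \<bar>x\<bar> / L)\<bar> \<le> 1"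
  using L by (auto simp: divide_nonpos_pos)

lemma wu_L2: "wu \<in> L2"
  unfolding wu_def[abs_def]
  by (rule L2_bounded_mult[OF u, where K = 1]) (use decay_le_1(2)[of "1 / (p + 1)"] p in \<open>auto intro!: measurable_completion\<close>)

lemma wu_bounded: "\<bar>wu x\<bar> \<le> B"
proof -
  have "\<bar>wu x\<bar> \<le> 1 * \<bar>u x\<bar>"
    unfolding wu_def abs_mult using decay_le_1(2)[of "1 / (p + 1)" x] p by (intro mult_right_mono) auto
  then show ?thesis using B[of x] by simp
qed

definition mass :: real where "mass = (LINT x|lebesgue. exp (- \<bar>x\<bar> / L) * \<bar>u x\<bar> powr (p + 1))"

lemma wu_powr: "\<bar>wu x\<bar> powr (p + 1) = exp (- \<bar>x\<bar> / L) * \<bar>u x\<bar> powr (p + 1)"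
  unfolding wu_def by (rule weighted_nonlin(2)[OF p])

lemma integrable_wu_powr: "integrable lborel (\<lambda>x. \<bar>wu x\<bar> powr (p + 1))"
  using integrable_powr_Suc[OF wu_L2 wu_bounded p] by (simp add: integrable_completion)

lemma mass_eq: "(LINT x|lborel. \<bar>wu x\<bar> powr (p + 1)) = mass"
proof -
  have "(LINT x|lebesgue. \<bar>wu x\<bar> powr (p + 1)) = mass" by (simp add: mass_def wu_powr)
  then show ?thesis by (subst (asm) integral_completion) auto
qed

text \<open>
  The majorant that Young's inequality provides for the kernel \<open>exp (- k \<bar>x - y\<bar>) / 2\<close>. With \<open>k = 1 - 1 / L\<close> it
  bounds the weighted product; the difference to \<open>k = 1\<close> bounds the error made in symmetrising the weight.
\<close>

lemma young_kernel_integral: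
  assumes "0 < k"
  defines "F \<equiv> \<lambda>z. case z of (x, y) \<Rightarrow> 1 / 2 * exp (- k * \<bar>x - y\<bar>) *
      ((\<bar>wu x\<bar> powr (p + 1) + p * \<bar>wu y\<bar> powr (p + 1)) / (p + 1))"
  shows "integrable (lborel \<Otimes>\<^sub>M lborel) F" "(LINT z|(lborel \<Otimes>\<^sub>M lborel). F z) = mass / k"
proof -
  note E = exp_kernel_pair_integrable[OF assms(1) integrable_wu_powr]
  have F: "F = (\<lambda>z. 1 / (2 * (p + 1)) * (case z of (x, y) \<Rightarrow> exp (- k * \<bar>x - y\<bar>) * \<bar>wu x\<bar> powr (p + 1))
     + p / (2 * (p + 1)) * (case z of (x, y) \<Rightarrow> exp (- k * \<bar>x - y\<bar>) * \<bar>wu y\<bar> powr (p + 1)))"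
  proof
    fix z :: "real \<times> real"
    obtain x y where z: "z = (x, y)" by (cases z)
    have "1 / 2 * E * ((X + p * Y) / (p + 1)) = 1 / (2 * (p + 1)) * (E * X) + p / (2 * (p + 1)) * (E * Y)" for E X Y :: real
      using p by (simp add: divide_simps) (simp add: algebra_simps)
    then show "F z = 1 / (2 * (p + 1)) * (case z of (x, y) \<Rightarrow> exp (- k * \<bar>x - y\<bar>) * \<bar>wu x\<bar> powr (p + 1))
     + p / (2 * (p + 1)) * (case z of (x, y) \<Rightarrow> exp (- k * \<bar>x - y\<bar>) * \<bar>wu y\<bar> powr (p + 1))"
      unfolding F_def z by simp
  qed
  show "integrable (lborel \<Otimes>\<^sub>M lborel) F"
    unfolding F using E(1,2) by (intro Bochner_Integration.integrable_add integrable_mult_right)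
  have "(LINT z|(lborel \<Otimes>\<^sub>M lborel). F z) = 1 / (2 * (p + 1)) * (2 / k * mass) + p / (2 * (p + 1)) * (2 / k * mass)"
  proof -
    let ?X = "\<lambda>z. case z of (x, y) \<Rightarrow> exp (- k * \<bar>x - y\<bar>) * \<bar>wu x\<bar> powr (p + 1)"
    let ?Y = "\<lambda>z. case z of (x, y) \<Rightarrow> exp (- k * \<bar>x - y\<bar>) * \<bar>wu y\<bar> powr (p + 1)"
    let ?M = "lborel \<Otimes>\<^sub>M lborel :: (real \<times> real) measure"
    have "(LINT z|?M. F z) = (LINT z|?M. 1 / (2 * (p + 1)) * ?X z) + (LINT z|?M. p / (2 * (p + 1)) * ?Y z)"
      unfolding F by (intro Bochner_Integration.integral_add integrable_mult_right E)
    also have "(LINT z|?M. 1 / (2 * (p + 1)) * ?X z) = 1 / (2 * (p + 1)) * (LINT z|?M. ?X z)"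
      by (rule integral_mult_right_zero)
    also have "(LINT z|?M. p / (2 * (p + 1)) * ?Y z) = p / (2 * (p + 1)) * (LINT z|?M. ?Y z)"
      by (rule integral_mult_right_zero)
    finally show ?thesis by (simp only: E(3,4) mass_eq)
  qed
  also have "\<dots> = (1 / (2 * (p + 1)) + p / (2 * (p + 1))) * (2 / k * mass)"
    by (simp only: distrib_right)
  also have "1 / (2 * (p + 1)) + p / (2 * (p + 1)) = 1 / 2" using p by (simp add: field_simps)
  also have "1 / 2 * (2 / k * mass) = mass / k" by simp
  finally show "(LINT z|(lborel \<Otimes>\<^sub>M lborel). F z) = mass / k" .
qed

lemma weight_split:
  "exp (- \<bar>x\<bar> / L) * u x * nonlin p (u y)
    = exp (- (p / (p + 1)) * (\<bar>x\<bar> - \<bar>y\<bar>) / L) * (wu x * nonlin p (wu y))"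
proof -
  have "wu x * nonlin p (wu y) = exp (- (1 / (p + 1)) * \<bar>x\<bar> / L) * exp (- (p / (p + 1)) * \<bar>y\<bar> / L) * (u x * nonlin p (u y))"
    unfolding wu_def weighted_nonlin(1)[OF p] by simp
  moreover have "exp (- (p / (p + 1)) * (\<bar>x\<bar> - \<bar>y\<bar>) / L) * (exp (- (1 / (p + 1)) * \<bar>x\<bar> / L) * exp (- (p / (p + 1)) * \<bar>y\<bar> / L))
      = exp (- \<bar>x\<bar> / L)"
  proof -
    have "- (p / (p + 1)) * (\<bar>x\<bar> - \<bar>y\<bar>) / L + (- (1 / (p + 1)) * \<bar>x\<bar> / L + - (p / (p + 1)) * \<bar>y\<bar> / L) = - \<bar>x\<bar> / L"
    proof -
      have gen: "- q * (\<bar>x\<bar> - \<bar>y\<bar>) / L + (- r * \<bar>x\<bar> / L + - q * \<bar>y\<bar> / L) = - ((q + r) * \<bar>x\<bar>) / L" for q r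
        using L by (simp add: field_simps)
      have sum1: "p / (p + 1) + 1 / (p + 1) = 1" using p by (simp add: field_simps)
      show ?thesis using gen[of "p / (p + 1)" "1 / (p + 1)"] unfolding sum1 mult_1 .
    qed
    then show ?thesis by (simp only: exp_add[symmetric])
  qed
  ultimately show ?thesis by (metis mult.assoc)
qed

lemma k1: "0 < 1 - 1 / L" "1 / (1 - 1 / L) = 1 + 1 / (L - 1)"
  using L by (auto simp: field_simps)

lemma exp_kernel_shift: "exp (- \<bar>x - y\<bar>) * exp (\<bar>x - y\<bar> / L) = exp (- (1 - 1 / L) * \<bar>x - y\<bar>)"
  unfolding exp_add[symmetric] by (simp add: algebra_simps)

lemma nonlin_u_L2: "(\<lambda>x. nonlin p (u x)) \<in> L2"
  by (rule nonlin_L2[OF u B p])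

lemma pairing_abs_bound:
  assumes [measurable]: "\<psi> \<in> borel_measurable borel" and \<psi>: "\<And>x. \<bar>\<psi> x\<bar> \<le> C * exp (- \<bar>x\<bar> / L)"
  shows "\<bar>ip (\<lambda>x. \<psi> x * u x) (resolvent 1 (\<lambda>x. nonlin p (u x)))\<bar> \<le> C * (1 + 1 / (L - 1)) * mass"
proof -
  have C: "0 \<le> C" using \<psi>[of 0] by simp
  have \<psi>b: "\<bar>\<psi> x\<bar> \<le> C" for x
    using \<psi>[of x] mult_left_mono[OF decay_le_1(1)[of 1 x] C] by simp
  have L2: "(\<lambda>x. \<psi> x * u x) \<in> L2" by (rule L2_bounded_mult[OF u _ \<psi>b]) (auto intro!: measurable_completion)
  note P = resolvent_pairing[OF _ _ L2 nonlin_u_L2]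
  note Y = young_kernel_integral[OF k1(1)]
  let ?Y = "\<lambda>z. case z of (x, y) \<Rightarrow> 1 / 2 * exp (- (1 - 1 / L) * \<bar>x - y\<bar>) *
      ((\<bar>wu x\<bar> powr (p + 1) + p * \<bar>wu y\<bar> powr (p + 1)) / (p + 1))"
  have "\<bar>ip (\<lambda>x. \<psi> x * u x) (resolvent 1 (\<lambda>x. nonlin p (u x)))\<bar>
     = \<bar>LINT z|(lborel \<Otimes>\<^sub>M lborel). (case z of (x, y) \<Rightarrow> 1 / 2 * exp (- \<bar>x - y\<bar>) * ((\<psi> x * u x) * nonlin p (u y)))\<bar>"
    by (subst P(2)) auto
  also have "\<dots> = norm (LINT z|(lborel \<Otimes>\<^sub>M lborel). (case z of (x, y) \<Rightarrow> 1 / 2 * exp (- \<bar>x - y\<bar>) * ((\<psi> x * u x) * nonlin p (u y))))"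
    by simp
  also have "\<dots> \<le> (LINT z|(lborel \<Otimes>\<^sub>M lborel). C * ?Y z)"
  proof (rule Bochner_Integration.integral_norm_bound_integral)
    show "integrable (lborel \<Otimes>\<^sub>M lborel) (\<lambda>z. case z of (x, y) \<Rightarrow> 1 / 2 * exp (- \<bar>x - y\<bar>) * ((\<psi> x * u x) * nonlin p (u y)))"
      by (rule P(1)) auto
    show "integrable (lborel \<Otimes>\<^sub>M lborel) (\<lambda>z. C * ?Y z)" using Y(1) by (rule integrable_mult_right)
    fix z :: "real \<times> real"
    obtain x y where z: "z = (x, y)" by (cases z)
    let ?T = "(\<bar>wu x\<bar> powr (p + 1) + p * \<bar>wu y\<bar> powr (p + 1)) / (p + 1)"
    have "\<bar>(\<psi> x * u x) * nonlin p (u y)\<bar> \<le> (C * exp (- \<bar>x\<bar> / L)) * \<bar>u x * nonlin p (u y)\<bar>"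
      unfolding mult.assoc[of "\<psi> x"] abs_mult[of "\<psi> x"] by (intro mult_right_mono \<psi>) auto
    also have "\<dots> = C * \<bar>exp (- \<bar>x\<bar> / L) * u x * nonlin p (u y)\<bar>"
      by (simp add: abs_mult)
    also have "\<dots> = C * (exp (- (p / (p + 1)) * (\<bar>x\<bar> - \<bar>y\<bar>) / L) * \<bar>wu x * nonlin p (wu y)\<bar>)"
      unfolding weight_split by (simp add: abs_mult)
    also have "\<dots> \<le> C * (exp (\<bar>x - y\<bar> / L) * ?T)"
    proof -
      have "\<bar>exp (- (p / (p + 1)) * (\<bar>x\<bar> - \<bar>y\<bar>) / L) - 1\<bar> \<le> exp (\<bar>x - y\<bar> / L) - 1"
        using p L by (intro exp_weight_ratio) auto
      then have "exp (- (p / (p + 1)) * (\<bar>x\<bar> - \<bar>y\<bar>) / L) \<le> exp (\<bar>x - y\<bar> / L)" by linarith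
      then show ?thesis by (intro mult_left_mono[OF _ C] mult_mono young_nonlin[OF p]) auto
    qed
    finally have *: "\<bar>(\<psi> x * u x) * nonlin p (u y)\<bar> \<le> C * (exp (\<bar>x - y\<bar> / L) * ?T)" .
    have "1 / 2 * exp (- \<bar>x - y\<bar>) * \<bar>(\<psi> x * u x) * nonlin p (u y)\<bar> \<le> 1 / 2 * exp (- \<bar>x - y\<bar>) * (C * (exp (\<bar>x - y\<bar> / L) * ?T))"
      by (intro mult_left_mono *) auto
    also have "\<dots> = C * (1 / 2 * (exp (- \<bar>x - y\<bar>) * exp (\<bar>x - y\<bar> / L)) * ?T)" by simp
    finally show "norm (case z of (x, y) \<Rightarrow> 1 / 2 * exp (- \<bar>x - y\<bar>) * ((\<psi> x * u x) * nonlin p (u y))) \<le> C * ?Y z"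
      unfolding z exp_kernel_shift by (simp add: abs_mult)
  qed
  also have "\<dots> = C * (1 + 1 / (L - 1)) * mass"
  proof -
    have "(LINT z|(lborel \<Otimes>\<^sub>M lborel). C * ?Y z) = C * (mass / (1 - 1 / L))"
      unfolding Y(2)[symmetric] by (rule integral_mult_right_zero)
    also have "\<dots> = C * (1 / (1 - 1 / L)) * mass" by simp
    finally show ?thesis by (simp only: k1(2))
  qed
  finally show ?thesis .
qed

lemma signed_root_wu_L2: "(\<lambda>x. signed_root p (wu x)) \<in> L2"
  by (rule L2_dominated[OF bounded_L2_powr[OF wu_L2 wu_bounded, of "(p + 1) / 2"]])
    (use p in \<open>auto simp: signed_root_def abs_mult abs_sgn_eq intro!: measurable_completion\<close>)

text \<open>
  The kernel is positive, so the pointwise bound for \<open>a f(b) + b f(a)\<close> can be integrated. Its product term becomes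
  a pairing of the resolvent of a function with that function, which is nonnegative.
\<close>

lemma symmetric_pairing_lower_bound:
  "- ((p - 1) / (p + 1))\<^sup>2 * mass \<le> ip wu (resolvent 1 (\<lambda>x. nonlin p (wu x)))"
proof -
  let ?c = "((p - 1) / (p + 1))\<^sup>2" and ?M = "lborel \<Otimes>\<^sub>M lborel :: (real \<times> real) measure"
  let ?g = "\<lambda>x. signed_root p (wu x)"
  let ?F = "\<lambda>(x, y). 1 / 2 * exp (- \<bar>x - y\<bar>) * (wu x * nonlin p (wu y))"
  let ?F' = "\<lambda>(x, y). 1 / 2 * exp (- \<bar>x - y\<bar>) * (wu y * nonlin p (wu x))"
  let ?G = "\<lambda>(x, y). 1 / 2 * exp (- \<bar>x - y\<bar>) * (?g x * ?g y)"
  let ?X = "\<lambda>(x, y). exp (- 1 * \<bar>x - y\<bar>) * \<bar>wu x\<bar> powr (p + 1)"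
  let ?Y = "\<lambda>(x, y). exp (- 1 * \<bar>x - y\<bar>) * \<bar>wu y\<bar> powr (p + 1)"
  note F = resolvent_pairing[OF wu_measurable _ wu_L2 nonlin_L2[OF wu_L2 wu_bounded p]]
  have iF: "integrable ?M ?F" by (rule F(1)) measurable
  have vF: "(LINT z|?M. ?F z) = ip wu (resolvent 1 (\<lambda>x. nonlin p (wu x)))" by (rule F(2)) measurable
  have sw: "(\<lambda>(x, y). ?F (y, x)) = ?F'" by (auto simp: abs_minus_commute)
  have iF': "integrable ?M ?F'" using lborel_pair.integrable_product_swap[OF iF] unfolding sw .
  have vF': "(LINT z|?M. ?F' z) = (LINT z|?M. ?F z)"
    using lborel_pair.integral_product_swap[of ?F] iF unfolding sw by (auto dest: borel_measurable_integrable)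
  note G = resolvent_pairing[OF _ _ signed_root_wu_L2 signed_root_wu_L2]
  have iG: "integrable ?M ?G" by (rule G(1)) measurable
  have vG: "(LINT z|?M. ?G z) = ip ?g (resolvent 1 ?g)" by (rule G(2)) measurable
  note E = exp_kernel_pair_integrable[OF zero_less_one integrable_wu_powr]
  have "(LINT z|?M. 2 * ?G z - ?c / 2 * (?X z + ?Y z)) \<le> (LINT z|?M. ?F z + ?F' z)"
  proof (rule integral_mono)
    show "integrable ?M (\<lambda>z. 2 * ?G z - ?c / 2 * (?X z + ?Y z))"
      by (intro Bochner_Integration.integrable_diff Bochner_Integration.integrable_add integrable_mult_right iG E)
    show "integrable ?M (\<lambda>z. ?F z + ?F' z)"
      by (intro Bochner_Integration.integrable_add iF iF')
    fix z :: "real \<times> real"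
    obtain x y where z: "z = (x, y)" by (cases z)
    have "1 / 2 * exp (- \<bar>x - y\<bar>) * (2 * (?g x * ?g y) - ?c * (\<bar>wu x\<bar> powr (p + 1) + \<bar>wu y\<bar> powr (p + 1)))
        \<le> 1 / 2 * exp (- \<bar>x - y\<bar>) * (wu x * nonlin p (wu y) + wu y * nonlin p (wu x))"
      by (intro mult_left_mono nonlin_cross_bound p) auto
    then show "2 * ?G z - ?c / 2 * (?X z + ?Y z) \<le> ?F z + ?F' z"
      unfolding z by (simp add: algebra_simps)
  qed
  also have "(LINT z|?M. ?F z + ?F' z) = 2 * ip wu (resolvent 1 (\<lambda>x. nonlin p (wu x)))"
    using iF iF' vF vF' by simp
  also have "(LINT z|?M. 2 * ?G z - ?c / 2 * (?X z + ?Y z))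
      = 2 * ip ?g (resolvent 1 ?g) - ?c / 2 * (2 / 1 * mass + 2 / 1 * mass)"
  proof -
    have "(LINT z|?M. 2 * ?G z - ?c / 2 * (?X z + ?Y z)) = (LINT z|?M. 2 * ?G z) - (LINT z|?M. ?c / 2 * (?X z + ?Y z))"
      by (intro Bochner_Integration.integral_diff Bochner_Integration.integrable_add integrable_mult_right iG E)
    also have "(LINT z|?M. 2 * ?G z) = 2 * (LINT z|?M. ?G z)" by (rule integral_mult_right_zero)
    also have "(LINT z|?M. ?c / 2 * (?X z + ?Y z)) = ?c / 2 * (LINT z|?M. ?X z + ?Y z)"
      by (rule integral_mult_right_zero)
    also have "(LINT z|?M. ?X z + ?Y z) = (LINT z|?M. ?X z) + (LINT z|?M. ?Y z)"
      by (intro Bochner_Integration.integral_add E)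
    finally show ?thesis by (simp only: vG E(3,4) mass_eq)
  qed
  also have "?c / 2 * (2 / 1 * mass + 2 / 1 * mass) = 2 * (?c * mass)" by simp
  finally have "ip ?g (resolvent 1 ?g) - ?c * mass \<le> ip wu (resolvent 1 (\<lambda>x. nonlin p (wu x)))"
    by linarith
  moreover have "0 \<le> ip ?g (resolvent 1 ?g)"
    using resolvent_pair_energy[OF resolvent_pair_resolvent[OF zero_less_one signed_root_wu_L2]] by simp
  ultimately show ?thesis by simp
qed

text \<open>
  The error made in symmetrising the weight is controlled by the kernel
  \<open>exp (- \<bar>x - y\<bar>) (exp (\<bar>x - y\<bar> / L) - 1) / 2\<close>, whose integral is \<open>1 / (L - 1)\<close>.
\<close>

lemma pairing_lower_bound:
  "- (((p - 1) / (p + 1))\<^sup>2 + 1 / (L - 1)) * mass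
    \<le> ip (\<lambda>x. exp (- \<bar>x\<bar> / L) * u x) (resolvent 1 (\<lambda>x. nonlin p (u x)))"
proof -
  let ?M = "lborel \<Otimes>\<^sub>M lborel :: (real \<times> real) measure"
  let ?A = "\<lambda>(x, y). 1 / 2 * exp (- \<bar>x - y\<bar>) * ((exp (- \<bar>x\<bar> / L) * u x) * nonlin p (u y))"
  let ?F = "\<lambda>(x, y). 1 / 2 * exp (- \<bar>x - y\<bar>) * (wu x * nonlin p (wu y))"
  let ?Y = "\<lambda>k z. case z of (x, y) \<Rightarrow> 1 / 2 * exp (- k * \<bar>x - y\<bar>) *
      ((\<bar>wu x\<bar> powr (p + 1) + p * \<bar>wu y\<bar> powr (p + 1)) / (p + 1))"
  have L2: "(\<lambda>x. exp (- \<bar>x\<bar> / L) * u x) \<in> L2"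
    by (rule L2_bounded_mult[OF u, where K = 1]) (use decay_le_1(2)[of 1] in \<open>auto intro!: measurable_completion\<close>)
  note A = resolvent_pairing[OF _ _ L2 nonlin_u_L2]
  have iA: "integrable ?M ?A" by (rule A(1)) measurable
  have vA: "(LINT z|?M. ?A z) = ip (\<lambda>x. exp (- \<bar>x\<bar> / L) * u x) (resolvent 1 (\<lambda>x. nonlin p (u x)))"
    by (rule A(2)) measurable
  note F = resolvent_pairing[OF wu_measurable _ wu_L2 nonlin_L2[OF wu_L2 wu_bounded p]]
  have iF: "integrable ?M ?F" by (rule F(1)) measurable
  have vF: "(LINT z|?M. ?F z) = ip wu (resolvent 1 (\<lambda>x. nonlin p (wu x)))" by (rule F(2)) measurable
  note Y1 = young_kernel_integral[OF k1(1)] and Y0 = young_kernel_integral[OF zero_less_one]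
  have "(LINT z|?M. ?F z - (?Y (1 - 1 / L) z - ?Y 1 z)) \<le> (LINT z|?M. ?A z)"
  proof (rule integral_mono[OF _ iA])
    show "integrable ?M (\<lambda>z. ?F z - (?Y (1 - 1 / L) z - ?Y 1 z))"
      by (intro Bochner_Integration.integrable_diff iF Y1 Y0)
    fix z :: "real \<times> real"
    obtain x y where z: "z = (x, y)" by (cases z)
    let ?T = "(\<bar>wu x\<bar> powr (p + 1) + p * \<bar>wu y\<bar> powr (p + 1)) / (p + 1)"
    let ?R = "exp (- (p / (p + 1)) * (\<bar>x\<bar> - \<bar>y\<bar>) / L)"
    let ?w = "wu x * nonlin p (wu y)"
    have "\<bar>(?R - 1) * ?w\<bar> \<le> (exp (\<bar>x - y\<bar> / L) - 1) * ?T"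
      unfolding abs_mult[of "?R - 1"] using p L
      by (intro mult_mono exp_weight_ratio young_nonlin) auto
    then have "?w - (exp (\<bar>x - y\<bar> / L) - 1) * ?T \<le> ?R * ?w"
      by (simp add: left_diff_distrib abs_le_iff)
    then have "1 / 2 * exp (- \<bar>x - y\<bar>) * (?w - (exp (\<bar>x - y\<bar> / L) - 1) * ?T) \<le> 1 / 2 * exp (- \<bar>x - y\<bar>) * (?R * ?w)"
      by (intro mult_left_mono) auto
    moreover have "1 / 2 * exp (- \<bar>x - y\<bar>) * (?w - (exp (\<bar>x - y\<bar> / L) - 1) * ?T)
      = 1 / 2 * exp (- \<bar>x - y\<bar>) * ?w - (1 / 2 * (exp (- \<bar>x - y\<bar>) * exp (\<bar>x - y\<bar> / L)) * ?T - 1 / 2 * exp (- 1 * \<bar>x - y\<bar>) * ?T)"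
    proof -
      have "1 / 2 * e0 * (w - (e1 - 1) * T) = 1 / 2 * e0 * w - (1 / 2 * (e0 * e1) * T - 1 / 2 * e0 * T)"
        for e0 e1 w T :: real by (simp add: algebra_simps)
      then show ?thesis by (simp only: mult_minus1)
    qed
    ultimately have "1 / 2 * exp (- \<bar>x - y\<bar>) * ?w - (1 / 2 * (exp (- \<bar>x - y\<bar>) * exp (\<bar>x - y\<bar> / L)) * ?T - 1 / 2 * exp (- 1 * \<bar>x - y\<bar>) * ?T)
      \<le> 1 / 2 * exp (- \<bar>x - y\<bar>) * (?R * ?w)"
      by (simp only:)
    then show "?F z - (?Y (1 - 1 / L) z - ?Y 1 z) \<le> ?A z"
      unfolding z exp_kernel_shift weight_split prod.case .
  qed
  also have "(LINT z|?M. ?F z - (?Y (1 - 1 / L) z - ?Y 1 z))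
      = ip wu (resolvent 1 (\<lambda>x. nonlin p (wu x))) - (mass / (1 - 1 / L) - mass / 1)"
    using iF Y1 Y0 vF by (simp only: Bochner_Integration.integral_diff Bochner_Integration.integrable_diff)
  also have "mass / (1 - 1 / L) - mass / 1 = mass / (L - 1)"
    using L by (simp add: field_simps)
  finally show ?thesis
    using symmetric_pairing_lower_bound unfolding vA by (simp add: algebra_simps)
qed

end

section \<open>The virial identity\<close>

lemma continuous_abs_powr: "0 < q \<Longrightarrow> continuous_on UNIV (\<lambda>s::real. \<bar>s\<bar> powr q)"
  by (intro continuous_on_powr' continuous_intros) auto

lemma nonlin_DERIV:
  assumes p: "1 < p"
  shows "(nonlin p has_real_derivative p * \<bar>s\<bar> powr (p - 1)) (at s)"
proof -
  consider "0 < s" | "s < 0" | "s = 0" by linarith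
  then show ?thesis
  proof cases
    case 1
    have "((\<lambda>s. s powr p) has_real_derivative p * s powr (p - 1)) (at s)"
      using 1 by (auto intro!: derivative_eq_intros)
    moreover have "\<forall>\<^sub>F y in nhds s. nonlin p y = y powr p"
      using eventually_nhds_in_open[of "{0<..}" s] 1
      by (auto elim!: eventually_mono simp: nonlin_def powr_diff)
    ultimately show ?thesis using 1 by (subst DERIV_cong_ev[OF refl _ refl]) auto
  next
    case 2
    have "((\<lambda>s. - ((- s) powr p)) has_real_derivative p * (- s) powr (p - 1)) (at s)"
      using 2 by (auto intro!: derivative_eq_intros)
    moreover have "\<forall>\<^sub>F y in nhds s. nonlin p y = - ((- y) powr p)"
      using eventually_nhds_in_open[of "{..<0}" s] 2
      by (auto elim!: eventually_mono simp: nonlin_def powr_diff)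
    ultimately show ?thesis using 2 by (subst DERIV_cong_ev[OF refl _ refl]) auto
  next
    case 3
    have "isCont (\<lambda>s::real. \<bar>s\<bar> powr (p - 1)) 0"
      using continuous_abs_powr[of "p - 1"] p by (simp add: continuous_on_eq_continuous_at)
    then have "((\<lambda>y::real. \<bar>y\<bar> powr (p - 1)) \<longlongrightarrow> 0) (at 0)"
      using p by (simp add: isCont_def)
    moreover have "\<forall>\<^sub>F y in at 0. \<bar>y\<bar> powr (p - 1) = (nonlin p y - nonlin p 0) / (y - 0)"
      by (auto simp: eventually_at nonlin_def intro!: exI[of _ 1])
    ultimately have "((\<lambda>y. (nonlin p y - nonlin p 0) / (y - 0)) \<longlongrightarrow> 0) (at 0)"
      by (rule Lim_transform_eventually)
    then show ?thesis using 3 p by (simp add: has_field_derivative_iff)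
  qed
qed

lemma flux_ac_deriv:
  assumes p: "1 < p" and f: "ac_deriv f f'"
  shows "ac_deriv (\<lambda>x. f x + nonlin p (f x)) (\<lambda>x. (1 + p * \<bar>f x\<bar> powr (p - 1)) * f' x)"
proof -
  have "continuous_on UNIV (\<lambda>s::real. p * \<bar>s\<bar> powr (p - 1))"
    using p by (intro continuous_intros continuous_abs_powr) auto
  from ac_deriv_add[OF f ac_deriv_comp[OF f nonlin_DERIV[OF p] this]]
  show ?thesis by (simp add: distrib_right)
qed

lemma ip_DERIV:
  assumes w: "has_time_deriv w w' t" and L2: "\<And>t. w t \<in> L2" "w' \<in> L2" "\<theta> \<in> L2"
  shows "((\<lambda>t. ip (w t) \<theta>) has_real_derivative ip w' \<theta>) (at t)"
  unfolding DERIV_def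
proof (rule LIM_zero_cancel, rule Lim_null_comparison)
  have "((\<lambda>h. L2_norm (\<lambda>x. (w (t + h) x - w t x) / h - w' x) * L2_norm \<theta>) \<longlongrightarrow> 0 * L2_norm \<theta>) (at 0)"
    using w unfolding has_time_deriv_def by (intro tendsto_mult tendsto_const)
  then show "((\<lambda>h. L2_norm (\<lambda>x. (w (t + h) x - w t x) / h - w' x) * L2_norm \<theta>) \<longlongrightarrow> 0) (at 0)" by simp
  show "\<forall>\<^sub>F h in at 0. norm ((ip (w (t + h)) \<theta> - ip (w t) \<theta>) / h - ip w' \<theta>)
      \<le> L2_norm (\<lambda>x. (w (t + h) x - w t x) / h - w' x) * L2_norm \<theta>"
  proof (intro always_eventually allI)
    fix h
    have "(ip (w (t + h)) \<theta> - ip (w t) \<theta>) / h - ip w' \<theta> = ip (\<lambda>x. (w (t + h) x - w t x) / h - w' x) \<theta>"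
      using L2 by (simp add: ip_diff_left ip_divide_left L2_diff L2_divide)
    then show "norm ((ip (w (t + h)) \<theta> - ip (w t) \<theta>) / h - ip w' \<theta>)
      \<le> L2_norm (\<lambda>x. (w (t + h) x - w t x) / h - w' x) * L2_norm \<theta>"
      using L2 by (auto intro!: abs_ip_le_norm L2_diff L2_divide)
  qed
qed

text \<open>
  Differentiability in norm is required of the first factor only. It is not available for \<open>v - v\<^sub>x\<^sub>x\<close>, of which
  continuity in norm and differentiability of pairings with fixed functions are known.
\<close>

lemma ip_product_DERIV:
  assumes a: "has_time_deriv a a' t" "\<And>t. a t \<in> L2" "a' \<in> L2"
    and z: "((\<lambda>s. L2_norm (\<lambda>x. z s x - z t x)) \<longlongrightarrow> 0) (at t)" "\<And>t. z t \<in> L2"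
    and D: "((\<lambda>s. ip (a t) (z s)) has_real_derivative D) (at t)"
  shows "((\<lambda>s. ip (a s) (z s)) has_real_derivative ip a' (z t) + D) (at t)"
proof -
  let ?q = "\<lambda>h x. (a (t + h) x - a t x) / h - a' x"
  let ?d = "\<lambda>h x. z (t + h) x - z t x"
  have q: "((\<lambda>h. L2_norm (?q h)) \<longlongrightarrow> 0) (at 0)" using a(1) by (simp add: has_time_deriv_def)
  have d: "((\<lambda>h. L2_norm (?d h)) \<longlongrightarrow> 0) (at 0)"
    using LIM_offset_zero[OF z(1)] by simp
  have 1: "((\<lambda>h. ip (\<lambda>x. (a (t + h) x - a t x) / h) (z (t + h)) - ip a' (z t)) \<longlongrightarrow> 0) (at 0)"
  proof (rule Lim_null_comparison)
    have "((\<lambda>h. L2_norm (?q h) * (L2_norm (z t) + L2_norm (?d h)) + L2_norm a' * L2_norm (?d h))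
        \<longlongrightarrow> 0 * (L2_norm (z t) + 0) + L2_norm a' * 0) (at 0)"
      by (intro tendsto_intros q d)
    then show "((\<lambda>h. L2_norm (?q h) * (L2_norm (z t) + L2_norm (?d h)) + L2_norm a' * L2_norm (?d h))
        \<longlongrightarrow> 0) (at 0)" by simp
    show "\<forall>\<^sub>F h in at 0. norm (ip (\<lambda>x. (a (t + h) x - a t x) / h) (z (t + h)) - ip a' (z t))
        \<le> L2_norm (?q h) * (L2_norm (z t) + L2_norm (?d h)) + L2_norm a' * L2_norm (?d h)"
    proof (intro always_eventually allI)
      fix h
      have qL: "?q h \<in> L2" and dL: "?d h \<in> L2" using a z by (auto intro!: L2_diff L2_divide)
      have "ip (\<lambda>x. (a (t + h) x - a t x) / h) (z (t + h)) - ip a' (z t) = ip (?q h) (z (t + h)) + ip a' (?d h)"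
        using a z by (simp add: ip_diff_left ip_diff_right L2_diff L2_divide)
      moreover have "\<bar>ip (?q h) (z (t + h))\<bar> \<le> L2_norm (?q h) * (L2_norm (z t) + L2_norm (?d h))"
      proof -
        have "L2_norm (z (t + h)) = L2_norm (\<lambda>x. z t x + ?d h x)" by simp
        also have "\<dots> \<le> L2_norm (z t) + L2_norm (?d h)" by (rule L2_norm_add_le[OF z(2) dL])
        finally have "L2_norm (?q h) * L2_norm (z (t + h)) \<le> L2_norm (?q h) * (L2_norm (z t) + L2_norm (?d h))"
          by (rule mult_left_mono) simp
        then show ?thesis using abs_ip_le_norm[OF qL z(2)[of "t + h"]] by linarith
      qed
      moreover have "\<bar>ip a' (?d h)\<bar> \<le> L2_norm a' * L2_norm (?d h)" by (rule abs_ip_le_norm[OF a(3) dL])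
      ultimately show "norm (ip (\<lambda>x. (a (t + h) x - a t x) / h) (z (t + h)) - ip a' (z t))
        \<le> L2_norm (?q h) * (L2_norm (z t) + L2_norm (?d h)) + L2_norm a' * L2_norm (?d h)"
        unfolding real_norm_def by linarith
    qed
  qed
  have "((\<lambda>h. ip (\<lambda>x. (a (t + h) x - a t x) / h) (z (t + h)) + (ip (a t) (z (t + h)) - ip (a t) (z t)) / h)
      \<longlongrightarrow> ip a' (z t) + D) (at 0)"
    using LIM_zero_cancel[OF 1] D unfolding DERIV_def by (intro tendsto_add)
  moreover have "ip (\<lambda>x. (a (t + h) x - a t x) / h) (z (t + h)) + (ip (a t) (z (t + h)) - ip (a t) (z t)) / h
      = (ip (a (t + h)) (z (t + h)) - ip (a t) (z t)) / h" for h
    using a z by (simp add: ip_diff_left ip_divide_left L2_diff L2_divide add_divide_distrib[symmetric])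
  ultimately show ?thesis unfolding DERIV_def by simp
qed

lemma has_time_deriv_bounded_mult:
  assumes w: "has_time_deriv w w' t" and L2: "\<And>t. w t \<in> L2" "w' \<in> L2"
    and \<phi>: "\<phi> \<in> borel_measurable lebesgue" "\<And>x. \<bar>\<phi> x\<bar> \<le> K"
  shows "has_time_deriv (\<lambda>t x. \<phi> x * w t x) (\<lambda>x. \<phi> x * w' x) t"
  unfolding has_time_deriv_def
proof (rule Lim_null_comparison)
  have "((\<lambda>h. K * L2_norm (\<lambda>x. (w (t + h) x - w t x) / h - w' x)) \<longlongrightarrow> K * 0) (at 0)"
    using w unfolding has_time_deriv_def by (intro tendsto_mult tendsto_const)
  then show "((\<lambda>h. K * L2_norm (\<lambda>x. (w (t + h) x - w t x) / h - w' x)) \<longlongrightarrow> 0) (at 0)" by simp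
  show "\<forall>\<^sub>F h in at 0. norm (L2_norm (\<lambda>x. (\<phi> x * w (t + h) x - \<phi> x * w t x) / h - \<phi> x * w' x))
      \<le> K * L2_norm (\<lambda>x. (w (t + h) x - w t x) / h - w' x)"
  proof (intro always_eventually allI)
    fix h
    have "(\<lambda>x. (\<phi> x * w (t + h) x - \<phi> x * w t x) / h - \<phi> x * w' x)
        = (\<lambda>x. \<phi> x * ((w (t + h) x - w t x) / h - w' x))"
      by (auto simp: algebra_simps diff_divide_distrib)
    then show "norm (L2_norm (\<lambda>x. (\<phi> x * w (t + h) x - \<phi> x * w t x) / h - \<phi> x * w' x))
      \<le> K * L2_norm (\<lambda>x. (w (t + h) x - w t x) / h - w' x)"
      using L2 \<phi> by (simp add: L2_norm_bounded_mult L2_diff L2_divide)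
  qed
qed

lemma ip_mult_deriv_self:
  assumes g: "ac_deriv g g'" "g \<in> L2" "g' \<in> L2" and \<phi>: "ac_deriv \<phi> \<psi>" "\<And>x. \<bar>\<phi> x\<bar> \<le> K" "\<And>x. \<bar>\<psi> x\<bar> \<le> K'"
  shows "ip (\<lambda>x. \<phi> x * g x) g' = - (1 / 2) * ip (\<lambda>x. \<psi> x * g x) g"
proof -
  have m: "\<phi> \<in> borel_measurable lebesgue" "\<psi> \<in> borel_measurable lebesgue"
    using ac_deriv_measurable_fun[OF \<phi>(1)] ac_deriv_measurable[OF \<phi>(1)] by auto
  have L: "(\<lambda>x. \<phi> x * g x) \<in> L2" "(\<lambda>x. \<psi> x * g x) \<in> L2" "(\<lambda>x. \<phi> x * g' x) \<in> L2"
    using g m \<phi> by (auto intro: L2_bounded_mult)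
  have "ip (\<lambda>x. \<psi> x * g x + \<phi> x * g' x) g = - ip (\<lambda>x. \<phi> x * g x) g'"
    using g L by (intro ip_deriv_left ac_deriv_mult \<phi> L2_add)
  moreover have "ip (\<lambda>x. \<phi> x * g' x) g = ip (\<lambda>x. \<phi> x * g x) g'"
    by (simp add: ip_def mult_ac)
  ultimately show ?thesis using g L by (simp add: ip_add_left)
qed

text \<open>
  The solution in terms of absolutely continuous representatives. The nonlinearity enters through the derivative of
  \<open>u + f(u)\<close>, written out by the chain rule; \<open>M\<close> bounds all norms at all times.
\<close>

locale bounded_solution =
  fixes p M :: real and u ux v vx vxx :: "real \<Rightarrow> real \<Rightarrow> real"
  assumes p: "1 < p"
    and ac: "\<And>t. ac_deriv (u t) (ux t)" "\<And>t. ac_deriv (v t) (vx t)" "\<And>t. ac_deriv (vx t) (vxx t)"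
    and L2: "\<And>t. u t \<in> L2" "\<And>t. ux t \<in> L2" "\<And>t. v t \<in> L2" "\<And>t. vx t \<in> L2" "\<And>t. vxx t \<in> L2"
    and M: "\<And>t. L2_norm (u t) \<le> M" "\<And>t. L2_norm (ux t) \<le> M" "\<And>t. L2_norm (v t) \<le> M"
      "\<And>t. L2_norm (vx t) \<le> M" "\<And>t. L2_norm (vxx t) \<le> M"
    and cont: "\<And>t. ((\<lambda>s. L2_norm (\<lambda>x. u s x - u t x)) \<longlongrightarrow> 0) (at t)"
      "\<And>t. ((\<lambda>s. L2_norm (\<lambda>x. v s x - v t x)) \<longlongrightarrow> 0) (at t)"
      "\<And>t. ((\<lambda>s. L2_norm (\<lambda>x. vx s x - vx t x)) \<longlongrightarrow> 0) (at t)"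
      "\<And>t. ((\<lambda>s. L2_norm (\<lambda>x. vxx s x - vxx t x)) \<longlongrightarrow> 0) (at t)"
    and eq_u: "\<And>t. has_time_deriv u (vx t) t"
    and eq_v: "\<And>t. has_time_deriv v (resolvent 1 (\<lambda>x. (1 + p * \<bar>u t x\<bar> powr (p - 1)) * ux t x)) t"
begin

definition B :: real where "B = 2 * M"
definition F :: "real \<Rightarrow> real \<Rightarrow> real" where "F t x = u t x + nonlin p (u t x)"
definition Fx :: "real \<Rightarrow> real \<Rightarrow> real" where "Fx t x = (1 + p * \<bar>u t x\<bar> powr (p - 1)) * ux t x"
definition z :: "real \<Rightarrow> real \<Rightarrow> real" where "z t x = v t x - vxx t x"

lemma M_nonneg: "0 \<le> M"
  using M(1)[of 0] L2_norm_nonneg[of "u 0"] by linarith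

lemma u_bound: "\<bar>u t x\<bar> \<le> B"
proof -
  have "(u t x)\<^sup>2 \<le> (L2_norm (u t))\<^sup>2 + (L2_norm (ux t))\<^sup>2"
    by (rule ac_deriv_square_bound[OF ac(1) L2(1,2)])
  also have "\<dots> \<le> M\<^sup>2 + M\<^sup>2"
    using M(1,2)[of t] by (intro add_mono power_mono) auto
  also have "\<dots> \<le> B\<^sup>2" by (simp add: B_def power_mult_distrib)
  finally have "\<bar>u t x\<bar> \<le> \<bar>B\<bar>" by (simp only: abs_le_square_iff)
  then show ?thesis using M_nonneg by (simp add: B_def)
qed

lemma eq_v': "has_time_deriv v (resolvent 1 (Fx t)) t"
proof -
  have "Fx t = (\<lambda>x. (1 + p * \<bar>u t x\<bar> powr (p - 1)) * ux t x)" by (auto simp: Fx_def)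
  then show ?thesis using eq_v[of t] by simp
qed

lemma slope_bound: "\<bar>1 + p * \<bar>u t x\<bar> powr (p - 1)\<bar> \<le> 1 + p * B powr (p - 1)"
  using p u_bound[of t x] by (auto simp: abs_of_nonneg add_nonneg_nonneg intro!: powr_mono2)

lemma u_measurable: "u t \<in> borel_measurable lebesgue" by (rule L2_measurable[OF L2(1)])

lemma slope_measurable: "(\<lambda>x. 1 + p * \<bar>u t x\<bar> powr (p - 1)) \<in> borel_measurable lebesgue"
  using u_measurable by measurable

lemma Fx_L2: "Fx t \<in> L2"
  unfolding Fx_def[abs_def] by (rule L2_bounded_mult[OF L2(2) slope_measurable slope_bound])

lemma Fx_norm: "L2_norm (Fx t) \<le> (1 + p * B powr (p - 1)) * M"
proof -
  have "L2_norm (Fx t) \<le> (1 + p * B powr (p - 1)) * L2_norm (ux t)"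
    unfolding Fx_def[abs_def] by (rule L2_norm_bounded_mult[OF L2(2) slope_measurable slope_bound])
  also have "\<dots> \<le> (1 + p * B powr (p - 1)) * M"
    using p M(2) by (intro mult_left_mono) auto
  finally show ?thesis .
qed

lemma nonlin_u_L2: "(\<lambda>x. nonlin p (u t x)) \<in> L2"
  by (rule nonlin_L2[OF L2(1) u_bound p])

lemma F_L2: "F t \<in> L2"
  unfolding F_def[abs_def] by (intro L2_add L2 nonlin_u_L2)

lemma F_ac_deriv: "ac_deriv (F t) (Fx t)"
  using flux_ac_deriv[OF p ac(1)] unfolding F_def[abs_def] Fx_def[abs_def] .

lemma z_L2: "z t \<in> L2" unfolding z_def[abs_def] by (intro L2_diff L2)

lemma z_norm: "L2_norm (z t) \<le> 2 * M"
  using L2_norm_diff_le[OF L2(3,5), of t t] M(3,5)[of t] unfolding z_def[abs_def] by linarith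

lemma z_cont: "((\<lambda>s. L2_norm (\<lambda>x. z s x - z t x)) \<longlongrightarrow> 0) (at t)"
proof (rule Lim_null_comparison)
  have "((\<lambda>s. L2_norm (\<lambda>x. v s x - v t x) + L2_norm (\<lambda>x. vxx s x - vxx t x)) \<longlongrightarrow> 0 + 0) (at t)"
    by (intro tendsto_add cont)
  then show "((\<lambda>s. L2_norm (\<lambda>x. v s x - v t x) + L2_norm (\<lambda>x. vxx s x - vxx t x)) \<longlongrightarrow> 0) (at t)" by simp
  show "\<forall>\<^sub>F s in at t. norm (L2_norm (\<lambda>x. z s x - z t x))
      \<le> L2_norm (\<lambda>x. v s x - v t x) + L2_norm (\<lambda>x. vxx s x - vxx t x)"
  proof (intro always_eventually allI)
    fix s
    have "(\<lambda>x. z s x - z t x) = (\<lambda>x. (v s x - v t x) - (vxx s x - vxx t x))" by (auto simp: z_def)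
    then show "norm (L2_norm (\<lambda>x. z s x - z t x))
      \<le> L2_norm (\<lambda>x. v s x - v t x) + L2_norm (\<lambda>x. vxx s x - vxx t x)"
      using L2_norm_diff_le[OF L2_diff[OF L2(3)[of s] L2(3)[of t]] L2_diff[OF L2(5)[of s] L2(5)[of t]]] by simp
  qed
qed

lemma resolvent_L2: "w \<in> L2 \<Longrightarrow> resolvent 1 w \<in> L2"
  by (rule resolvent_pairD(2)[OF resolvent_pair_resolvent[OF zero_less_one]])

text \<open>
  Formally \<open>z = v - v\<^sub>x\<^sub>x\<close> satisfies \<open>z\<^sub>t = F\<^sub>x\<close>, but \<open>v\<close> is differentiable in time only as a curve in \<open>L\<^sup>2\<close>. For \<open>\<eta>\<close>
  in the range of the resolvent the pairing of \<open>z\<close> with \<open>\<eta>\<close> is one of \<open>v\<close> with an \<open>L\<^sup>2\<close> function. A general \<open>\<eta>\<close> is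
  approximated by \<open>(1 - \<partial>\<^sub>x\<^sup>2 / k\<^sup>2)\<inverse> \<eta>\<close>, and the time derivatives converge uniformly because \<open>F\<^sub>x\<close> is bounded in
  \<open>L\<^sup>2\<close>.
\<close>

lemma z_weak_DERIV:
  assumes \<eta>: "ac_deriv \<eta> \<eta>'" "\<eta> \<in> L2" "\<eta>' \<in> L2"
  shows "((\<lambda>t. ip (z t) \<eta>) has_real_derivative ip (Fx t) \<eta>) (at t)"
proof -
  define k where "k n = real (Suc n)" for n
  have k: "0 < k n" for n by (simp add: k_def)
  define f f' where "f n = resolvent (k n) \<eta>" and "f' n = resolvent_deriv (k n) \<eta>" for n
  have rp: "resolvent_pair (k n) \<eta> (f n) (f' n)" for n
    unfolding f_def f'_def by (rule resolvent_pair_resolvent[OF k \<eta>(2)])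
  note r = resolvent_pairD[OF rp]
  \<comment> \<open>\<open>\<theta> n\<close> is \<open>f n\<close> minus its second derivative, so \<open>f n\<close> is in the range of the resolvent with \<open>k = 1\<close>\<close>
  define \<theta> where "\<theta> n x = f n x - (k n)\<^sup>2 * (f n x - \<eta> x)" for n x
  have kL: "(\<lambda>x. (k n)\<^sup>2 * (f n x - \<eta> x)) \<in> L2" for n by (intro L2_cmult L2_diff r \<eta>)
  have \<theta>L: "\<theta> n \<in> L2" for n unfolding \<theta>_def[abs_def] by (intro L2_diff r kL)
  have rp1: "resolvent_pair 1 (\<theta> n) (f n) (f' n)" for n
    using r(2,3,4,5)[of n] \<theta>L[of n] by (simp add: resolvent_pair_def \<theta>_def)
  have zf: "ip (z t) (f n) = ip (v t) (\<theta> n)" for t n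
  proof -
    have "ip (vxx t) (f n) = - ip (vx t) (f' n)"
      by (rule ip_deriv_left[OF ac(3) r(4) L2(4,5) r(2,3)])
    moreover have "ip (vx t) (f' n) = - ip (v t) (\<lambda>x. (k n)\<^sup>2 * (f n x - \<eta> x))"
      by (rule ip_deriv_left[OF ac(2) r(5) L2(3,4) r(3) kL])
    ultimately show ?thesis
      unfolding z_def[abs_def] \<theta>_def[abs_def] by (simp add: ip_diff_left ip_diff_right L2 r kL)
  qed
  have d: "((\<lambda>t. ip (z t) (f n)) has_real_derivative ip (Fx t) (f n)) (at t)" for t n
  proof -
    have "((\<lambda>t. ip (v t) (\<theta> n)) has_real_derivative ip (resolvent 1 (Fx t)) (\<theta> n)) (at t)"
      by (intro ip_DERIV L2 \<theta>L resolvent_L2 Fx_L2 eq_v')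
    moreover have "ip (resolvent 1 (Fx t)) (\<theta> n) = ip (Fx t) (f n)"
      by (rule resolvent_pair_symmetric[OF resolvent_pair_resolvent[OF zero_less_one Fx_L2] rp1 zero_less_one, symmetric])
    ultimately show ?thesis by (simp add: zf)
  qed
  have conv: "L2_norm (\<lambda>x. f n x - \<eta> x) \<le> L2_norm \<eta>' / k n" for n
    by (rule resolvent_pair_converges[OF rp \<eta>(1,3) k])
  have lim0: "(\<lambda>n. C * (L2_norm \<eta>' / k n)) \<longlonglongrightarrow> 0" for C
  proof -
    have "(\<lambda>n. C * L2_norm \<eta>' * inverse (k n)) \<longlonglongrightarrow> C * L2_norm \<eta>' * 0"
      unfolding k_def by (intro tendsto_intros LIMSEQ_inverse_real_of_nat)
    then show ?thesis by (simp add: divide_inverse mult.assoc)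
  qed
  have dist: "\<bar>ip g (f n) - ip g \<eta>\<bar> \<le> L2_norm g * (L2_norm \<eta>' / k n)" if "g \<in> L2" for g n
  proof -
    have "ip g (f n) - ip g \<eta> = ip g (\<lambda>x. f n x - \<eta> x)" by (simp add: ip_diff_right that r \<eta>)
    also have "\<bar>\<dots>\<bar> \<le> L2_norm g * L2_norm (\<lambda>x. f n x - \<eta> x)" by (intro abs_ip_le_norm that L2_diff r \<eta>)
    also have "\<dots> \<le> L2_norm g * (L2_norm \<eta>' / k n)" by (intro mult_left_mono conv) simp
    finally show ?thesis .
  qed
  have lim: "(\<lambda>n. ip g (f n)) \<longlonglongrightarrow> ip g \<eta>" if "g \<in> L2" for g
    by (rule LIM_zero_cancel, rule Lim_null_comparison[OF _ lim0[of "L2_norm g"]])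
      (use dist[OF that] in auto)
  have "\<exists>G. \<forall>t\<in>UNIV. (\<lambda>n. ip (z t) (f n)) \<longlonglongrightarrow> G t \<and> (G has_derivative (\<lambda>h. ip (Fx t) \<eta> * h)) (at t within UNIV)"
  proof (rule has_derivative_sequence[where f' = "\<lambda>n t h. ip (Fx t) (f n) * h"])
    show "((\<lambda>t. ip (z t) (f n)) has_derivative (\<lambda>h. ip (Fx t) (f n) * h)) (at t within UNIV)" for n t
      using d[of n t] by (simp add: has_field_derivative_def)
    show "(\<lambda>n. ip (z 0) (f n)) \<longlonglongrightarrow> ip (z 0) \<eta>" by (rule lim[OF z_L2])
    fix e :: real assume e: "0 < e"
    let ?C = "(1 + p * B powr (p - 1)) * M"
    have "\<forall>\<^sub>F n in sequentially. ?C * (L2_norm \<eta>' / k n) < e"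
      using order_tendstoD(2)[OF lim0 e] .
    then show "\<forall>\<^sub>F n in sequentially. \<forall>t\<in>UNIV. \<forall>h. norm (ip (Fx t) (f n) * h - ip (Fx t) \<eta> * h) \<le> e * norm h"
    proof eventually_elim
      case (elim n)
      show ?case
      proof (intro ballI allI)
        fix t h :: real
        have "\<bar>ip (Fx t) (f n) - ip (Fx t) \<eta>\<bar> \<le> L2_norm (Fx t) * (L2_norm \<eta>' / k n)" by (rule dist[OF Fx_L2])
        also have "\<dots> \<le> ?C * (L2_norm \<eta>' / k n)" using k[of n] by (intro mult_right_mono Fx_norm) auto
        finally have "\<bar>ip (Fx t) (f n) - ip (Fx t) \<eta>\<bar> * \<bar>h\<bar> \<le> e * \<bar>h\<bar>"
          using elim by (intro mult_right_mono) auto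
        then show "norm (ip (Fx t) (f n) * h - ip (Fx t) \<eta> * h) \<le> e * norm h"
          by (simp add: abs_mult[symmetric] left_diff_distrib)
      qed
    qed
  qed auto
  then obtain G where G: "\<And>t. (\<lambda>n. ip (z t) (f n)) \<longlonglongrightarrow> G t" "\<And>t. (G has_derivative (\<lambda>h. ip (Fx t) \<eta> * h)) (at t)"
    by auto
  have "G = (\<lambda>t. ip (z t) \<eta>)"
    using LIMSEQ_unique[OF G(1) lim[OF z_L2]] by auto
  then show ?thesis using G(2)[of t] by (simp add: has_field_derivative_def)
qed

text \<open>
  Formally \<open>v\<^sub>x\<^sub>t = (1 - \<partial>\<^sub>x\<^sup>2)\<inverse> F - F\<close>. With \<open>a = (1 - \<partial>\<^sub>x\<^sup>2)\<inverse> \<zeta>\<close> the pairing of \<open>v\<^sub>x\<close> with \<open>\<zeta>\<close> is that of \<open>z\<close> with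
  \<open>- a'\<close>, which the preceding lemma differentiates.
\<close>

lemma vx_weak_DERIV:
  assumes \<zeta>: "\<zeta> \<in> L2"
  shows "((\<lambda>t. ip \<zeta> (vx t)) has_real_derivative ip \<zeta> (\<lambda>x. resolvent 1 (F t) x - F t x)) (at t)"
proof -
  let ?a = "resolvent 1 \<zeta>" and ?a' = "resolvent_deriv 1 \<zeta>"
  have rp: "resolvent_pair 1 \<zeta> ?a ?a'" by (rule resolvent_pair_resolvent[OF zero_less_one \<zeta>])
  note r = resolvent_pairD[OF rp]
  have a'': "ac_deriv ?a' (\<lambda>x. ?a x - \<zeta> x)" using r(5) by simp
  have dL: "(\<lambda>x. ?a x - \<zeta> x) \<in> L2" by (intro L2_diff r)
  have "ip \<zeta> (vx t) = - ip (z t) ?a'" for t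
  proof -
    have "ip (vx t) ?a = - ip (v t) ?a'" by (rule ip_deriv_left[OF ac(2) r(4) L2(3,4) r(2,3)])
    moreover have "ip (vxx t) ?a' = - ip (vx t) (\<lambda>x. ?a x - \<zeta> x)"
      by (rule ip_deriv_left[OF ac(3) a'' L2(4,5) r(3) dL])
    ultimately show ?thesis
      unfolding z_def[abs_def] by (simp add: ip_diff_left ip_diff_right L2 r ip_commute[of \<zeta>])
  qed
  moreover have "((\<lambda>t. - ip (z t) ?a') has_real_derivative - ip (Fx t) ?a') (at t)"
    by (intro DERIV_minus z_weak_DERIV[OF a'' r(3) dL])
  moreover have "- ip (Fx t) ?a' = ip \<zeta> (\<lambda>x. resolvent 1 (F t) x - F t x)"
  proof -
    have "ip (Fx t) ?a' = - ip (F t) (\<lambda>x. ?a x - \<zeta> x)"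
      by (rule ip_deriv_left[OF F_ac_deriv a'' F_L2 Fx_L2 r(3) dL])
    moreover have "ip (F t) ?a = ip (resolvent 1 (F t)) \<zeta>"
      by (rule resolvent_pair_symmetric[OF resolvent_pair_resolvent[OF zero_less_one F_L2] rp zero_less_one])
    ultimately show ?thesis
      by (simp add: ip_diff_right F_L2 r \<zeta> resolvent_L2 ip_commute)
  qed
  ultimately show ?thesis by simp
qed

text \<open>
  The product \<open>u F\<^sub>x\<close> is the derivative of \<open>u\<^sup>2 / 2 + p / (p + 1) \<bar>u\<bar>\<^sup>p\<^sup>+\<^sup>1\<close>.
\<close>

lemma flux_identity:
  assumes \<phi>: "ac_deriv \<phi> \<psi>" "\<And>x. \<bar>\<phi> x\<bar> \<le> K" "\<And>x. \<bar>\<psi> x\<bar> \<le> K'"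
  shows "ip (\<lambda>x. \<phi> x * u t x) (Fx t)
    = - (1 / 2) * ip (\<lambda>x. \<psi> x * u t x) (u t) - p / (p + 1) * ip (\<lambda>x. \<psi> x * u t x) (\<lambda>x. nonlin p (u t x))"
proof -
  let ?f = "\<lambda>x. nonlin p (u t x)"
  let ?P = "\<lambda>s. s * s / 2 + p / (p + 1) * (s * nonlin p s)"
  have DP: "(?P has_real_derivative s + p * nonlin p s) (at s)" for s
  proof -
    have "(?P has_real_derivative s + p / (p + 1) * (nonlin p s + p * nonlin p s)) (at s)"
      by (rule DERIV_cong[OF DERIV_add[OF DERIV_cdivide[OF DERIV_mult[OF DERIV_ident DERIV_ident]]
            DERIV_cmult[OF DERIV_mult[OF DERIV_ident nonlin_DERIV[OF p]]]]]) (simp add: nonlin_def)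
    moreover have "p / (p + 1) * (nonlin p s + p * nonlin p s) = p * nonlin p s"
      using p by (simp add: field_simps)
    ultimately show ?thesis by simp
  qed
  have cn: "continuous_on UNIV (nonlin p)"
    using nonlin_DERIV[OF p] by (meson DERIV_continuous_on has_field_derivative_at_within)
  have cP: "continuous_on UNIV (\<lambda>s. s + p * nonlin p s)"
    by (intro continuous_intros cn)
  have acP: "ac_deriv (\<lambda>x. ?P (u t x)) (\<lambda>x. (u t x + p * ?f x) * ux t x)"
    by (rule ac_deriv_comp[OF ac(1) DP cP])
  have m: "\<phi> \<in> borel_measurable lebesgue" "\<psi> \<in> borel_measurable lebesgue"
    using ac_deriv_measurable_fun[OF \<phi>(1)] ac_deriv_measurable[OF \<phi>(1)] by auto
  have L: "(\<lambda>x. \<phi> x * u t x) \<in> L2" "(\<lambda>x. \<psi> x * u t x) \<in> L2"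
    by (rule L2_bounded_mult[OF L2(1) m(1) \<phi>(2)], rule L2_bounded_mult[OF L2(1) m(2) \<phi>(3)])
  have e1: "\<phi> x * ?P (u t x) = 1 / 2 * ((\<phi> x * u t x) * u t x) + p / (p + 1) * ((\<phi> x * u t x) * ?f x)" for x
    by (simp add: algebra_simps)
  have e2: "\<psi> x * ?P (u t x) = 1 / 2 * ((\<psi> x * u t x) * u t x) + p / (p + 1) * ((\<psi> x * u t x) * ?f x)" for x
    by (simp add: algebra_simps)
  have e3: "\<phi> x * ((u t x + p * ?f x) * ux t x) = (\<phi> x * u t x) * Fx t x" for x
    by (simp add: Fx_def nonlin_def algebra_simps)
  have i1: "integrable lebesgue (\<lambda>x. \<phi> x * ?P (u t x))"
    unfolding e1 by (intro Bochner_Integration.integrable_add integrable_mult_right L2_integrable_mult L L2 nonlin_u_L2)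
  have i2: "integrable lebesgue (\<lambda>x. \<psi> x * ?P (u t x))"
    unfolding e2 by (intro Bochner_Integration.integrable_add integrable_mult_right L2_integrable_mult L L2 nonlin_u_L2)
  have i3: "integrable lebesgue (\<lambda>x. \<phi> x * ((u t x + p * ?f x) * ux t x))"
    unfolding e3 by (intro L2_integrable_mult L Fx_L2)
  have "(LINT x|lebesgue. \<psi> x * ?P (u t x) + \<phi> x * ((u t x + p * ?f x) * ux t x)) = 0"
    by (rule integral_ac_deriv_eq_0[OF ac_deriv_mult[OF \<phi>(1) acP] i1 Bochner_Integration.integrable_add[OF i2 i3]])
  then have "(LINT x|lebesgue. \<psi> x * ?P (u t x)) + (LINT x|lebesgue. \<phi> x * ((u t x + p * ?f x) * ux t x)) = 0"
    using i2 i3 by simp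
  moreover have "(LINT x|lebesgue. \<phi> x * ((u t x + p * ?f x) * ux t x)) = ip (\<lambda>x. \<phi> x * u t x) (Fx t)"
    unfolding e3 ip_def ..
  moreover have "(LINT x|lebesgue. \<psi> x * ?P (u t x))
      = 1 / 2 * ip (\<lambda>x. \<psi> x * u t x) (u t) + p / (p + 1) * ip (\<lambda>x. \<psi> x * u t x) ?f"
    unfolding e2 ip_def using L L2 nonlin_u_L2
    by (subst Bochner_Integration.integral_add)
      (simp_all only: integral_mult_right_zero L2_integrable_mult integrable_mult_right)
  ultimately show ?thesis by linarith
qed

text \<open>
  The functional is used with \<open>\<phi>' = \<psi>\<close>. Its first term is a localisation of the momentum \<open>\<integral> u (v - v\<^sub>x\<^sub>x)\<close>, which
  the equation conserves.
\<close>

definition momentum :: "(real \<Rightarrow> real) \<Rightarrow> (real \<Rightarrow> real) \<Rightarrow> real \<Rightarrow> real" where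
  "momentum \<phi> \<psi> t = - 2 * ip (\<lambda>x. \<phi> x * u t x) (z t) + ip (\<lambda>x. \<psi> x * u t x) (vx t)"

definition virial :: "(real \<Rightarrow> real) \<Rightarrow> real \<Rightarrow> real" where
  "virial \<psi> t = ip (\<lambda>x. \<psi> x * v t x) (v t) + ip (\<lambda>x. \<psi> x * u t x) (resolvent 1 (u t))
     + ip (\<lambda>x. \<psi> x * u t x) (resolvent 1 (\<lambda>x. nonlin p (u t x)))
     + (p - 1) / (p + 1) * ip (\<lambda>x. \<psi> x * u t x) (\<lambda>x. nonlin p (u t x))"

lemma resolvent_F: "resolvent 1 (F t) = (\<lambda>x. resolvent 1 (u t) x + resolvent 1 (\<lambda>x. nonlin p (u t x)) x)"
  using resolvent_pair_eq(1)[OF resolvent_pair_add[OF resolvent_pair_resolvent[OF zero_less_one L2(1)[of t]]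
      resolvent_pair_resolvent[OF zero_less_one nonlin_u_L2[of t]]] zero_less_one]
  unfolding F_def[abs_def] by simp

text \<open>
  The first term of the momentum contributes \<open>\<integral> \<psi> (v\<^sup>2 - v\<^sub>x\<^sup>2 + u\<^sup>2 + 2 p / (p + 1) \<bar>u\<bar>\<^sup>p\<^sup>+\<^sup>1)\<close>. The second contributes
  \<open>\<integral> \<psi> (v\<^sub>x\<^sup>2 + u A F - u F)\<close>, where \<open>A = (1 - \<partial>\<^sub>x\<^sup>2)\<inverse>\<close>; in the sum \<open>v\<^sub>x\<^sup>2\<close> and \<open>u\<^sup>2\<close> cancel.
\<close>

theorem virial_identity:
  assumes \<phi>: "ac_deriv \<phi> \<psi>" "\<And>x. \<bar>\<phi> x\<bar> \<le> K" "\<And>x. \<bar>\<psi> x\<bar> \<le> K'"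
  shows "(momentum \<phi> \<psi> has_real_derivative virial \<psi> t) (at t)"
proof -
  have m: "\<phi> \<in> borel_measurable lebesgue" "\<psi> \<in> borel_measurable lebesgue"
    using ac_deriv_measurable_fun[OF \<phi>(1)] ac_deriv_measurable[OF \<phi>(1)] by auto
  have \<phi>L: "(\<lambda>x. \<phi> x * g x) \<in> L2" and \<psi>L: "(\<lambda>x. \<psi> x * g x) \<in> L2" if "g \<in> L2" for g
    using that m \<phi> by (auto intro: L2_bounded_mult)
  have d1: "((\<lambda>s. ip (\<lambda>x. \<phi> x * u s x) (z s)) has_real_derivative
      ip (\<lambda>x. \<phi> x * vx t x) (z t) + ip (\<lambda>x. \<phi> x * u t x) (Fx t)) (at t)"
  proof (rule ip_product_DERIV[OF has_time_deriv_bounded_mult[OF eq_u L2(1,4) m(1) \<phi>(2)] \<phi>L[OF L2(1)] \<phi>L[OF L2(4)] z_cont z_L2])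
    have "((\<lambda>s. ip (z s) (\<lambda>x. \<phi> x * u t x)) has_real_derivative ip (Fx t) (\<lambda>x. \<phi> x * u t x)) (at t)"
      by (rule z_weak_DERIV[OF ac_deriv_mult[OF \<phi>(1) ac(1)]]) (intro \<phi>L \<psi>L L2 L2_add)+
    then show "((\<lambda>s. ip (\<lambda>x. \<phi> x * u t x) (z s)) has_real_derivative ip (\<lambda>x. \<phi> x * u t x) (Fx t)) (at t)"
      by (simp add: ip_commute)
  qed
  have d2: "((\<lambda>s. ip (\<lambda>x. \<psi> x * u s x) (vx s)) has_real_derivative
      ip (\<lambda>x. \<psi> x * vx t x) (vx t) + ip (\<lambda>x. \<psi> x * u t x) (\<lambda>x. resolvent 1 (F t) x - F t x)) (at t)"
    by (rule ip_product_DERIV[OF has_time_deriv_bounded_mult[OF eq_u L2(1,4) m(2) \<phi>(3)] \<psi>L[OF L2(1)] \<psi>L[OF L2(4)] cont(3) L2(4)])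
      (rule vx_weak_DERIV[OF \<psi>L[OF L2(1)]])
  let ?f = "\<lambda>x. nonlin p (u t x)" and ?\<zeta> = "\<lambda>x. \<psi> x * u t x"
  have 1: "ip (\<lambda>x. \<phi> x * vx t x) (z t) = - (1 / 2) * ip (\<lambda>x. \<psi> x * v t x) (v t) + 1 / 2 * ip (\<lambda>x. \<psi> x * vx t x) (vx t)"
  proof -
    have "ip (\<lambda>x. \<phi> x * vx t x) (v t) = ip (\<lambda>x. \<phi> x * v t x) (vx t)" by (simp add: ip_def mult_ac)
    then show ?thesis
      using ip_mult_deriv_self[OF ac(2) L2(3,4) \<phi>, of t] ip_mult_deriv_self[OF ac(3) L2(4,5) \<phi>, of t]
      unfolding z_def[abs_def] by (simp add: ip_diff_right \<phi>L L2)
  qed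
  have 2: "ip ?\<zeta> (\<lambda>x. resolvent 1 (F t) x - F t x)
      = ip ?\<zeta> (resolvent 1 (u t)) + ip ?\<zeta> (resolvent 1 ?f) - ip ?\<zeta> (u t) - ip ?\<zeta> ?f"
    unfolding resolvent_F unfolding F_def[abs_def]
    by (simp add: ip_diff_right ip_add_right \<psi>L L2 resolvent_L2 nonlin_u_L2 L2_add)
  have c: "(p - 1) / (p + 1) = 2 * (p / (p + 1)) - 1" using p by (simp add: field_simps)
  have "- 2 * (ip (\<lambda>x. \<phi> x * vx t x) (z t) + ip (\<lambda>x. \<phi> x * u t x) (Fx t))
      + (ip (\<lambda>x. \<psi> x * vx t x) (vx t) + ip ?\<zeta> (\<lambda>x. resolvent 1 (F t) x - F t x)) = virial \<psi> t"
    unfolding 1 2 flux_identity[OF \<phi>] virial_def c by (simp add: algebra_simps)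
  with DERIV_add[OF DERIV_cmult[OF d1, of "- 2"] d2] show ?thesis
    unfolding momentum_def[abs_def] by simp
qed

lemma momentum_bound:
  assumes \<phi>: "ac_deriv \<phi> \<psi>" "\<And>x. \<bar>\<phi> x\<bar> \<le> K" "\<And>x. \<bar>\<psi> x\<bar> \<le> K'"
  shows "\<bar>momentum \<phi> \<psi> t\<bar> \<le> (4 * K + K') * M\<^sup>2"
proof -
  have m: "\<phi> \<in> borel_measurable lebesgue" "\<psi> \<in> borel_measurable lebesgue"
    using ac_deriv_measurable_fun[OF \<phi>(1)] ac_deriv_measurable[OF \<phi>(1)] by auto
  have K: "0 \<le> K" "0 \<le> K'" using \<phi>(2)[of 0] \<phi>(3)[of 0] by auto
  have "\<bar>ip (\<lambda>x. \<phi> x * u t x) (z t)\<bar> \<le> L2_norm (\<lambda>x. \<phi> x * u t x) * L2_norm (z t)"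
    by (intro abs_ip_le_norm z_L2 L2_bounded_mult[OF L2(1) m(1) \<phi>(2)])
  also have "\<dots> \<le> (K * L2_norm (u t)) * L2_norm (z t)"
    by (intro mult_right_mono L2_norm_bounded_mult[OF L2(1) m(1) \<phi>(2)]) simp
  also have "\<dots> \<le> (K * M) * (2 * M)"
    using K M(1) z_norm M_nonneg by (intro mult_mono) auto
  finally have 1: "\<bar>ip (\<lambda>x. \<phi> x * u t x) (z t)\<bar> \<le> (K * M) * (2 * M)" .
  have "\<bar>ip (\<lambda>x. \<psi> x * u t x) (vx t)\<bar> \<le> L2_norm (\<lambda>x. \<psi> x * u t x) * L2_norm (vx t)"
    by (intro abs_ip_le_norm L2 L2_bounded_mult[OF L2(1) m(2) \<phi>(3)])
  also have "\<dots> \<le> (K' * L2_norm (u t)) * L2_norm (vx t)"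
    by (intro mult_right_mono L2_norm_bounded_mult[OF L2(1) m(2) \<phi>(3)]) simp
  also have "\<dots> \<le> (K' * M) * M"
    using K M(1,4) M_nonneg by (intro mult_mono) auto
  finally have 2: "\<bar>ip (\<lambda>x. \<psi> x * u t x) (vx t)\<bar> \<le> (K' * M) * M" .
  have "\<bar>momentum \<phi> \<psi> t\<bar> \<le> 2 * \<bar>ip (\<lambda>x. \<phi> x * u t x) (z t)\<bar> + \<bar>ip (\<lambda>x. \<psi> x * u t x) (vx t)\<bar>"
    unfolding momentum_def by linarith
  also have "\<dots> \<le> 2 * ((K * M) * (2 * M)) + (K' * M) * M"
    using 1 2 by linarith
  also have "\<dots> = (4 * K + K') * M\<^sup>2" by (simp add: power2_eq_square algebra_simps)
  finally show ?thesis .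
qed

end

section \<open>Weights\<close>

lemma ac_deriv_piecewise:
  assumes S: "finite S" and f: "continuous_on UNIV f" and d: "\<And>x. x \<notin> S \<Longrightarrow> (f has_real_derivative g x) (at x)"
    and g: "g \<in> borel_measurable lebesgue" "\<And>x. \<bar>g x\<bar> \<le> K"
  shows "ac_deriv f g"
proof (rule ac_derivI)
  fix a b :: real assume ab: "a \<le> b"
  have "set_integrable lebesgue {a..b} (\<lambda>x. g x * 1)"
    by (rule set_integrable_bounded_mult[OF _ g]) (auto intro!: absolutely_integrable_continuous_real)
  then show "set_integrable lebesgue {a..b} g" by simp
  have "(g has_integral f b - f a) {a..b}"
    using d by (intro fundamental_theorem_of_calculus_strong[OF S ab] continuous_on_subset[OF f])
      (auto simp: has_real_derivative_iff_has_vector_derivative)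
  then show "f b - f a = integral {a..b} g" by (simp add: integral_unique)
qed

text \<open>
  The two weights used are \<open>decay L\<close> and the indicator of \<open>[- L, L]\<close>. Their odd primitives are \<open>decay_primitive L\<close>
  and \<open>clamp_id L\<close>; both weights have mass \<open>2 L\<close>, so these have the same limits at infinity.
\<close>

definition decay :: "real \<Rightarrow> real \<Rightarrow> real" where "decay L x = exp (- \<bar>x\<bar> / L)"

definition decay_primitive :: "real \<Rightarrow> real \<Rightarrow> real" where
  "decay_primitive L x = sgn x * (L * (1 - decay L x))"

definition clamp_id :: "real \<Rightarrow> real \<Rightarrow> real" where "clamp_id L x = max (- L) (min L x)"

lemma decay_continuous: "continuous_on UNIV (decay L)"
  unfolding decay_def[abs_def] by (cases "L = 0") (auto intro!: continuous_intros)

lemma decay_measurable [measurable]: "decay L \<in> borel_measurable borel"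
  by (rule borel_measurable_continuous_onI[OF decay_continuous])

lemma decay_pos: "0 < decay L x" by (simp add: decay_def)

lemma decay_le_1: "0 < L \<Longrightarrow> decay L x \<le> 1" "0 < L \<Longrightarrow> \<bar>decay L x\<bar> \<le> 1"
  by (auto simp: decay_def divide_nonpos_pos)

lemma decay_ac_deriv:
  assumes L: "0 < L"
  shows "ac_deriv (decay L) (\<lambda>x. - (sgn x / L) * decay L x)"
proof (rule ac_deriv_piecewise[of "{0}" _ _ "1 / L"])
  show "continuous_on UNIV (decay L)" by (rule decay_continuous)
  show "(\<lambda>x. - (sgn x / L) * decay L x) \<in> borel_measurable lebesgue" by (intro measurable_completion) measurable
  show "\<bar>- (sgn x / L) * decay L x\<bar> \<le> 1 / L" for x
    using decay_le_1[OF L, of x] decay_pos[of L x] L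
    by (auto simp: abs_mult abs_divide sgn_if divide_le_cancel)
  show "(decay L has_real_derivative - (sgn x / L) * decay L x) (at x)" if x: "x \<notin> {0}" for x
  proof -
    consider "0 < x" | "x < 0" using x by fastforce
    then show ?thesis
    proof cases
      case 1
      have "((\<lambda>x. exp (- x / L)) has_real_derivative - (sgn x / L) * decay L x) (at x)"
        using 1 L by (auto intro!: derivative_eq_intros simp: decay_def)
      then show ?thesis
        by (rule has_field_derivative_transform_within_open[of _ _ _ "{0<..}"]) (use 1 in \<open>auto simp: decay_def\<close>)
    next
      case 2
      have "((\<lambda>x. exp (x / L)) has_real_derivative - (sgn x / L) * decay L x) (at x)"
        using 2 L by (auto intro!: derivative_eq_intros simp: decay_def)
      moreover have "\<forall>\<^sub>F y in nhds x. decay L y = exp (y / L)"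
        using eventually_nhds_in_open[of "{..<0}" x] 2
        by (auto elim!: eventually_mono simp: decay_def)
      ultimately show ?thesis by (subst DERIV_cong_ev[OF refl _ refl]) auto
    qed
  qed
qed simp

lemma decay_primitive_ac_deriv:
  assumes L: "0 < L"
  shows "ac_deriv (decay_primitive L) (decay L)"
proof -
  have eq: "decay_primitive L x = L * (exp (- max (- x) 0 / L) - exp (- max x 0 / L))" for x
    by (cases "x > 0"; cases "x < 0") (auto simp: decay_primitive_def decay_def max_def algebra_simps)
  have cont: "continuous_on UNIV (decay_primitive L)"
    unfolding eq[abs_def] using L by (auto intro!: continuous_intros)
  show ?thesis
  proof (rule ac_deriv_piecewise[of "{0}" _ _ 1, OF _ cont])
    show "decay L \<in> borel_measurable lebesgue" by (intro measurable_completion) measurable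
    show "\<bar>decay L x\<bar> \<le> 1" for x by (rule decay_le_1(2)[OF L])
    show "(decay_primitive L has_real_derivative decay L x) (at x)" if x: "x \<notin> {0}" for x
    proof -
      consider "0 < x" | "x < 0" using x by fastforce
      then show ?thesis
      proof cases
        case 1
        have "((\<lambda>x. L * (1 - exp (- x / L))) has_real_derivative decay L x) (at x)"
          using 1 L by (auto intro!: derivative_eq_intros simp: decay_def)
        then show ?thesis
          by (rule has_field_derivative_transform_within_open[of _ _ _ "{0<..}"])
            (use 1 in \<open>auto simp: decay_def decay_primitive_def\<close>)
      next
        case 2
        have "((\<lambda>x. L * (exp (x / L) - 1)) has_real_derivative decay L x) (at x)"
          using 2 L by (auto intro!: derivative_eq_intros simp: decay_def)
        moreover have "\<forall>\<^sub>F y in nhds x. decay_primitive L y = L * (exp (y / L) - 1)"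
          using eventually_nhds_in_open[of "{..<0}" x] 2
          by (auto elim!: eventually_mono simp: decay_def decay_primitive_def algebra_simps)
        ultimately show ?thesis by (subst DERIV_cong_ev[OF refl _ refl]) auto
      qed
    qed
  qed simp
qed

lemma decay_primitive_bound: "0 < L \<Longrightarrow> \<bar>decay_primitive L x\<bar> \<le> L"
proof -
  assume L: "0 < L"
  have "\<bar>L * (1 - decay L x)\<bar> \<le> L"
    using L decay_le_1(1)[OF L, of x] decay_pos[of L x] by (simp add: abs_mult)
  then show ?thesis by (auto simp: decay_primitive_def sgn_if)
qed

lemma clamp_id_ac_deriv:
  assumes L: "0 < L"
  shows "ac_deriv (clamp_id L) (indicator {-L..L})"
proof (rule ac_deriv_piecewise[of "{-L, L}" _ _ 1])
  show "continuous_on UNIV (clamp_id L)"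
    unfolding clamp_id_def[abs_def] by (intro continuous_intros)
  show "(clamp_id L has_real_derivative indicator {-L..L} x) (at x)" if x: "x \<notin> {-L, L}" for x
  proof -
    consider "x < -L" | "-L < x" "x < L" | "L < x" using x by fastforce
    then show ?thesis
    proof cases
      case 1
      have "((\<lambda>x. - L) has_real_derivative indicator {-L..L} x) (at x)"
        using 1 by simp
      moreover have "\<forall>\<^sub>F y in nhds x. clamp_id L y = - L"
        using eventually_nhds_in_open[of "{..<-L}" x] 1 L
        by (auto elim!: eventually_mono simp: clamp_id_def)
      ultimately show ?thesis by (subst DERIV_cong_ev[OF refl _ refl]) auto
    next
      case 2
      have "((\<lambda>x. x) has_real_derivative indicator {-L..L} x) (at x)"
        using 2 by simp
      moreover have "\<forall>\<^sub>F y in nhds x. clamp_id L y = y"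
        using eventually_nhds_in_open[of "{-L<..<L}" x] 2
        by (auto elim!: eventually_mono simp: clamp_id_def)
      ultimately show ?thesis by (subst DERIV_cong_ev[OF refl _ refl]) auto
    next
      case 3
      have "((\<lambda>x. L) has_real_derivative indicator {-L..L} x) (at x)"
        using 3 by simp
      moreover have "\<forall>\<^sub>F y in nhds x. clamp_id L y = L"
        using eventually_nhds_in_open[of "{L<..}" x] 3 L
        by (auto elim!: eventually_mono simp: clamp_id_def)
      ultimately show ?thesis by (subst DERIV_cong_ev[OF refl _ refl]) auto
    qed
  qed
  show "(indicator {-L..L} :: real \<Rightarrow> real) \<in> borel_measurable lebesgue"
    by (intro borel_measurable_indicator) simp
qed (auto simp: indicator_def)

lemma clamp_id_bound: "0 < L \<Longrightarrow> \<bar>clamp_id L x\<bar> \<le> L"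
  by (auto simp: clamp_id_def)

lemma indicator_le_decay:
  assumes L: "0 < L"
  shows "indicator {-L..L} x \<le> 3 * decay L x"
proof (cases "x \<in> {-L..L}")
  case True
  \<comment> \<open>the constant \<open>3\<close> is an upper bound for \<open>exp 1\<close>\<close>
  then have "exp (- 1) \<le> decay L x" using L by (auto simp: decay_def divide_le_eq)
  moreover have "1 \<le> 3 * exp (- 1 :: real)" using exp_le by (simp add: exp_minus field_simps)
  ultimately show ?thesis using True by (simp only: indicator_simps)
qed (use decay_pos[of L x] in simp)

lemma clamp_decay_primitive_diff:
  assumes L: "0 < L"
  shows "\<bar>clamp_id L x - decay_primitive L x\<bar> \<le> \<bar>3 * L * decay L x\<bar>"
proof (cases "\<bar>x\<bar> \<le> L")
  case True
  have "\<bar>clamp_id L x - decay_primitive L x\<bar> \<le> L"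
  proof -
    define q where "q = L * (1 - decay L x)"
    have q: "0 \<le> q" "q \<le> L"
      using L decay_le_1(1)[OF L, of x] decay_pos[of L x] by (auto simp: q_def)
    have "clamp_id L x = x" "decay_primitive L x = sgn x * q"
      using True by (auto simp: clamp_id_def decay_primitive_def q_def)
    then show ?thesis using q True by (cases x "0 :: real" rule: linorder_cases) auto
  qed
  also have "L \<le> L * (3 * decay L x)"
    using indicator_le_decay[OF L, of x] True L by (simp add: abs_le_iff)
  finally show ?thesis using L decay_pos[of L x] by (simp add: abs_mult)
next
  case False
  then have "clamp_id L x - decay_primitive L x = sgn x * (L * decay L x)"
    using L by (auto simp: clamp_id_def decay_primitive_def sgn_if algebra_simps abs_if split: if_splits)
  then have "\<bar>clamp_id L x - decay_primitive L x\<bar> \<le> L * decay L x"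
    using L decay_pos[of L x] by (auto simp: abs_mult sgn_if)
  also have "\<dots> \<le> 3 * L * decay L x" using L decay_pos[of L x] by simp
  finally show ?thesis using L decay_pos[of L x] by (simp add: abs_mult)
qed

section \<open>Convergence at infinity\<close>

lemma mono_bounded_tendsto:
  fixes X :: "real \<Rightarrow> real"
  assumes mono: "\<And>s t. s \<le> t \<Longrightarrow> X s \<le> X t" and C: "\<And>t. X t \<le> C"
  shows "\<exists>l. (X \<longlongrightarrow> l) at_top"
proof -
  have bdd: "bdd_above (range X)" by (rule bdd_aboveI[of _ C]) (use C in auto)
  have "(X \<longlongrightarrow> (SUP t. X t)) at_top"
  proof (rule order_tendstoI)
    fix a assume "a < (SUP t. X t)"
    then obtain t0 where "a < X t0" using less_cSUP_iff[OF _ bdd] by auto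
    then show "\<forall>\<^sub>F t in at_top. a < X t"
      using mono unfolding eventually_at_top_linorder by (meson order_less_le_trans)
  next
    fix a assume "(SUP t. X t) < a"
    then show "\<forall>\<^sub>F t in at_top. X t < a"
      by (intro always_eventually allI order_le_less_trans[OF cSUP_upper[OF UNIV_I bdd]])
  qed
  then show ?thesis by blast
qed

text \<open>
  If \<open>g t \<ge> e\<close>, then \<open>g \<ge> e / 2\<close> on an interval of fixed length to the right of \<open>t\<close>, because \<open>g\<close> is Lipschitz.
  There \<open>X'\<close> is bounded below, so \<open>X\<close> grows by a fixed amount. This happens for no large \<open>t\<close>, as \<open>X\<close> converges.
\<close>

lemma barbalat:
  fixes g X :: "real \<Rightarrow> real"
  assumes X: "\<And>t. (X has_real_derivative X' t) (at t)" "(X \<longlongrightarrow> l) at_top"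
    and g: "\<And>t. (g has_real_derivative g' t) (at t)" "\<And>t. \<bar>g' t\<bar> \<le> K" "\<And>t. 0 \<le> g t"
    and le: "\<And>t. g t \<le> C * X' t" and C: "0 < C"
  shows "(g \<longlongrightarrow> 0) at_top"
proof (rule order_tendstoI)
  fix a :: real assume "a < 0"
  then show "\<forall>\<^sub>F t in at_top. a < g t" by (intro always_eventually allI less_le_trans[OF _ g(3)])
next
  fix e :: real assume e: "0 < e"
  have K: "0 \<le> K" using g(2)[of 0] by linarith
  define d where "d = e / (2 * (K + 1))"
  have d: "0 < d" using e K by (simp add: d_def)
  have dK: "K * d \<le> e / 2" using e K by (simp add: d_def field_simps)
  have "((\<lambda>t. X (t + d) - X t) \<longlongrightarrow> l - l) at_top"
    by (intro tendsto_diff X(2) filterlim_compose[OF X(2)] filterlim_tendsto_add_at_top[of "\<lambda>_. d" d, simplified add.commute[of d]])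
      (auto simp: filterlim_ident)
  moreover have "l - l < d * (e / (2 * C))" using d e C by simp
  ultimately have "\<forall>\<^sub>F t in at_top. X (t + d) - X t < d * (e / (2 * C))"
    by (rule order_tendstoD(2))
  then show "\<forall>\<^sub>F t in at_top. g t < e"
  proof eventually_elim
    case (elim t)
    show ?case
    proof (rule ccontr)
      assume "\<not> g t < e"
      then have gt: "e \<le> g t" by simp
      have X'ge: "e / (2 * C) \<le> X' s" if s: "t < s" "s < t + d" for s
      proof -
        obtain r where r: "g s - g t = (s - t) * g' r"
          using MVT2[OF s(1), of g g'] g(1) by blast
        have "\<bar>g s - g t\<bar> \<le> d * K"
          unfolding r abs_mult using s g(2)[of r] K by (intro mult_mono) auto
        then have "e / 2 \<le> g s" using gt dK by (simp add: abs_le_iff mult.commute)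
        also have "g s \<le> C * X' s" by (rule le)
        finally show ?thesis using C by (simp add: field_simps)
      qed
      obtain r where r: "t < r" "r < t + d" "X (t + d) - X t = (t + d - t) * X' r"
        using MVT2[of t "t + d" X X'] X(1) d by auto
      have "d * (e / (2 * C)) \<le> d * X' r" using X'ge[OF r(1,2)] d by (intro mult_left_mono) auto
      then show False using elim r(3) by simp
    qed
  qed
qed

text \<open>
  For the gauge integral on a half-line, convergence of the integrals over bounded intervals is sufficient, even if
  it is only conditional.
\<close>

lemma has_integral_improper:
  fixes f :: "real \<Rightarrow> real"
  assumes f: "\<And>T. a \<le> T \<Longrightarrow> (f has_integral X T) {a..T}" and X: "(X \<longlongrightarrow> l) at_top"
  shows "(f has_integral l) {a..}"
  unfolding has_integral_alt'
proof (intro conjI allI impI)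
  have restr: "((\<lambda>x. if x \<in> {a..} then f x else 0) has_integral (if max c a \<le> d then integral {max c a..d} f else 0)) {c..d}" for c d
  proof -
    have i: "f integrable_on {max c a..d}"
    proof (cases "a \<le> d")
      case True
      then show ?thesis using f[OF True] by (auto intro: integrable_on_subinterval has_integral_integrable)
    qed auto
    have "(f has_integral integral {max c a..d} f) {max c a..d}" using i by (rule integrable_integral)
    then have "((\<lambda>x. if x \<in> {max c a..d} then f x else 0) has_integral integral {max c a..d} f) {c..d}"
      by (subst has_integral_restrict) auto
    then have "((\<lambda>x. if x \<in> {a..} then f x else 0) has_integral integral {max c a..d} f) {c..d}"
      by (rule has_integral_eq[rotated]) auto
    then show ?thesis by auto
  qed
  show "(\<lambda>x. if x \<in> {a..} then f x else 0) integrable_on cbox c d" for c d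
    using restr[of c d] by (auto simp: integrable_on_def)
  fix e :: real assume "0 < e"
  then have "\<forall>\<^sub>F T in at_top. dist (X T) l < e" using X by (rule tendstoD[rotated])
  then obtain T0 where T0: "\<And>T. T0 \<le> T \<Longrightarrow> \<bar>X T - l\<bar> < e"
    by (auto simp: eventually_at_top_linorder dist_real_def)
  define R where "R = \<bar>T0\<bar> + \<bar>a\<bar> + 1"
  show "\<exists>B>0. \<forall>c d. ball 0 B \<subseteq> cbox c d \<longrightarrow> norm (integral (cbox c d) (\<lambda>x. if x \<in> {a..} then f x else 0) - l) < e"
  proof (intro exI[of _ R] conjI allI impI)
    show "0 < R" by (simp add: R_def)
    fix c d :: real assume sub: "ball 0 R \<subseteq> cbox c d"
    have "R - 1 / 2 \<in> ball 0 R" "- (R - 1 / 2) \<in> ball 0 R" by (auto simp: R_def dist_real_def)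
    then have cd: "c \<le> - (R - 1 / 2)" "R - 1 / 2 \<le> d" using sub by auto
    then have "max c a = a" "a \<le> d" "T0 \<le> d" by (auto simp: R_def)
    then have "integral (cbox c d) (\<lambda>x. if x \<in> {a..} then f x else 0) = X d"
      using integral_unique[OF restr[of c d]] integral_unique[OF f[of d]] by simp
    then show "norm (integral (cbox c d) (\<lambda>x. if x \<in> {a..} then f x else 0) - l) < e"
      using T0[OF \<open>T0 \<le> d\<close>] by simp
  qed
qed

lemma ip_isCont:
  assumes a: "((\<lambda>s. L2_norm (\<lambda>x. a s x - a t x)) \<longlongrightarrow> 0) (at t)" "\<And>t. a t \<in> L2"
    and b: "((\<lambda>s. L2_norm (\<lambda>x. b s x - b t x)) \<longlongrightarrow> 0) (at t)" "\<And>t. b t \<in> L2"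
  shows "isCont (\<lambda>t. ip (a t) (b t)) t"
  unfolding isCont_def
proof (rule LIM_zero_cancel, rule Lim_null_comparison)
  let ?a = "\<lambda>s. L2_norm (\<lambda>x. a s x - a t x)" and ?b = "\<lambda>s. L2_norm (\<lambda>x. b s x - b t x)"
  have "((\<lambda>s. ?a s * (L2_norm (b t) + ?b s) + L2_norm (a t) * ?b s) \<longlongrightarrow> 0 * (L2_norm (b t) + 0) + L2_norm (a t) * 0) (at t)"
    by (intro tendsto_intros a b)
  then show "((\<lambda>s. ?a s * (L2_norm (b t) + ?b s) + L2_norm (a t) * ?b s) \<longlongrightarrow> 0) (at t)" by simp
  show "\<forall>\<^sub>F s in at t. norm (ip (a s) (b s) - ip (a t) (b t)) \<le> ?a s * (L2_norm (b t) + ?b s) + L2_norm (a t) * ?b s"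
  proof (intro always_eventually allI)
    fix s
    have da: "(\<lambda>x. a s x - a t x) \<in> L2" and db: "(\<lambda>x. b s x - b t x) \<in> L2" using a b by (auto intro: L2_diff)
    have "ip (a s) (b s) - ip (a t) (b t) = ip (\<lambda>x. a s x - a t x) (b s) + ip (a t) (\<lambda>x. b s x - b t x)"
      using a b by (simp add: ip_diff_left ip_diff_right)
    moreover have "\<bar>ip (\<lambda>x. a s x - a t x) (b s)\<bar> \<le> ?a s * (L2_norm (b t) + ?b s)"
    proof -
      have "L2_norm (b s) = L2_norm (\<lambda>x. b t x + (b s x - b t x))" by simp
      also have "\<dots> \<le> L2_norm (b t) + ?b s" by (rule L2_norm_add_le[OF b(2) db])
      finally have "?a s * L2_norm (b s) \<le> ?a s * (L2_norm (b t) + ?b s)" by (rule mult_left_mono) simp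
      then show ?thesis using abs_ip_le_norm[OF da b(2)[of s]] by linarith
    qed
    moreover have "\<bar>ip (a t) (\<lambda>x. b s x - b t x)\<bar> \<le> L2_norm (a t) * ?b s" by (rule abs_ip_le_norm[OF a(2) db])
    ultimately show "norm (ip (a s) (b s) - ip (a t) (b t)) \<le> ?a s * (L2_norm (b t) + ?b s) + L2_norm (a t) * ?b s"
      unfolding real_norm_def by linarith
  qed
qed

lemma L2_cont_bounded_mult:
  assumes a: "((\<lambda>s. L2_norm (\<lambda>x. a s x - a t x)) \<longlongrightarrow> 0) (at t)" "\<And>t. a t \<in> L2"
    and w: "w \<in> borel_measurable lebesgue" "\<And>x. \<bar>w x\<bar> \<le> K"
  shows "((\<lambda>s. L2_norm (\<lambda>x. w x * a s x - w x * a t x)) \<longlongrightarrow> 0) (at t)"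
proof (rule Lim_null_comparison)
  have "((\<lambda>s. K * L2_norm (\<lambda>x. a s x - a t x)) \<longlongrightarrow> K * 0) (at t)" by (intro tendsto_intros a)
  then show "((\<lambda>s. K * L2_norm (\<lambda>x. a s x - a t x)) \<longlongrightarrow> 0) (at t)" by simp
  have "L2_norm (\<lambda>x. w x * a s x - w x * a t x) \<le> K * L2_norm (\<lambda>x. a s x - a t x)" for s
    using L2_norm_bounded_mult[OF L2_diff[OF a(2)[of s] a(2)[of t]] w] by (simp add: right_diff_distrib)
  then show "\<forall>\<^sub>F s in at t. norm (L2_norm (\<lambda>x. w x * a s x - w x * a t x)) \<le> K * L2_norm (\<lambda>x. a s x - a t x)"
    by simp
qed

lemma resolvent_diff:
  assumes "w \<in> L2" "w' \<in> L2"
  shows "(\<lambda>x. resolvent 1 w x - resolvent 1 w' x) = resolvent 1 (\<lambda>x. w x - w' x)"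
  using resolvent_pair_eq(1)[OF resolvent_pair_diff[OF resolvent_pair_resolvent[OF zero_less_one assms(1)]
      resolvent_pair_resolvent[OF zero_less_one assms(2)]] zero_less_one] .

lemma resolvent_norm: "w \<in> L2 \<Longrightarrow> L2_norm (resolvent 1 w) \<le> L2_norm w"
  by (rule resolvent_pair_norm(1)[OF resolvent_pair_resolvent]) simp_all

lemma resolvent_cmult:
  assumes "w \<in> L2"
  shows "(\<lambda>x. c * resolvent 1 w x) = resolvent 1 (\<lambda>x. c * w x)"
  using resolvent_pair_eq(1)[OF resolvent_pair_cmult[OF resolvent_pair_resolvent[OF zero_less_one assms]] zero_less_one] .

lemma resolvent_cont:
  assumes a: "((\<lambda>s. L2_norm (\<lambda>x. a s x - a t x)) \<longlongrightarrow> 0) (at t)" "\<And>t. a t \<in> L2"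
  shows "((\<lambda>s. L2_norm (\<lambda>x. resolvent 1 (a s) x - resolvent 1 (a t) x)) \<longlongrightarrow> 0) (at t)"
proof (rule Lim_null_comparison[OF _ a(1)], intro always_eventually allI)
  fix s
  have "L2_norm (resolvent 1 (\<lambda>x. a s x - a t x)) \<le> L2_norm (\<lambda>x. a s x - a t x)"
    by (intro resolvent_norm L2_diff a)
  then show "norm (L2_norm (\<lambda>x. resolvent 1 (a s) x - resolvent 1 (a t) x)) \<le> L2_norm (\<lambda>x. a s x - a t x)"
    using a(2) by (simp add: resolvent_diff)
qed

lemma resolvent_has_time_deriv:
  assumes w: "has_time_deriv w w' t" "\<And>t. w t \<in> L2" "w' \<in> L2"
  shows "has_time_deriv (\<lambda>t. resolvent 1 (w t)) (resolvent 1 w') t"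
  unfolding has_time_deriv_def
proof (rule Lim_null_comparison[OF _ w(1)[unfolded has_time_deriv_def]])
  show "\<forall>\<^sub>F h in at 0. norm (L2_norm (\<lambda>x. (resolvent 1 (w (t + h)) x - resolvent 1 (w t) x) / h - resolvent 1 w' x))
      \<le> L2_norm (\<lambda>x. (w (t + h) x - w t x) / h - w' x)"
  proof (intro always_eventually allI)
    fix h
    have dL: "(\<lambda>x. w (t + h) x - w t x) \<in> L2" using w by (intro L2_diff)
    have "(\<lambda>x. (resolvent 1 (w (t + h)) x - resolvent 1 (w t) x) / h - resolvent 1 w' x)
       = (\<lambda>x. 1 / h * resolvent 1 (\<lambda>x. w (t + h) x - w t x) x - resolvent 1 w' x)"
      using w by (simp flip: resolvent_diff)
    also have "\<dots> = (\<lambda>x. resolvent 1 (\<lambda>x. 1 / h * (w (t + h) x - w t x)) x - resolvent 1 w' x)"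
      unfolding resolvent_cmult[OF dL, symmetric] ..
    also have "\<dots> = resolvent 1 (\<lambda>x. 1 / h * (w (t + h) x - w t x) - w' x)"
      by (intro resolvent_diff L2_cmult dL w)
    also have "(\<lambda>x. 1 / h * (w (t + h) x - w t x) - w' x) = (\<lambda>x. (w (t + h) x - w t x) / h - w' x)"
      by auto
    finally have eq: "(\<lambda>x. (resolvent 1 (w (t + h)) x - resolvent 1 (w t) x) / h - resolvent 1 w' x)
      = resolvent 1 (\<lambda>x. (w (t + h) x - w t x) / h - w' x)" .
    show "norm (L2_norm (\<lambda>x. (resolvent 1 (w (t + h)) x - resolvent 1 (w t) x) / h - resolvent 1 w' x))
      \<le> L2_norm (\<lambda>x. (w (t + h) x - w t x) / h - w' x)"
      unfolding eq using resolvent_norm[OF L2_diff[OF L2_divide[OF dL] w(3)]] by simp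
  qed
qed

section \<open>Decay of bounded solutions\<close>

lemma nonlin_lipschitz:
  assumes p: "1 < p" and a: "\<bar>a\<bar> \<le> B" and b: "\<bar>b\<bar> \<le> B"
  shows "\<bar>nonlin p a - nonlin p b\<bar> \<le> p * B powr (p - 1) * \<bar>a - b\<bar>"
proof -
  have "norm (nonlin p a - nonlin p b) \<le> p * B powr (p - 1) * norm (a - b)"
  proof (rule field_differentiable_bound[of "{-B..B}"])
    show "(nonlin p has_field_derivative p * \<bar>s\<bar> powr (p - 1)) (at s within {-B..B})" for s
      by (rule has_field_derivative_at_within[OF nonlin_DERIV[OF p]])
    show "norm (p * \<bar>s\<bar> powr (p - 1)) \<le> p * B powr (p - 1)" if "s \<in> {-B..B}" for s
    proof -
      have "\<bar>s\<bar> powr (p - 1) \<le> B powr (p - 1)" using p that by (intro powr_mono2) auto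
      then show ?thesis using p by (simp add: abs_mult)
    qed
  qed (use a b in auto)
  then show ?thesis by simp
qed

lemma lebesgue_decay_measurable: "decay L \<in> borel_measurable lebesgue"
  by (rule continuous_lebesgue_measurable[OF decay_continuous])

lemma decay_L2: "0 < L \<Longrightarrow> g \<in> L2 \<Longrightarrow> (\<lambda>x. decay L x * g x) \<in> L2"
  by (rule L2_bounded_mult[OF _ lebesgue_decay_measurable decay_le_1(2)])

lemma decay_norm_le: "0 < L \<Longrightarrow> g \<in> L2 \<Longrightarrow> L2_norm (\<lambda>x. decay L x * g x) \<le> L2_norm g"
  using L2_norm_bounded_mult[OF _ lebesgue_decay_measurable decay_le_1(2)] by fastforce

lemma decay_ip_nonneg: "0 \<le> ip (\<lambda>x. decay L x * g x) g"
  unfolding ip_def using decay_pos[of L] by (intro Bochner_Integration.integral_nonneg) (simp add: mult.assoc less_imp_le)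

lemma decay_norm_le_sqrt:
  assumes L: "0 < L" and g: "g \<in> L2"
  shows "L2_norm (\<lambda>x. decay L x * g x) \<le> sqrt (ip (\<lambda>x. decay L x * g x) g)"
proof (rule real_le_rsqrt)
  have "(L2_norm (\<lambda>x. decay L x * g x))\<^sup>2 = (LINT x|lebesgue. decay L x * g x * (decay L x * g x))"
    by (simp add: L2_norm_power2 ip_def)
  also have "\<dots> \<le> (LINT x|lebesgue. decay L x * g x * g x)"
  proof (rule integral_mono)
    fix x
    have "decay L x * (decay L x * (g x * g x)) \<le> 1 * (decay L x * (g x * g x))"
      using decay_le_1(1)[OF L] decay_pos[of L x] by (intro mult_right_mono) auto
    then show "decay L x * g x * (decay L x * g x) \<le> decay L x * g x * g x" by (simp add: mult_ac)
  qed (intro L2_integrable_mult decay_L2 L g)+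
  finally show "(L2_norm (\<lambda>x. decay L x * g x))\<^sup>2 \<le> ip (\<lambda>x. decay L x * g x) g" by (simp add: ip_def)
qed

lemma sgn_L2:
  assumes L: "1 \<le> L" and g: "g \<in> L2"
  shows "(\<lambda>x. - (sgn x / L) * g x) \<in> L2" "L2_norm (\<lambda>x. - (sgn x / L) * g x) \<le> L2_norm g"
proof -
  have m: "(\<lambda>x. - (sgn x / L)) \<in> borel_measurable lebesgue" by (intro measurable_completion) measurable
  have b: "\<bar>- (sgn x / L)\<bar> \<le> 1" for x using L by (auto simp: sgn_if)
  show "(\<lambda>x. - (sgn x / L) * g x) \<in> L2" by (rule L2_bounded_mult[OF g m b])
  show "L2_norm (\<lambda>x. - (sgn x / L) * g x) \<le> L2_norm g" using L2_norm_bounded_mult[OF g m b] by simp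
qed

text \<open>
  One derivative of \<open>g'\<close> is moved to the other factor. Differentiating the weight reproduces it up to a factor
  \<open>sgn x / L\<close>, which is at most one in absolute value.
\<close>

lemma weighted_interpolation:
  assumes L: "1 \<le> L" and g: "ac_deriv g g'" "ac_deriv g' g''" "g \<in> L2" "g' \<in> L2" "g'' \<in> L2"
    and N: "L2_norm g' \<le> N" "L2_norm g'' \<le> N"
  shows "ip (\<lambda>x. decay L x * g' x) g' \<le> 2 * N * L2_norm (\<lambda>x. decay L x * g x)"
proof -
  have L0: "0 < L" using L by simp
  let ?h = "\<lambda>x. - (sgn x / L) * g' x + g'' x"
  have hL: "?h \<in> L2" by (intro L2_add sgn_L2 L g)
  have eq: "(\<lambda>x. - (sgn x / L) * decay L x * g' x + decay L x * g'' x) = (\<lambda>x. decay L x * ?h x)"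
    by (auto simp: algebra_simps)
  have "ac_deriv (\<lambda>x. decay L x * g' x) (\<lambda>x. decay L x * ?h x)"
    using ac_deriv_mult[OF decay_ac_deriv[OF L0] g(2)] unfolding eq .
  then have "ip g' (\<lambda>x. decay L x * g' x) = - ip g (\<lambda>x. decay L x * ?h x)"
    by (intro ip_deriv_left g decay_L2 L0 hL)
  also have "ip g (\<lambda>x. decay L x * ?h x) = ip (\<lambda>x. decay L x * g x) ?h" by (simp add: ip_def mult_ac)
  also have "- ip (\<lambda>x. decay L x * g x) ?h \<le> L2_norm (\<lambda>x. decay L x * g x) * L2_norm ?h"
    using abs_ip_le_norm[OF decay_L2[OF L0 g(3)] hL] by linarith
  also have "\<dots> \<le> L2_norm (\<lambda>x. decay L x * g x) * (2 * N)"
  proof (rule mult_left_mono)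
    show "L2_norm ?h \<le> 2 * N"
      using L2_norm_add_le[OF sgn_L2(1)[OF L g(4)] g(5)] sgn_L2(2)[OF L g(4)] N by linarith
  qed simp
  finally show ?thesis by (simp add: ip_commute mult_ac)
qed

lemma weighted_square_DERIV:
  assumes L: "0 < L" and w: "has_time_deriv w w' t" "\<And>t. w t \<in> L2" "w' \<in> L2"
    and cont: "((\<lambda>s. L2_norm (\<lambda>x. w s x - w t x)) \<longlongrightarrow> 0) (at t)"
  shows "((\<lambda>t. ip (\<lambda>x. decay L x * w t x) (w t)) has_real_derivative
      ip (\<lambda>x. decay L x * w' x) (w t) + ip (\<lambda>x. decay L x * w t x) w') (at t)"
    and "\<bar>ip (\<lambda>x. decay L x * w' x) (w t) + ip (\<lambda>x. decay L x * w t x) w'\<bar> \<le> 2 * (L2_norm w' * L2_norm (w t))"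
proof -
  show "((\<lambda>t. ip (\<lambda>x. decay L x * w t x) (w t)) has_real_derivative
      ip (\<lambda>x. decay L x * w' x) (w t) + ip (\<lambda>x. decay L x * w t x) w') (at t)"
  proof (rule ip_product_DERIV[OF has_time_deriv_bounded_mult[OF w lebesgue_decay_measurable decay_le_1(2)[OF L]]
        decay_L2[OF L w(2)] decay_L2[OF L w(3)] cont w(2)])
    have "((\<lambda>s. ip (w s) (\<lambda>x. decay L x * w t x)) has_real_derivative ip w' (\<lambda>x. decay L x * w t x)) (at t)"
      by (intro ip_DERIV w decay_L2 L)
    then show "((\<lambda>s. ip (\<lambda>x. decay L x * w t x) (w s)) has_real_derivative ip (\<lambda>x. decay L x * w t x) w') (at t)"
      by (simp add: ip_commute)
  qed
  have "ip (\<lambda>x. decay L x * w t x) w' = ip (\<lambda>x. decay L x * w' x) (w t)" by (simp add: ip_def mult_ac)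
  moreover have "\<bar>ip (\<lambda>x. decay L x * w' x) (w t)\<bar> \<le> L2_norm w' * L2_norm (w t)"
    using abs_ip_le_norm[OF decay_L2[OF L w(3)] w(2)[of t]]
      mult_right_mono[OF decay_norm_le[OF L w(3)] L2_norm_nonneg[of "w t"]] by linarith
  ultimately show "\<bar>ip (\<lambda>x. decay L x * w' x) (w t) + ip (\<lambda>x. decay L x * w t x) w'\<bar> \<le> 2 * (L2_norm w' * L2_norm (w t))"
    by linarith
qed

context bounded_solution
begin

definition U :: "real \<Rightarrow> real \<Rightarrow> real" where "U t = resolvent 1 (u t)"
definition Ux :: "real \<Rightarrow> real \<Rightarrow> real" where "Ux t = resolvent_deriv 1 (u t)"

lemma U_pair: "resolvent_pair 1 (u t) (U t) (Ux t)"
  unfolding U_def Ux_def by (rule resolvent_pair_resolvent[OF zero_less_one L2(1)])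

lemma U_L2: "U t \<in> L2" "Ux t \<in> L2" and U_ac: "ac_deriv (U t) (Ux t)" "ac_deriv (Ux t) (\<lambda>x. U t x - u t x)"
  using resolvent_pairD[OF U_pair] by auto

lemma Uxx_L2: "(\<lambda>x. U t x - u t x) \<in> L2" by (intro L2_diff U_L2 L2)

lemma U_norm: "L2_norm (U t) \<le> M" "L2_norm (Ux t) \<le> M" "L2_norm (\<lambda>x. U t x - u t x) \<le> 2 * M"
proof -
  show 1: "L2_norm (U t) \<le> M" using resolvent_pair_norm(1)[OF U_pair zero_less_one] M(1) order_trans by blast
  show "L2_norm (Ux t) \<le> M" using resolvent_pair_norm(2)[OF U_pair zero_less_one, of t] M(1)[of t] by simp
  show "L2_norm (\<lambda>x. U t x - u t x) \<le> 2 * M"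
    using L2_norm_diff_le[OF U_L2(1) L2(1), of t t] 1 M(1)[of t] by linarith
qed

definition mass :: "real \<Rightarrow> real \<Rightarrow> real" where
  "mass L t = ip (\<lambda>x. decay L x * u t x) (\<lambda>x. nonlin p (u t x))"

lemma weighted_profile: "1 < L \<Longrightarrow> weighted_profile p L (u t) B"
  by (unfold_locales) (auto intro: p L2 ac_deriv_continuous[OF ac(1)] u_bound)

lemma weighted_profile_mass: "1 < L \<Longrightarrow> weighted_profile.mass p L (u t) = mass L t"
  unfolding weighted_profile.mass_def[OF weighted_profile] mass_def ip_def decay_def
  by (simp add: mult.assoc nonlin_mult_self p)

lemma mass_nonneg: "0 \<le> mass L t"
  unfolding mass_def ip_def using decay_pos[of L] p
  by (intro Bochner_Integration.integral_nonneg) (simp add: mult.assoc nonlin_mult_self less_imp_le)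

lemma nonlocal_lower_bound:
  assumes L: "1 < L"
  shows "- (((p - 1) / (p + 1))\<^sup>2 + 1 / (L - 1)) * mass L t
    \<le> ip (\<lambda>x. decay L x * u t x) (resolvent 1 (\<lambda>x. nonlin p (u t x)))"
  using weighted_profile.pairing_lower_bound[OF weighted_profile[OF L], of t]
  unfolding weighted_profile_mass[OF L] decay_def .

lemma nonlocal_abs_bound:
  assumes L: "1 < L" and "\<psi> \<in> borel_measurable borel" and "\<And>x. \<bar>\<psi> x\<bar> \<le> C * decay L x"
  shows "\<bar>ip (\<lambda>x. \<psi> x * u t x) (resolvent 1 (\<lambda>x. nonlin p (u t x)))\<bar> \<le> C * (1 + 1 / (L - 1)) * mass L t"
  using weighted_profile.pairing_abs_bound[OF weighted_profile[OF L] assms(2), of C t] assms(3)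
  unfolding weighted_profile_mass[OF L] decay_def by blast

text \<open>
  Inserting \<open>u = U - U\<^sub>x\<^sub>x\<close> and integrating by parts gives \<open>\<integral> \<chi> (U\<^sup>2 + U\<^sub>x\<^sup>2) + \<integral> \<chi>' U U\<^sub>x\<close>, and the last term is
  absorbed since \<open>\<bar>\<chi>'\<bar> \<le> \<chi>\<close>.
\<close>

lemma local_term_lower_bound:
  assumes L: "1 \<le> L"
  shows "1 / 2 * ip (\<lambda>x. decay L x * U t x) (U t) \<le> ip (\<lambda>x. decay L x * u t x) (U t)"
proof -
  have L0: "0 < L" using L by simp
  note dL = decay_L2[OF L0]
  let ?U = "U t" and ?V = "Ux t"
  let ?s = "\<lambda>x. - (sgn x / L) * decay L x * ?U x"
  have sL: "?s \<in> L2" using sgn_L2(1)[OF L dL[OF U_L2(1)]] by (simp add: mult.assoc)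
  have "ac_deriv (\<lambda>x. decay L x * ?U x) (\<lambda>x. ?s x + decay L x * ?V x)"
    by (rule ac_deriv_mult[OF decay_ac_deriv[OF L0] U_ac(1)])
  then have "ip (\<lambda>x. ?U x - u t x) (\<lambda>x. decay L x * ?U x) = - ip ?V (\<lambda>x. ?s x + decay L x * ?V x)"
    by (intro ip_deriv_left U_ac U_L2 dL Uxx_L2 L2_add sL)
  then have "ip ?U (\<lambda>x. decay L x * ?U x) - ip (u t) (\<lambda>x. decay L x * ?U x)
      = - ip ?V ?s - ip ?V (\<lambda>x. decay L x * ?V x)"
    unfolding ip_diff_left[OF U_L2(1) L2(1) dL[OF U_L2(1)]] ip_add_right[OF sL dL[OF U_L2(2)] U_L2(2)]
    by linarith
  moreover have "ip (u t) (\<lambda>x. decay L x * ?U x) = ip (\<lambda>x. decay L x * u t x) ?U" by (simp add: ip_def mult_ac)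
  moreover have "0 \<le> 1 / 2 * ip ?U (\<lambda>x. decay L x * ?U x) + ip ?V ?s + ip ?V (\<lambda>x. decay L x * ?V x)"
  proof -
    have "0 \<le> (LINT x|lebesgue. 1 / 2 * (?U x * (decay L x * ?U x)) + ?V x * ?s x + ?V x * (decay L x * ?V x))"
    proof (rule Bochner_Integration.integral_nonneg)
      fix x
      define r where "r = - (sgn x / L)"
      have r: "\<bar>r\<bar> \<le> 1" using L by (auto simp: r_def sgn_if)
      have "0 \<le> 1 / 2 * (?U x)\<^sup>2 + r * (?V x * ?U x) + (?V x)\<^sup>2"
      proof -
        have "0 \<le> (?U x + r * ?V x)\<^sup>2" by simp
        also have "\<dots> = (?U x)\<^sup>2 + 2 * (r * (?V x * ?U x)) + r\<^sup>2 * (?V x)\<^sup>2"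
          by (simp add: power2_eq_square algebra_simps)
        also have "\<dots> \<le> (?U x)\<^sup>2 + 2 * (r * (?V x * ?U x)) + 2 * (?V x)\<^sup>2"
        proof -
          have "r\<^sup>2 \<le> 1" using r by (simp add: abs_square_le_1)
          then have "r\<^sup>2 * (?V x)\<^sup>2 \<le> 2 * (?V x)\<^sup>2" by (intro mult_right_mono) auto
          then show ?thesis by simp
        qed
        finally show ?thesis by simp
      qed
      then have "0 \<le> decay L x * (1 / 2 * (?U x)\<^sup>2 + r * (?V x * ?U x) + (?V x)\<^sup>2)"
        using decay_pos[of L x] by (intro mult_nonneg_nonneg) auto
      then show "0 \<le> 1 / 2 * (?U x * (decay L x * ?U x)) + ?V x * ?s x + ?V x * (decay L x * ?V x)"
        unfolding r_def[symmetric] by (simp add: power2_eq_square algebra_simps)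
    qed
    also have "\<dots> = 1 / 2 * ip ?U (\<lambda>x. decay L x * ?U x) + ip ?V ?s + ip ?V (\<lambda>x. decay L x * ?V x)"
    proof -
      have i: "integrable lebesgue (\<lambda>x. ?U x * (decay L x * ?U x))" "integrable lebesgue (\<lambda>x. ?V x * ?s x)"
        "integrable lebesgue (\<lambda>x. ?V x * (decay L x * ?V x))"
        by (intro L2_integrable_mult U_L2 dL sL)+
      show ?thesis unfolding ip_def using i
        by (simp only: Bochner_Integration.integral_add Bochner_Integration.integrable_add
            integrable_mult_right integral_mult_right_zero)
    qed
    finally show ?thesis .
  qed
  moreover have "ip ?U (\<lambda>x. decay L x * ?U x) = ip (\<lambda>x. decay L x * ?U x) ?U" by (rule ip_commute)
  ultimately show ?thesis by linarith
qed

text \<open>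
  Half of the difference between the coefficient of \<open>\<bar>u\<bar>\<^sup>p\<^sup>+\<^sup>1\<close> in the virial identity and the loss in the nonlocal
  term; the other half pays for the error \<open>1 / (L - 1)\<close> of the localisation.
\<close>

definition gap :: real where "gap = ((p - 1) / (p + 1) - ((p - 1) / (p + 1))\<^sup>2) / 2"

lemma gap_pos: "0 < gap"
proof -
  have c: "0 < (p - 1) / (p + 1)" "(p - 1) / (p + 1) < 1" using p by auto
  then have "(p - 1) / (p + 1) * ((p - 1) / (p + 1)) < 1 * ((p - 1) / (p + 1))"
    by (intro mult_strict_right_mono)
  then show ?thesis by (simp add: gap_def power2_eq_square)
qed

definition large :: "real \<Rightarrow> bool" where "large L \<longleftrightarrow> 1 < L \<and> 1 / (L - 1) \<le> gap"

lemma eventually_large: "\<forall>\<^sub>F L in at_top. large L"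
  using eventually_ge_at_top[of "2 + 1 / gap"]
proof eventually_elim
  case (elim L)
  have L: "1 < L" "1 / gap \<le> L - 1" using elim gap_pos divide_pos_pos[OF zero_less_one gap_pos] by linarith+
  then have "1 / (L - 1) \<le> gap" using gap_pos by (simp add: field_simps)
  then show ?case using L by (simp add: large_def)
qed

lemma virial_coercive:
  assumes L: "large L"
  shows "ip (\<lambda>x. decay L x * v t x) (v t) + 1 / 2 * ip (\<lambda>x. decay L x * U t x) (U t) + gap * mass L t
    \<le> virial (decay L) t"
proof -
  have L1: "1 < L" "1 / (L - 1) \<le> gap" using L by (auto simp: large_def)
  let ?c = "(p - 1) / (p + 1)"
  have "gap * mass L t \<le> (?c - ?c\<^sup>2 - 1 / (L - 1)) * mass L t"
  proof (rule mult_right_mono[OF _ mass_nonneg])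
    have "2 * gap = ?c - ?c\<^sup>2" by (simp add: gap_def)
    then show "gap \<le> ?c - ?c\<^sup>2 - 1 / (L - 1)" using L1(2) by linarith
  qed
  also have "\<dots> = ?c * mass L t + - (?c\<^sup>2 + 1 / (L - 1)) * mass L t" by (simp add: algebra_simps)
  also have "\<dots> \<le> ?c * mass L t + ip (\<lambda>x. decay L x * u t x) (resolvent 1 (\<lambda>x. nonlin p (u t x)))"
    using nonlocal_lower_bound[OF L1(1), of t] by simp
  finally show ?thesis
    using local_term_lower_bound[of L t] L1(1)
    unfolding virial_def U_def[symmetric] mass_def[symmetric] by linarith
qed

lemma virial_dominates:
  assumes "large L"
  shows "0 \<le> virial (decay L) t" "ip (\<lambda>x. decay L x * v t x) (v t) \<le> 1 * virial (decay L) t"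
    "ip (\<lambda>x. decay L x * U t x) (U t) \<le> 2 * virial (decay L) t"
    "mass L t \<le> 1 / gap * virial (decay L) t"
proof -
  have a: "0 \<le> ip (\<lambda>x. decay L x * v t x) (v t)" "0 \<le> ip (\<lambda>x. decay L x * U t x) (U t)" "0 \<le> gap * mass L t"
    using decay_ip_nonneg mass_nonneg gap_pos by auto
  note c = virial_coercive[OF assms, of t]
  show "0 \<le> virial (decay L) t" "ip (\<lambda>x. decay L x * v t x) (v t) \<le> 1 * virial (decay L) t"
    "ip (\<lambda>x. decay L x * U t x) (U t) \<le> 2 * virial (decay L) t"
    using a c by linarith+
  have "gap * mass L t \<le> virial (decay L) t" using a c by linarith
  then show "mass L t \<le> 1 / gap * virial (decay L) t" using gap_pos by (simp add: field_simps)
qed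

abbreviation smooth_momentum :: "real \<Rightarrow> real \<Rightarrow> real" where
  "smooth_momentum L \<equiv> momentum (decay_primitive L) (decay L)"

abbreviation sharp_momentum :: "real \<Rightarrow> real \<Rightarrow> real" where
  "sharp_momentum L \<equiv> momentum (clamp_id L) (indicator {-L..L})"

lemma smooth_momentum_DERIV:
  "0 < L \<Longrightarrow> (smooth_momentum L has_real_derivative virial (decay L) t) (at t)"
  by (rule virial_identity[OF decay_primitive_ac_deriv decay_primitive_bound decay_le_1(2)])

lemma indicator_abs_le_1: "\<bar>indicator S x :: real\<bar> \<le> 1"
  by (simp add: indicator_def)

lemma sharp_momentum_DERIV:
  "0 < L \<Longrightarrow> (sharp_momentum L has_real_derivative virial (indicator {-L..L}) t) (at t)"
  by (rule virial_identity[OF clamp_id_ac_deriv clamp_id_bound indicator_abs_le_1])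

lemma smooth_momentum_converges:
  assumes L: "large L"
  shows "\<exists>l. (smooth_momentum L \<longlongrightarrow> l) at_top"
proof (rule mono_bounded_tendsto)
  have L0: "0 < L" using L by (simp add: large_def)
  show "smooth_momentum L s \<le> smooth_momentum L t" if "s \<le> t" for s t
  proof (rule DERIV_nonneg_imp_nondecreasing[OF that])
    fix r
    show "\<exists>y. (smooth_momentum L has_real_derivative y) (at r) \<and> 0 \<le> y"
      using smooth_momentum_DERIV[OF L0, of r] virial_dominates(1)[OF L, of r] by blast
  qed
  show "smooth_momentum L t \<le> (4 * L + 1) * M\<^sup>2" for t
    using momentum_bound[OF decay_primitive_ac_deriv decay_primitive_bound decay_le_1(2), OF L0 L0 L0, of t] by linarith
qed

lemma U_cont: "((\<lambda>s. L2_norm (\<lambda>x. U s x - U t x)) \<longlongrightarrow> 0) (at t)"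
  unfolding U_def by (rule resolvent_cont[OF cont(1) L2(1)])

lemma eq_U: "has_time_deriv U (resolvent 1 (vx t)) t"
  unfolding U_def[abs_def] by (rule resolvent_has_time_deriv[OF eq_u L2(1,4)])

text \<open>
  The weighted square is dominated by the derivative of the convergent function \<open>smooth_momentum L\<close>, and its own
  time derivative is bounded by the equation.
\<close>

lemma weighted_v_decays:
  assumes L: "large L"
  shows "((\<lambda>t. ip (\<lambda>x. decay L x * v t x) (v t)) \<longlongrightarrow> 0) at_top"
proof -
  have L0: "0 < L" using L by (simp add: large_def)
  obtain l where l: "(smooth_momentum L \<longlongrightarrow> l) at_top" using smooth_momentum_converges[OF L] by blast
  let ?w = "\<lambda>t. resolvent 1 (Fx t)"
  note D = weighted_square_DERIV[OF L0 eq_v' L2(3) resolvent_L2[OF Fx_L2] cont(2)]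
  show ?thesis
  proof (rule barbalat[OF smooth_momentum_DERIV[OF L0] l D(1) _ decay_ip_nonneg virial_dominates(2)[OF L] zero_less_one])
    fix t
    have "L2_norm (?w t) * L2_norm (v t) \<le> (1 + p * B powr (p - 1)) * M * M"
      using resolvent_norm[OF Fx_L2, of t] Fx_norm[of t] M(3)[of t] p M_nonneg
      by (intro mult_mono) auto
    then show "\<bar>ip (\<lambda>x. decay L x * ?w t x) (v t) + ip (\<lambda>x. decay L x * v t x) (?w t)\<bar>
        \<le> 2 * ((1 + p * B powr (p - 1)) * M * M)"
      using D(2)[of t] by linarith
  qed
qed

lemma weighted_U_decays:
  assumes L: "large L"
  shows "((\<lambda>t. ip (\<lambda>x. decay L x * U t x) (U t)) \<longlongrightarrow> 0) at_top"
proof -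
  have L0: "0 < L" using L by (simp add: large_def)
  obtain l where l: "(smooth_momentum L \<longlongrightarrow> l) at_top" using smooth_momentum_converges[OF L] by blast
  let ?w = "\<lambda>t. resolvent 1 (vx t)"
  have two: "(0::real) < 2" by simp
  note D = weighted_square_DERIV[OF L0 eq_U U_L2(1) resolvent_L2[OF L2(4)] U_cont]
  show ?thesis
  proof (rule barbalat[OF smooth_momentum_DERIV[OF L0] l D(1) _ decay_ip_nonneg virial_dominates(3)[OF L] two])
    fix t
    have "L2_norm (?w t) * L2_norm (U t) \<le> M * M"
      using resolvent_norm[OF L2(4), of t] M(4)[of t] U_norm(1)[of t] M_nonneg
      by (intro mult_mono) auto
    then show "\<bar>ip (\<lambda>x. decay L x * ?w t x) (U t) + ip (\<lambda>x. decay L x * U t x) (?w t)\<bar> \<le> 2 * (M * M)"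
      using D(2)[of t] by linarith
  qed
qed

lemma decay_norm_tendsto_0:
  assumes L: "0 < L" and g: "\<And>t. g t \<in> L2" and lim: "((\<lambda>t. ip (\<lambda>x. decay L x * g t x) (g t)) \<longlongrightarrow> 0) at_top"
  shows "((\<lambda>t. L2_norm (\<lambda>x. decay L x * g t x)) \<longlongrightarrow> 0) at_top"
proof (rule Lim_null_comparison)
  show "((\<lambda>t. sqrt (ip (\<lambda>x. decay L x * g t x) (g t))) \<longlongrightarrow> 0) at_top"
    using tendsto_real_sqrt[OF lim] by simp
  show "\<forall>\<^sub>F t in at_top. norm (L2_norm (\<lambda>x. decay L x * g t x)) \<le> sqrt (ip (\<lambda>x. decay L x * g t x) (g t))"
    using decay_norm_le_sqrt[OF L g] by simp
qed

lemma interpolated_decay: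
  assumes L: "1 \<le> L" and g: "\<And>t. ac_deriv (g t) (g' t)" "\<And>t. ac_deriv (g' t) (g'' t)"
    "\<And>t. g t \<in> L2" "\<And>t. g' t \<in> L2" "\<And>t. g'' t \<in> L2"
    and N: "\<And>t. L2_norm (g' t) \<le> N" "\<And>t. L2_norm (g'' t) \<le> N"
    and lim: "((\<lambda>t. ip (\<lambda>x. decay L x * g t x) (g t)) \<longlongrightarrow> 0) at_top"
  shows "((\<lambda>t. ip (\<lambda>x. decay L x * g' t x) (g' t)) \<longlongrightarrow> 0) at_top"
proof (rule Lim_null_comparison)
  have L0: "0 < L" using L by simp
  have "((\<lambda>t. 2 * N * L2_norm (\<lambda>x. decay L x * g t x)) \<longlongrightarrow> 2 * N * 0) at_top"
    by (intro tendsto_intros decay_norm_tendsto_0 L0 g lim)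
  then show "((\<lambda>t. 2 * N * L2_norm (\<lambda>x. decay L x * g t x)) \<longlongrightarrow> 0) at_top" by simp
  show "\<forall>\<^sub>F t in at_top. norm (ip (\<lambda>x. decay L x * g' t x) (g' t)) \<le> 2 * N * L2_norm (\<lambda>x. decay L x * g t x)"
    using weighted_interpolation[OF L g N] decay_ip_nonneg by (simp add: abs_of_nonneg)
qed

lemma weighted_vx_decays:
  assumes L: "large L"
  shows "((\<lambda>t. ip (\<lambda>x. decay L x * vx t x) (vx t)) \<longlongrightarrow> 0) at_top"
  using L by (intro interpolated_decay[OF _ ac(2,3) L2(3,4,5) M(4,5) weighted_v_decays]) (auto simp: large_def)

lemma weighted_Ux_decays:
  assumes L: "large L"
  shows "((\<lambda>t. ip (\<lambda>x. decay L x * Ux t x) (Ux t)) \<longlongrightarrow> 0) at_top"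
proof (rule interpolated_decay[OF _ U_ac U_L2 Uxx_L2 _ U_norm(3) weighted_U_decays[OF L]])
  show "1 \<le> L" using L by (simp add: large_def)
  show "L2_norm (Ux t) \<le> 2 * M" for t using U_norm(2)[of t] M_nonneg by linarith
qed

text \<open>
  Inserting \<open>u = U - U\<^sub>x\<^sub>x\<close> into one factor and integrating by parts leaves \<open>\<chi> U\<close> and \<open>\<chi> U\<^sub>x\<close>, which decay, paired
  with functions that are bounded in \<open>L\<^sup>2\<close>.
\<close>

lemma weighted_u_decays:
  assumes L: "large L"
  shows "((\<lambda>t. ip (\<lambda>x. decay L x * u t x) (u t)) \<longlongrightarrow> 0) at_top"
proof (rule Lim_null_comparison)
  have L1: "1 \<le> L" and L0: "0 < L" using L by (auto simp: large_def)
  note dL = decay_L2[OF L0]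
  have "((\<lambda>t. L2_norm (\<lambda>x. decay L x * U t x) * M + L2_norm (\<lambda>x. decay L x * Ux t x) * (2 * M)) \<longlongrightarrow> 0 * M + 0 * (2 * M)) at_top"
    by (intro tendsto_intros decay_norm_tendsto_0 L0 U_L2 weighted_U_decays weighted_Ux_decays L)
  then show "((\<lambda>t. L2_norm (\<lambda>x. decay L x * U t x) * M + L2_norm (\<lambda>x. decay L x * Ux t x) * (2 * M)) \<longlongrightarrow> 0) at_top"
    by simp
  show "\<forall>\<^sub>F t in at_top. norm (ip (\<lambda>x. decay L x * u t x) (u t))
      \<le> L2_norm (\<lambda>x. decay L x * U t x) * M + L2_norm (\<lambda>x. decay L x * Ux t x) * (2 * M)"
  proof (intro always_eventually allI)
    fix t
    let ?h = "\<lambda>x. - (sgn x / L) * u t x + ux t x"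
    have hL: "?h \<in> L2" by (intro L2_add sgn_L2 L1 L2)
    have hn: "L2_norm ?h \<le> 2 * M"
      using L2_norm_add_le[OF sgn_L2(1)[OF L1 L2(1)] L2(2), of t t] sgn_L2(2)[OF L1 L2(1), of t] M(1,2)[of t] by linarith
    have eq: "(\<lambda>x. - (sgn x / L) * decay L x * u t x + decay L x * ux t x) = (\<lambda>x. decay L x * ?h x)"
      by (auto simp: algebra_simps)
    have "ac_deriv (\<lambda>x. decay L x * u t x) (\<lambda>x. decay L x * ?h x)"
      using ac_deriv_mult[OF decay_ac_deriv[OF L0] ac(1)[of t]] unfolding eq .
    then have "ip (\<lambda>x. U t x - u t x) (\<lambda>x. decay L x * u t x) = - ip (Ux t) (\<lambda>x. decay L x * ?h x)"
      by (intro ip_deriv_left U_ac U_L2 Uxx_L2 dL L2 hL)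
    then have "ip (u t) (\<lambda>x. decay L x * u t x) = ip (U t) (\<lambda>x. decay L x * u t x) + ip (Ux t) (\<lambda>x. decay L x * ?h x)"
      by (simp add: ip_diff_left U_L2 L2 dL)
    moreover have "ip (U t) (\<lambda>x. decay L x * u t x) = ip (\<lambda>x. decay L x * U t x) (u t)"
      "ip (Ux t) (\<lambda>x. decay L x * ?h x) = ip (\<lambda>x. decay L x * Ux t x) ?h"
      by (simp_all add: ip_def mult_ac)
    moreover have "ip (\<lambda>x. decay L x * U t x) (u t) \<le> L2_norm (\<lambda>x. decay L x * U t x) * M"
      using ip_le_norm[OF dL[OF U_L2(1)] L2(1), of t t] mult_left_mono[OF M(1)[of t] L2_norm_nonneg] order_trans by blast
    moreover have "ip (\<lambda>x. decay L x * Ux t x) ?h \<le> L2_norm (\<lambda>x. decay L x * Ux t x) * (2 * M)"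
      using ip_le_norm[OF dL[OF U_L2(2)] hL, of t] mult_left_mono[OF hn L2_norm_nonneg] order_trans by blast
    ultimately have "ip (\<lambda>x. decay L x * u t x) (u t)
        \<le> L2_norm (\<lambda>x. decay L x * U t x) * M + L2_norm (\<lambda>x. decay L x * Ux t x) * (2 * M)"
      unfolding ip_commute[of "u t"] by linarith
    then show "norm (ip (\<lambda>x. decay L x * u t x) (u t))
        \<le> L2_norm (\<lambda>x. decay L x * U t x) * M + L2_norm (\<lambda>x. decay L x * Ux t x) * (2 * M)"
      using decay_ip_nonneg[of L "u t"] by simp
  qed
qed

section \<open>The time integral over a sharp cut-off\<close>

text \<open>
  Both weights and both primitives differ by at most a multiple of \<open>decay L\<close>, so the difference is controlled by the
  weighted norm of \<open>u\<close>.
\<close>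

lemma momentum_difference_tendsto_0:
  assumes L: "large L"
  shows "((\<lambda>t. sharp_momentum L t - smooth_momentum L t) \<longlongrightarrow> 0) at_top"
proof (rule Lim_null_comparison)
  have L0: "0 < L" using L by (simp add: large_def)
  note dL = decay_L2[OF L0]
  have "((\<lambda>t. (12 * L + 4) * M * L2_norm (\<lambda>x. decay L x * u t x)) \<longlongrightarrow> (12 * L + 4) * M * 0) at_top"
    by (intro tendsto_intros decay_norm_tendsto_0 L0 L2 weighted_u_decays L)
  then show "((\<lambda>t. (12 * L + 4) * M * L2_norm (\<lambda>x. decay L x * u t x)) \<longlongrightarrow> 0) at_top" by simp
  show "\<forall>\<^sub>F t in at_top. norm (sharp_momentum L t - smooth_momentum L t) \<le> (12 * L + 4) * M * L2_norm (\<lambda>x. decay L x * u t x)"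
  proof (intro always_eventually allI)
    fix t
    let ?n = "L2_norm (\<lambda>x. decay L x * u t x)"
    have m: "clamp_id L \<in> borel_measurable lebesgue" "decay_primitive L \<in> borel_measurable lebesgue"
      "(indicator {-L..L} :: real \<Rightarrow> real) \<in> borel_measurable lebesgue"
      using ac_deriv_measurable_fun[OF clamp_id_ac_deriv[OF L0]] ac_deriv_measurable_fun[OF decay_primitive_ac_deriv[OF L0]]
        ac_deriv_measurable[OF clamp_id_ac_deriv[OF L0]] by auto
    have main: "\<bar>ip (\<lambda>x. \<phi> x * u t x) g - ip (\<lambda>x. \<phi>' x * u t x) g\<bar> \<le> K * ?n * L2_norm g"
      if g: "g \<in> L2" and \<phi>: "\<phi> \<in> borel_measurable lebesgue" "\<phi>' \<in> borel_measurable lebesgue"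
        "\<And>x. \<bar>\<phi> x\<bar> \<le> C" "\<And>x. \<bar>\<phi>' x\<bar> \<le> C'" and K: "\<And>x. \<bar>\<phi> x - \<phi>' x\<bar> \<le> K * decay L x" for g \<phi> \<phi>' C C' K
    proof -
      have K0: "0 \<le> K" using K[of 0] by (simp add: decay_def)
      have L: "(\<lambda>x. \<phi> x * u t x) \<in> L2" "(\<lambda>x. \<phi>' x * u t x) \<in> L2"
        by (rule L2_bounded_mult[OF L2(1) \<phi>(1,3)], rule L2_bounded_mult[OF L2(1) \<phi>(2,4)])
      have "ip (\<lambda>x. \<phi> x * u t x) g - ip (\<lambda>x. \<phi>' x * u t x) g = ip (\<lambda>x. \<phi> x * u t x - \<phi>' x * u t x) g"
        using L g by (simp add: ip_diff_left)
      also have "\<bar>\<dots>\<bar> \<le> L2_norm (\<lambda>x. \<phi> x * u t x - \<phi>' x * u t x) * L2_norm g"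
        by (intro abs_ip_le_norm L2_diff L g)
      also have "\<dots> \<le> (K * ?n) * L2_norm g"
      proof (rule mult_right_mono)
        have "L2_norm (\<lambda>x. \<phi> x * u t x - \<phi>' x * u t x) \<le> L2_norm (\<lambda>x. K * (decay L x * u t x))"
        proof (rule L2_norm_mono[OF L2_cmult[OF dL[OF L2(1)]] L2_measurable[OF L2_diff[OF L]]])
          fix x
          have "\<bar>\<phi> x - \<phi>' x\<bar> * \<bar>u t x\<bar> \<le> K * decay L x * \<bar>u t x\<bar>" by (intro mult_right_mono K) simp
          then show "\<bar>\<phi> x * u t x - \<phi>' x * u t x\<bar> \<le> \<bar>K * (decay L x * u t x)\<bar>"
            using K0 decay_pos[of L x] by (simp add: abs_mult left_diff_distrib[symmetric] mult.assoc)
        qed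
        then show "L2_norm (\<lambda>x. \<phi> x * u t x - \<phi>' x * u t x) \<le> K * ?n" using K0 by (simp add: L2_norm_cmult)
      qed simp
      finally show ?thesis .
    qed
    have 1: "\<bar>ip (\<lambda>x. clamp_id L x * u t x) (z t) - ip (\<lambda>x. decay_primitive L x * u t x) (z t)\<bar> \<le> 3 * L * ?n * L2_norm (z t)"
    proof (rule main[OF z_L2 m(1,2) clamp_id_bound[OF L0] decay_primitive_bound[OF L0]])
      show "\<bar>clamp_id L x - decay_primitive L x\<bar> \<le> 3 * L * decay L x" for x
        using clamp_decay_primitive_diff[OF L0, of x] L0 decay_pos[of L x] by (simp add: abs_mult)
    qed
    have 2: "\<bar>ip (\<lambda>x. indicator {-L..L} x * u t x) (vx t) - ip (\<lambda>x. decay L x * u t x) (vx t)\<bar> \<le> 4 * ?n * L2_norm (vx t)"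
    proof (rule main[OF L2(4) m(3) lebesgue_decay_measurable indicator_abs_le_1 decay_le_1(2)[OF L0]])
      show "\<bar>indicator {-L..L} x - decay L x\<bar> \<le> 4 * decay L x" for x
        using indicator_le_decay[OF L0, of x] decay_pos[of L x] by (simp add: abs_le_iff indicator_def)
    qed
    have n0: "0 \<le> 3 * L * ?n" "0 \<le> 4 * ?n" using L0 by auto
    have "norm (sharp_momentum L t - smooth_momentum L t)
      \<le> 2 * \<bar>ip (\<lambda>x. clamp_id L x * u t x) (z t) - ip (\<lambda>x. decay_primitive L x * u t x) (z t)\<bar>
        + \<bar>ip (\<lambda>x. indicator {-L..L} x * u t x) (vx t) - ip (\<lambda>x. decay L x * u t x) (vx t)\<bar>"
    proof -
      have "\<bar>- 2 * a + b - (- 2 * a' + b')\<bar> \<le> 2 * \<bar>a - a'\<bar> + \<bar>b - b'\<bar>" for a a' b b' :: real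
      proof -
        have "- 2 * a + b - (- 2 * a' + b') = (b - b') - 2 * (a - a')" by simp
        moreover have "\<bar>(b - b') - 2 * (a - a')\<bar> \<le> \<bar>b - b'\<bar> + \<bar>2 * (a - a')\<bar>"
          by (rule abs_triangle_ineq4)
        moreover have "\<bar>2 * (a - a')\<bar> = 2 * \<bar>a - a'\<bar>" by (simp only: abs_mult abs_numeral)
        ultimately show ?thesis by (simp only: add.commute)
      qed
      then show ?thesis unfolding momentum_def real_norm_def .
    qed
    also have "\<dots> \<le> 2 * (3 * L * ?n * (2 * M)) + 4 * ?n * M"
      by (intro add_mono mult_left_mono order_trans[OF 1 mult_left_mono[OF z_norm n0(1)]]
          order_trans[OF 2 mult_left_mono[OF M(4) n0(2)]]) simp
    also have "\<dots> = (12 * L + 4) * M * ?n" by (simp add: algebra_simps)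
    finally show "norm (sharp_momentum L t - smooth_momentum L t) \<le> (12 * L + 4) * M * ?n" .
  qed
qed

lemma nonlin_cont: "((\<lambda>s. L2_norm (\<lambda>x. nonlin p (u s x) - nonlin p (u t x))) \<longlongrightarrow> 0) (at t)"
proof (rule Lim_null_comparison)
  let ?K = "p * B powr (p - 1)"
  have K: "0 \<le> ?K" using p by simp
  have "((\<lambda>s. ?K * L2_norm (\<lambda>x. u s x - u t x)) \<longlongrightarrow> ?K * 0) (at t)" by (intro tendsto_intros cont)
  then show "((\<lambda>s. ?K * L2_norm (\<lambda>x. u s x - u t x)) \<longlongrightarrow> 0) (at t)" by simp
  show "\<forall>\<^sub>F s in at t. norm (L2_norm (\<lambda>x. nonlin p (u s x) - nonlin p (u t x))) \<le> ?K * L2_norm (\<lambda>x. u s x - u t x)"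
  proof (intro always_eventually allI)
    fix s
    have "L2_norm (\<lambda>x. nonlin p (u s x) - nonlin p (u t x)) \<le> L2_norm (\<lambda>x. ?K * (u s x - u t x))"
    proof (rule L2_norm_mono[OF L2_cmult[OF L2_diff[OF L2(1) L2(1)]] L2_measurable[OF L2_diff[OF nonlin_u_L2 nonlin_u_L2]]])
      show "\<bar>nonlin p (u s x) - nonlin p (u t x)\<bar> \<le> \<bar>?K * (u s x - u t x)\<bar>" for x
        using nonlin_lipschitz[OF p u_bound u_bound, of s x t x] K by (simp only: abs_mult[of ?K] abs_of_nonneg)
    qed
    then show "norm (L2_norm (\<lambda>x. nonlin p (u s x) - nonlin p (u t x))) \<le> ?K * L2_norm (\<lambda>x. u s x - u t x)"
      using K by (simp add: L2_norm_cmult)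
  qed
qed

text \<open>
  The integrand is the virial with the indicator as weight, plus a function \<open>G\<close> of time. The former is the derivative
  of the convergent sharp momentum, the latter is absolutely integrable.
\<close>

lemma sharp_density_has_integral:
  assumes L: "large L"
  shows "\<exists>J. ((\<lambda>t. ip (\<lambda>x. indicator {-L..L} x * v t x) (v t) + ip (\<lambda>x. indicator {-L..L} x * u t x) (U t)
      + ip (\<lambda>x. indicator {-L..L} x * u t x) (\<lambda>x. nonlin p (u t x))) has_integral J) {2..}"
proof -
  have L0: "0 < L" and L1: "1 < L" using L by (auto simp: large_def)
  let ?\<psi> = "indicator {-L..L} :: real \<Rightarrow> real" and ?c = "(p - 1) / (p + 1)"
  let ?f = "\<lambda>t x. nonlin p (u t x)"
  have \<psi>m: "?\<psi> \<in> borel_measurable lebesgue" using ac_deriv_measurable[OF clamp_id_ac_deriv[OF L0]] .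
  have \<psi>L: "(\<lambda>x. ?\<psi> x * g x) \<in> L2" if "g \<in> L2" for g by (rule L2_bounded_mult[OF that \<psi>m indicator_abs_le_1])
  have \<psi>d: "\<bar>?\<psi> x\<bar> \<le> 3 * decay L x" for x using indicator_le_decay[OF L0, of x] by simp
  define G where "G t = (1 - ?c) * ip (\<lambda>x. ?\<psi> x * u t x) (?f t) - ip (\<lambda>x. ?\<psi> x * u t x) (resolvent 1 (?f t))" for t
  obtain l where l: "(smooth_momentum L \<longlongrightarrow> l) at_top" using smooth_momentum_converges[OF L] by blast
  have sl: "(sharp_momentum L \<longlongrightarrow> l) at_top"
    using tendsto_add[OF l momentum_difference_tendsto_0[OF L]] by simp
  have ftc: "(virial \<psi> has_integral X T - X 2) {2..T}"
    if "\<And>t. (X has_real_derivative virial \<psi> t) (at t)" "2 \<le> T" for X \<psi> T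
    using that by (intro fundamental_theorem_of_calculus)
      (auto simp: has_real_derivative_iff_has_vector_derivative has_vector_derivative_at_within)
  have v1: "(virial ?\<psi> has_integral (l - sharp_momentum L 2)) {2..}"
    by (rule has_integral_improper[OF ftc[OF sharp_momentum_DERIV[OF L0]]]) (auto intro!: tendsto_intros sl)
  have v2: "(virial (decay L) has_integral (l - smooth_momentum L 2)) {2..}"
    by (rule has_integral_improper[OF ftc[OF smooth_momentum_DERIV[OF L0]]]) (auto intro!: tendsto_intros l)
  \<comment> \<open>\<open>G\<close> is dominated by the weighted virial density, which is nonnegative and integrable in time.\<close>
  let ?K = "(\<bar>1 - ?c\<bar> * 3 + 3 * (1 + 1 / (L - 1))) * (1 / gap)"
  have Gb: "\<bar>G t\<bar> \<le> ?K * virial (decay L) t" for t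
  proof -
    have m3: "\<bar>ip (\<lambda>x. ?\<psi> x * u t x) (?f t)\<bar> \<le> 3 * mass L t"
    proof -
      have i1: "integrable lebesgue (\<lambda>x. ?\<psi> x * u t x * ?f t x)"
        by (intro L2_integrable_mult \<psi>L L2 nonlin_u_L2)
      have i2: "integrable lebesgue (\<lambda>x. decay L x * u t x * ?f t x)"
        by (intro L2_integrable_mult decay_L2 L0 L2 nonlin_u_L2)
      have "\<bar>ip (\<lambda>x. ?\<psi> x * u t x) (?f t)\<bar> \<le> (LINT x|lebesgue. 3 * (decay L x * u t x * ?f t x))"
        unfolding ip_def real_norm_def[symmetric]
      proof (rule Bochner_Integration.integral_norm_bound_integral[OF i1])
        show "integrable lebesgue (\<lambda>x. 3 * (decay L x * u t x * ?f t x))" using i2 by simp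
        fix x
        have "\<bar>?\<psi> x\<bar> * \<bar>u t x\<bar> powr (p + 1) \<le> 3 * decay L x * \<bar>u t x\<bar> powr (p + 1)"
          by (intro mult_right_mono \<psi>d) simp
        then show "norm (?\<psi> x * u t x * ?f t x) \<le> 3 * (decay L x * u t x * ?f t x)"
          by (simp add: mult.assoc nonlin_mult_self p abs_mult)
      qed
      also have "\<dots> = 3 * mass L t" by (simp add: mass_def ip_def)
      finally show ?thesis .
    qed
    have r3: "\<bar>ip (\<lambda>x. ?\<psi> x * u t x) (resolvent 1 (?f t))\<bar> \<le> 3 * (1 + 1 / (L - 1)) * mass L t"
      by (rule nonlocal_abs_bound[OF L1 _ \<psi>d]) measurable
    have "\<bar>G t\<bar> \<le> \<bar>1 - ?c\<bar> * \<bar>ip (\<lambda>x. ?\<psi> x * u t x) (?f t)\<bar> + \<bar>ip (\<lambda>x. ?\<psi> x * u t x) (resolvent 1 (?f t))\<bar>"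
      unfolding G_def abs_mult[symmetric] by (rule abs_triangle_ineq4)
    also have "\<dots> \<le> \<bar>1 - ?c\<bar> * (3 * mass L t) + 3 * (1 + 1 / (L - 1)) * mass L t"
      by (intro add_mono mult_left_mono m3 r3) simp
    also have "\<dots> = (\<bar>1 - ?c\<bar> * 3 + 3 * (1 + 1 / (L - 1))) * mass L t" by (simp only: distrib_right mult.assoc)
    also have "\<dots> \<le> (\<bar>1 - ?c\<bar> * 3 + 3 * (1 + 1 / (L - 1))) * (1 / gap * virial (decay L) t)"
      using L1 by (intro mult_left_mono virial_dominates(4)[OF L] add_nonneg_nonneg mult_nonneg_nonneg) auto
    finally show ?thesis by (simp only: mult.assoc)
  qed
  have "isCont G t" for t
    unfolding G_def[abs_def]
    by (intro continuous_intros ip_isCont L2_cont_bounded_mult[OF cont(1) L2(1) \<psi>m indicator_abs_le_1]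
        \<psi>L L2 nonlin_cont nonlin_u_L2 resolvent_cont resolvent_L2)
  then have Gc: "continuous_on {2..} G" by (simp add: continuous_at_imp_continuous_on)
  have "G absolutely_integrable_on {2..}"
  proof (rule measurable_bounded_by_integrable_imp_absolutely_integrable)
    show "G \<in> borel_measurable (lebesgue_on {2..})"
      by (rule continuous_imp_measurable_on_sets_lebesgue[OF Gc]) simp
    show "(\<lambda>t. ?K * virial (decay L) t) integrable_on {2..}"
      using v2 by (intro integrable_on_mult_right) (auto simp: integrable_on_def)
    show "norm (G t) \<le> ?K * virial (decay L) t" for t using Gb[of t] by simp
  qed simp
  then obtain J where J: "(G has_integral J) {2..}"
    using set_lebesgue_integral_eq_integral(1) by (auto simp: integrable_on_def)
  have "virial ?\<psi> t + G t = ip (\<lambda>x. ?\<psi> x * v t x) (v t) + ip (\<lambda>x. ?\<psi> x * u t x) (U t) + ip (\<lambda>x. ?\<psi> x * u t x) (?f t)" for t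
    unfolding virial_def G_def U_def by (simp add: left_diff_distrib)
  with has_integral_add[OF v1 J] show ?thesis by auto
qed

end

section \<open>From the function spaces to representatives\<close>

lemma AE_nearby:
  fixes t d :: real
  assumes "AE s in lebesgue. P s" and d: "0 < d"
  shows "\<exists>s. s \<noteq> t \<and> dist s t < d \<and> P s"
proof (rule ccontr)
  assume neg: "\<not> (\<exists>s. s \<noteq> t \<and> dist s t < d \<and> P s)"
  have no: "\<not> P s" if s: "s \<in> {t<..<t + d}" for s
  proof -
    have "s \<noteq> t" "dist s t < d" using s by (auto simp: dist_real_def)
    then show ?thesis using neg by blast
  qed
  have "AE s in lebesgue. s \<notin> {t<..<t + d}"
    using assms(1) by eventually_elim (use no in blast)
  then have "emeasure lebesgue {t<..<t + d} = 0"
    by (subst (asm) AE_iff_measurable[of "{t<..<t + d}"]) auto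
  then show False using d by simp
qed

text \<open>
  The bound holds at a dense set of times and the curve is continuous; the summand \<open>1\<close> leaves room for the
  approximation.
\<close>

lemma L2_norm_bound_everywhere:
  fixes g :: "real \<Rightarrow> real \<Rightarrow> real"
  assumes ae: "AE t in lebesgue. L2_norm (g t) \<le> C" and g: "\<And>t. g t \<in> L2"
    and cont: "\<And>t. ((\<lambda>s. L2_norm (\<lambda>x. g s x - g t x)) \<longlongrightarrow> 0) (at t)"
  shows "L2_norm (g t) \<le> C + 1"
proof -
  have "\<forall>\<^sub>F s in at t. L2_norm (\<lambda>x. g s x - g t x) < 1"
    by (rule order_tendstoD(2)[OF cont]) simp
  then obtain d where d: "0 < d" "\<And>s. s \<noteq> t \<Longrightarrow> dist s t < d \<Longrightarrow> L2_norm (\<lambda>x. g s x - g t x) < 1"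
    unfolding eventually_at by blast
  obtain s where s: "s \<noteq> t" "dist s t < d" "L2_norm (g s) \<le> C" using AE_nearby[OF ae d(1)] by blast
  have "L2_norm (g t) = L2_norm (\<lambda>x. g s x - (g s x - g t x))" by simp
  also have "\<dots> \<le> L2_norm (g s) + L2_norm (\<lambda>x. g s x - g t x)" by (intro L2_norm_diff_le L2_diff g)
  finally show ?thesis using d(2)[OF s(1,2)] s(3) by linarith
qed

lemma H1_norm_ge: "L2_norm f \<le> H1_norm f" "L2_norm (weak_deriv f) \<le> H1_norm f"
  unfolding H1_norm_def by (rule real_le_rsqrt, simp)+

lemma H2_norm_ge: "L2_norm f \<le> H2_norm f" "L2_norm (weak_deriv f) \<le> H2_norm f"
  "L2_norm (weak_deriv (weak_deriv f)) \<le> H2_norm f"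
  unfolding H2_norm_def by (rule real_le_rsqrt, simp)+

lemma L2_limit_0_cong:
  assumes "((\<lambda>s. N s) \<longlongrightarrow> 0) (at t)" "\<And>s. L2_norm (f s) \<le> N s" "\<And>s. AE x in lebesgue. f s x = g s x"
  shows "((\<lambda>s. L2_norm (g s)) \<longlongrightarrow> 0) (at t)"
proof (rule Lim_null_comparison[OF _ assms(1)], intro always_eventually allI)
  show "norm (L2_norm (g s)) \<le> N s" for s
    using assms(2)[of s] L2_norm_cong_AE[OF assms(3)[of s]] by simp
qed

lemma has_time_deriv_cong_AE:
  assumes w: "has_time_deriv w w' t" and ae: "\<And>t. AE x in lebesgue. w t x = v t x" "AE x in lebesgue. w' x = v' x"
  shows "has_time_deriv v v' t"
proof -
  have "L2_norm (\<lambda>x. (w (t + h) x - w t x) / h - w' x) = L2_norm (\<lambda>x. (v (t + h) x - v t x) / h - v' x)" for h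
  proof (rule L2_norm_cong_AE)
    show "AE x in lebesgue. (w (t + h) x - w t x) / h - w' x = (v (t + h) x - v t x) / h - v' x"
      using ae(1)[of t] ae(1)[of "t + h"] ae(2) by eventually_elim simp
  qed
  then show ?thesis using w by (simp add: has_time_deriv_def)
qed

lemma resolvent_cong_AE:
  assumes "AE x in lebesgue. w x = v x"
  shows "resolvent k w = resolvent k v"
proof
  fix x
  have "AE y in lebesgue. k / 2 * exp (- k * \<bar>x - y\<bar>) * w y = k / 2 * exp (- k * \<bar>x - y\<bar>) * v y"
    using assms by eventually_elim simp
  then show "resolvent k w x = resolvent k v x" unfolding resolvent_def by (rule lebesgue_integral_cong_AE)
qed

text \<open>
  The norms of differences of solutions control those of the representatives and of their derivatives, which gives
  continuity in time; the bound at almost all times then extends to all times.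
\<close>

lemma global_solution_representatives:
  fixes u v :: "real \<Rightarrow> real \<Rightarrow> real"
  assumes p: "1 < p" and sol: "global_solution p u v" and bdd: "in_Linf_H1_H2 u v"
  obtains M u' ux v' vx vxx where "bounded_solution p M u' ux v' vx vxx"
    "\<And>t. AE x in lebesgue. u t x = u' t x" "\<And>t. AE x in lebesgue. v t x = v' t x"
    "\<And>t. AE x in lebesgue. weak_deriv (v t) x = vx t x"
proof -
  have C: "\<And>t. u t \<in> H1" "\<And>t. v t \<in> H2"
    "\<And>t. ((\<lambda>s. H1_norm (\<lambda>x. u s x - u t x)) \<longlongrightarrow> 0) (at t)"
    "\<And>t. ((\<lambda>s. H2_norm (\<lambda>x. v s x - v t x)) \<longlongrightarrow> 0) (at t)"
    using sol by (auto simp: global_solution_def in_C_H1_H2_def)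
  define ux where "ux t = weak_deriv (u t)" for t
  define vxx where "vxx t = weak_deriv (weak_deriv (v t))" for t
  have "\<exists>f. ac_deriv f (ux t) \<and> (AE x in lebesgue. u t x = f x) \<and> f \<in> L2 \<and> ux t \<in> L2" for t
    unfolding ux_def by (rule H1_ac_deriv[OF C(1)[of t]]) blast
  then obtain u' where u': "\<And>t. ac_deriv (u' t) (ux t)" "\<And>t. AE x in lebesgue. u t x = u' t x"
    "\<And>t. u' t \<in> L2" "\<And>t. ux t \<in> L2" by metis
  have "\<exists>f g. ac_deriv f g \<and> ac_deriv g (vxx t) \<and> (AE x in lebesgue. v t x = f x)
      \<and> (AE x in lebesgue. weak_deriv (v t) x = g x) \<and> f \<in> L2 \<and> g \<in> L2 \<and> vxx t \<in> L2" for t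
    unfolding vxx_def by (rule H2_ac_deriv[OF C(2)[of t]]) blast
  then have "\<forall>t. \<exists>f. \<exists>g. ac_deriv f g \<and> ac_deriv g (vxx t) \<and> (AE x in lebesgue. v t x = f x)
      \<and> (AE x in lebesgue. weak_deriv (v t) x = g x) \<and> f \<in> L2 \<and> g \<in> L2 \<and> vxx t \<in> L2"
    by blast
  from choice[OF this] obtain v' where "\<forall>t. \<exists>g. ac_deriv (v' t) g \<and> ac_deriv g (vxx t) \<and> (AE x in lebesgue. v t x = v' t x)
      \<and> (AE x in lebesgue. weak_deriv (v t) x = g x) \<and> v' t \<in> L2 \<and> g \<in> L2 \<and> vxx t \<in> L2" by blast
  from choice[OF this] obtain vx where v': "\<And>t. ac_deriv (v' t) (vx t)" "\<And>t. ac_deriv (vx t) (vxx t)"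
    "\<And>t. AE x in lebesgue. v t x = v' t x" "\<And>t. AE x in lebesgue. weak_deriv (v t) x = vx t x"
    "\<And>t. v' t \<in> L2" "\<And>t. vx t \<in> L2" "\<And>t. vxx t \<in> L2" by blast
  have du: "AE x in lebesgue. u s x - u t x = u' s x - u' t x" for s t
    using u'(2)[of s] u'(2)[of t] by eventually_elim simp
  have dux: "AE x in lebesgue. weak_deriv (\<lambda>x. u s x - u t x) x = ux s x - ux t x" for s t
    by (rule weak_deriv_ac_deriv[OF ac_deriv_diff[OF u'(1) u'(1)] du])
  have dv: "AE x in lebesgue. v s x - v t x = v' s x - v' t x" for s t
    using v'(3)[of s] v'(3)[of t] by eventually_elim simp
  have dvx: "AE x in lebesgue. weak_deriv (\<lambda>x. v s x - v t x) x = vx s x - vx t x" for s t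
    by (rule weak_deriv_ac_deriv[OF ac_deriv_diff[OF v'(1) v'(1)] dv])
  have dvxx: "AE x in lebesgue. weak_deriv (weak_deriv (\<lambda>x. v s x - v t x)) x = vxx s x - vxx t x" for s t
    by (rule weak_deriv_ac_deriv[OF ac_deriv_diff[OF v'(2) v'(2)] dvx])
  have cont: "((\<lambda>s. L2_norm (\<lambda>x. u' s x - u' t x)) \<longlongrightarrow> 0) (at t)"
    "((\<lambda>s. L2_norm (\<lambda>x. ux s x - ux t x)) \<longlongrightarrow> 0) (at t)"
    "((\<lambda>s. L2_norm (\<lambda>x. v' s x - v' t x)) \<longlongrightarrow> 0) (at t)"
    "((\<lambda>s. L2_norm (\<lambda>x. vx s x - vx t x)) \<longlongrightarrow> 0) (at t)"
    "((\<lambda>s. L2_norm (\<lambda>x. vxx s x - vxx t x)) \<longlongrightarrow> 0) (at t)" for t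
    by (rule L2_limit_0_cong[OF C(3) H1_norm_ge(1) du], rule L2_limit_0_cong[OF C(3) H1_norm_ge(2) dux],
        rule L2_limit_0_cong[OF C(4) H2_norm_ge(1) dv], rule L2_limit_0_cong[OF C(4) H2_norm_ge(2) dvx],
        rule L2_limit_0_cong[OF C(4) H2_norm_ge(3) dvxx])
  obtain M\<^sub>0 where M0: "AE t in lebesgue. u t \<in> H1 \<and> v t \<in> H2 \<and> H1_norm (u t) \<le> M\<^sub>0 \<and> H2_norm (v t) \<le> M\<^sub>0"
    using bdd by (auto simp: in_Linf_H1_H2_def)
  have n: "L2_norm (u' t) = L2_norm (u t)" "L2_norm (v' t) = L2_norm (v t)" "L2_norm (vx t) = L2_norm (weak_deriv (v t))" for t
    using L2_norm_cong_AE[OF u'(2)[of t]] L2_norm_cong_AE[OF v'(3)[of t]] L2_norm_cong_AE[OF v'(4)[of t]] by auto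
  have M: "L2_norm (u' t) \<le> M\<^sub>0 + 1" "L2_norm (ux t) \<le> M\<^sub>0 + 1" "L2_norm (v' t) \<le> M\<^sub>0 + 1"
    "L2_norm (vx t) \<le> M\<^sub>0 + 1" "L2_norm (vxx t) \<le> M\<^sub>0 + 1" for t
  proof -
    note ge = H1_norm_ge[of "u s" for s] H2_norm_ge[of "v s" for s]
    have "AE s in lebesgue. L2_norm (u' s) \<le> M\<^sub>0" using M0 by eventually_elim (use ge(1) n(1) order_trans in fastforce)
    then show "L2_norm (u' t) \<le> M\<^sub>0 + 1" by (rule L2_norm_bound_everywhere[OF _ u'(3) cont(1)])
    have "AE s in lebesgue. L2_norm (ux s) \<le> M\<^sub>0" unfolding ux_def using M0 by eventually_elim (use ge(2) order_trans in fastforce)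
    then show "L2_norm (ux t) \<le> M\<^sub>0 + 1" by (rule L2_norm_bound_everywhere[OF _ u'(4) cont(2)])
    have "AE s in lebesgue. L2_norm (v' s) \<le> M\<^sub>0" using M0 by eventually_elim (use ge(3) n(2) order_trans in fastforce)
    then show "L2_norm (v' t) \<le> M\<^sub>0 + 1" by (rule L2_norm_bound_everywhere[OF _ v'(5) cont(3)])
    have "AE s in lebesgue. L2_norm (vx s) \<le> M\<^sub>0" using M0 by eventually_elim (use ge(4) n(3) order_trans in fastforce)
    then show "L2_norm (vx t) \<le> M\<^sub>0 + 1" by (rule L2_norm_bound_everywhere[OF _ v'(6) cont(4)])
    have "AE s in lebesgue. L2_norm (vxx s) \<le> M\<^sub>0" unfolding vxx_def using M0 by eventually_elim (use ge(5) order_trans in fastforce)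
    then show "L2_norm (vxx t) \<le> M\<^sub>0 + 1" by (rule L2_norm_bound_everywhere[OF _ v'(7) cont(5)])
  qed
  have eq_u: "has_time_deriv u' (vx t) t" for t
  proof -
    have "has_time_deriv u (weak_deriv (v t)) t" using sol by (simp add: global_solution_def)
    then show ?thesis by (rule has_time_deriv_cong_AE[OF _ u'(2) v'(4)])
  qed
  have eq_v: "has_time_deriv v' (resolvent 1 (\<lambda>x. (1 + p * \<bar>u' t x\<bar> powr (p - 1)) * ux t x)) t" for t
  proof -
    let ?F = "\<lambda>x. u t x + \<bar>u t x\<bar> powr (p - 1) * u t x"
    let ?G = "\<lambda>x. (1 + p * \<bar>u' t x\<bar> powr (p - 1)) * ux t x"
    have "AE x in lebesgue. ?F x = u' t x + nonlin p (u' t x)"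
      using u'(2)[of t] by eventually_elim (simp add: nonlin_def)
    then have wd: "AE x in lebesgue. weak_deriv ?F x = ?G x"
      by (rule weak_deriv_ac_deriv[OF flux_ac_deriv[OF p u'(1)]])
    define b where "b = sqrt ((L2_norm (u' t))\<^sup>2 + (L2_norm (ux t))\<^sup>2)"
    have b: "\<bar>u' t x\<bar> \<le> b" for x
      unfolding b_def using ac_deriv_square_bound[OF u'(1,3,4), of t x] by (intro real_le_rsqrt) simp
    have "?G \<in> L2"
    proof (rule L2_bounded_mult[OF u'(4)])
      show "(\<lambda>x. 1 + p * \<bar>u' t x\<bar> powr (p - 1)) \<in> borel_measurable lebesgue"
        using L2_measurable[OF u'(3)[of t]] by measurable
      fix x
      have "\<bar>u' t x\<bar> powr (p - 1) \<le> b powr (p - 1)" using b[of x] p by (intro powr_mono2) auto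
      then have "p * \<bar>u' t x\<bar> powr (p - 1) \<le> p * b powr (p - 1)" using p by (intro mult_left_mono) auto
      moreover have "0 \<le> p * \<bar>u' t x\<bar> powr (p - 1)" using p by simp
      ultimately show "\<bar>1 + p * \<bar>u' t x\<bar> powr (p - 1)\<bar> \<le> 1 + p * b powr (p - 1)" by linarith
    qed
    moreover have "AE x in lebesgue. ?G x = weak_deriv ?F x" using wd by eventually_elim simp
    ultimately have wL: "weak_deriv ?F \<in> L2" by (rule L2_cong_AE)
    have "AE x in lebesgue. inv_helmholtz (weak_deriv ?F) x = resolvent 1 ?G x"
      using inv_helmholtz_AE[OF wL] unfolding resolvent_cong_AE[OF wd] .
    moreover have "has_time_deriv v (inv_helmholtz (weak_deriv ?F)) t"
      using sol by (simp add: global_solution_def)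
    ultimately show ?thesis using has_time_deriv_cong_AE[OF _ v'(3)] by simp
  qed
  have "bounded_solution p (M\<^sub>0 + 1) u' ux v' vx vxx"
    by unfold_locales (fact p u' v' M cont eq_u eq_v)+
  then show ?thesis using u'(2) v'(3,4) that by blast
qed

(* The integrand of the time integral need not have a sign, since u (1 - d_x^2)^{-1} u need not;
   has_integral over the half-line is the (gauge, hence possibly improper) integral. *)
theorem theorem1p2:
  fixes p :: real and u v :: "real \<Rightarrow> real \<Rightarrow> real"
  assumes "p > 1"
    and "global_solution p u v"
    and "in_Linf_H1_H2 u v"
  shows "(\<forall>\<^sub>F L in at_top.
            (\<forall>t\<ge>2. set_integrable lebesgue {-L..L} (virial_density p (u t) (v t))) \<and>
            (\<exists>C J. ((\<lambda>t. LINT x:{-L..L}|lebesgue. virial_density p (u t) (v t) x)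
                     has_integral J) {2..} \<and> J \<le> C))
       \<and> (\<forall>I. is_interval I \<and> bounded I \<longrightarrow>
            ((\<lambda>t. L2_H1_norm_on I (u t) (v t)) \<longlongrightarrow> 0) at_top)"
proof -
  obtain M u' ux v' vx vxx where sol: "bounded_solution p M u' ux v' vx vxx"
    and u': "\<And>t. AE x in lebesgue. u t x = u' t x" and v': "\<And>t. AE x in lebesgue. v t x = v' t x"
    and vx: "\<And>t. AE x in lebesgue. weak_deriv (v t) x = vx t x"
    using global_solution_representatives[OF assms] by blast
  interpret bounded_solution p M u' ux v' vx vxx by (rule sol)
  let ?d = "\<lambda>t x. v' t x * v' t x + u' t x * U t x + u' t x * nonlin p (u' t x)"
  have density: "AE x in lebesgue. virial_density p (u t) (v t) x = ?d t x" for t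
  proof -
    have "AE x in lebesgue. u' t x = u t x" using u'[of t] by eventually_elim simp
    then have uL: "u t \<in> L2" by (rule L2_cong_AE[OF L2(1)])
    have "AE x in lebesgue. inv_helmholtz (u t) x = U t x"
      using inv_helmholtz_AE[OF uL] unfolding U_def resolvent_cong_AE[OF u'] .
    with u'[of t] v'[of t] show ?thesis
      by eventually_elim (simp add: virial_density_def nonlin_mult_self p power2_eq_square)
  qed
  have integrable_density: "integrable lebesgue (?d t)" for t
    by (intro Bochner_Integration.integrable_add L2_integrable_mult L2 U_L2 nonlin_u_L2)
  have part1: "(\<forall>t\<ge>2. set_integrable lebesgue {-L..L} (virial_density p (u t) (v t))) \<and>
            (\<exists>C J. ((\<lambda>t. LINT x:{-L..L}|lebesgue. virial_density p (u t) (v t) x)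
                     has_integral J) {2..} \<and> J \<le> C)" if L: "large L" for L
  proof -
    let ?\<psi> = "indicator {-L..L} :: real \<Rightarrow> real"
    have ae: "AE x in lebesgue. ?\<psi> x *\<^sub>R ?d t x = ?\<psi> x *\<^sub>R virial_density p (u t) (v t) x" for t
      using density[of t] by eventually_elim simp
    have i: "integrable lebesgue (\<lambda>x. ?\<psi> x *\<^sub>R ?d t x)" for t
      by (intro integrable_mult_indicator integrable_density) simp
    have "set_integrable lebesgue {-L..L} (virial_density p (u t) (v t))" for t
      unfolding set_integrable_def by (rule lebesgue_integrable_cong_AE[OF i ae])
    moreover have "(LINT x:{-L..L}|lebesgue. virial_density p (u t) (v t) x)
        = ip (\<lambda>x. ?\<psi> x * v' t x) (v' t) + ip (\<lambda>x. ?\<psi> x * u' t x) (U t)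
          + ip (\<lambda>x. ?\<psi> x * u' t x) (\<lambda>x. nonlin p (u' t x))" for t
    proof -
      have \<psi>: "?\<psi> \<in> borel_measurable lebesgue" by (intro borel_measurable_indicator) simp
      have \<psi>L: "(\<lambda>x. ?\<psi> x * g x) \<in> L2" if "g \<in> L2" for g
        by (rule L2_bounded_mult[OF that \<psi> indicator_abs_le_1])
      have "(LINT x:{-L..L}|lebesgue. virial_density p (u t) (v t) x) = (LINT x|lebesgue. ?\<psi> x *\<^sub>R ?d t x)"
        unfolding set_lebesgue_integral_def by (rule lebesgue_integral_cong_AE[OF ae, symmetric])
      also have "\<dots> = (LINT x|lebesgue. ?\<psi> x * v' t x * v' t x + ?\<psi> x * u' t x * U t x
          + ?\<psi> x * u' t x * nonlin p (u' t x))"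
        by (simp add: algebra_simps)
      also have "\<dots> = ip (\<lambda>x. ?\<psi> x * v' t x) (v' t) + ip (\<lambda>x. ?\<psi> x * u' t x) (U t)
          + ip (\<lambda>x. ?\<psi> x * u' t x) (\<lambda>x. nonlin p (u' t x))"
        unfolding ip_def by (simp only: Bochner_Integration.integral_add Bochner_Integration.integrable_add
            L2_integrable_mult \<psi>L L2 U_L2 nonlin_u_L2)
      finally show ?thesis .
    qed
    ultimately show ?thesis using sharp_density_has_integral[OF L] by auto
  qed
  have part2: "((\<lambda>t. L2_H1_norm_on I (u t) (v t)) \<longlongrightarrow> 0) at_top" if I: "bounded I" for I
  proof -
    obtain L where L: "large L"
      using eventually_happens[OF eventually_large] by auto
    then have L0: "0 < L" by (simp add: large_def)
    obtain R where R: "\<And>x. x \<in> I \<Longrightarrow> \<bar>x\<bar> \<le> R" using I unfolding bounded_iff real_norm_def by blast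
    define K where "K = exp (R / L)"
    have K: "indicator I x \<le> K * decay L x" for x :: real
    proof (cases "x \<in> I")
      case True
      have "1 \<le> exp (R / L + - \<bar>x\<bar> / L)" using R[OF True] L0 by (simp add: divide_right_mono)
      then show ?thesis using True by (simp only: exp_add K_def decay_def indicator_simps)
    qed (simp add: K_def decay_def)
    let ?E = "\<lambda>t. K * (ip (\<lambda>x. decay L x * u' t x) (u' t) + ip (\<lambda>x. decay L x * v' t x) (v' t)
        + ip (\<lambda>x. decay L x * vx t x) (vx t))"
    have "(?E \<longlongrightarrow> K * (0 + 0 + 0)) at_top"
      by (intro tendsto_intros weighted_u_decays weighted_v_decays weighted_vx_decays L)
    then have lim: "((\<lambda>t. sqrt (?E t)) \<longlongrightarrow> 0) at_top"
      using tendsto_real_sqrt by fastforce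
    have "L2_H1_norm_on I (u t) (v t) \<le> sqrt (?E t)" for t
    proof -
      let ?q = "\<lambda>x. u' t x * u' t x + v' t x * v' t x + vx t x * vx t x"
      let ?r = "\<lambda>x. decay L x * u' t x * u' t x + decay L x * v' t x * v' t x + decay L x * vx t x * vx t x"
      have ir: "integrable lebesgue ?r"
        by (intro Bochner_Integration.integrable_add L2_integrable_mult decay_L2 L0 L2)
      have "(LINT x:I|lebesgue. (u t x)\<^sup>2 + (v t x)\<^sup>2 + (weak_deriv (v t) x)\<^sup>2) = (LINT x|lebesgue. indicator I x * ?q x)"
        unfolding set_lebesgue_integral_def
      proof (rule lebesgue_integral_cong_AE)
        show "AE x in lebesgue. indicator I x *\<^sub>R ((u t x)\<^sup>2 + (v t x)\<^sup>2 + (weak_deriv (v t) x)\<^sup>2) = indicator I x * ?q x"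
          using u'[of t] v'[of t] vx[of t] by eventually_elim (simp add: power2_eq_square)
      qed
      also have "\<dots> \<le> (LINT x|lebesgue. K * ?r x)"
      proof (rule integral_mono')
        show "integrable lebesgue (\<lambda>x. K * ?r x)" using ir by (rule integrable_mult_right)
        fix x
        have q: "0 \<le> ?q x" by simp
        have "indicator I x * ?q x \<le> K * decay L x * ?q x" by (rule mult_right_mono[OF K q])
        also have "\<dots> = K * ?r x" by (simp add: algebra_simps)
        finally show "indicator I x * ?q x \<le> K * ?r x" .
        then show "0 \<le> K * ?r x" using q by (meson indicator_pos_le mult_nonneg_nonneg order_trans)
      qed
      also have "\<dots> = ?E t"
        unfolding ip_def by (simp only: integral_mult_right_zero Bochner_Integration.integral_add
            Bochner_Integration.integrable_add L2_integrable_mult decay_L2[OF L0] L2)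
      finally show ?thesis unfolding L2_H1_norm_on_def by (rule real_sqrt_le_mono)
    qed
    moreover have "0 \<le> L2_H1_norm_on I (u t) (v t)" for t
      unfolding L2_H1_norm_on_def set_lebesgue_integral_def
      by (intro real_sqrt_ge_zero Bochner_Integration.integral_nonneg) simp
    ultimately show ?thesis by (intro Lim_null_comparison[OF _ lim]) auto
  qed
  show ?thesis
  proof (intro conjI allI impI)
    show "\<forall>\<^sub>F L in at_top. (\<forall>t\<ge>2. set_integrable lebesgue {-L..L} (virial_density p (u t) (v t))) \<and>
            (\<exists>C J. ((\<lambda>t. LINT x:{-L..L}|lebesgue. virial_density p (u t) (v t) x)
                     has_integral J) {2..} \<and> J \<le> C)"
      by (rule eventually_mono[OF eventually_large part1])
    show "((\<lambda>t. L2_H1_norm_on I (u t) (v t)) \<longlongrightarrow> 0) at_top" if "is_interval I \<and> bounded I" for I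
      using that by (intro part2) simp
  qed
qed

end
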